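(* Let $p>0$, and let $E\to X$ be a holomorphic vector bundle over a complex manifold $X$, endowed with a singular Finsler metric $h$ such that $|u|_{h^*}$ is upper semi-continuous for every local holomorphic section $u$ of $E^*$. Assume that $(E,h)$ satisfies the multiple coarse $L^p$ extension property, i.e. there are constants $C_m>0$ ($m\ge 1$) with $\lim_{m\to\infty}\frac{\log C_m}{m}=0$ such that for each $m\ge 1$, every $x\in X$ and every $a\in E_x\setminus\{0\}$ there is $s\in H^p(X,E^{\otimes m},h^{\otimes m})$ with $$s(x)=a^{\otimes m},\qquad \|s\|_{L^p(h^{\otimes m})}^p\le C_m\,|a|_{h(x)}^{pm}.$$ For each $m\ge1$ define $h_m^*$ on $E^*$ by $$|u|_{h_m^*}:=\left(\Big(\sup_{s\in H^p(X,E^{\otimes m},h^{\otimes m}),\ \|s\|_{L^p(h^{\otimes m})}\le1}|\langle u^{\otimes m},s(x)\rangle|\Big)^{*}\right)^{1/m},\qquad u\in E_x^*,$$ where the outer $(\cdot)^*$ denotes upper semi-continuous regularization. Then $h_m^*$ is a well-defined singular Finsler metric on $E^*$, it is Griffiths semi-negative, and for every local holomorphic section $u$ of $E^*$, every $x\in X$ (in the domain of $u$), and every sufficiently small $r>0$, $$C_m^{-1/(pm)}\,|u|_{h^*}(x)\ \le\ |u|_{h_m^*}(x)\ \le\ C_r^{1/(pm)}\sup_{B(x,r)}|u|_{h^*},\qquad C_r:=\frac{1}{\operatorname{Vol}(B(x,r))}.$$ Moreover, for every local holomorphic section $u$ of $E^*$, $|u|_{h_m^*}\to|u|_{h^*}$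 pointwise and in $L^1_{\mathrm{loc}}$ as $m\to\infty$.
   Context: A singular Finsler metric $h$ on a holomorphic vector bundle $E\to X$ is a function $|\cdot|_h:E\to[0,+\infty]$, homogeneous of degree one on each fiber ($|\lambda v|_h=|\lambda||v|_h$), finite almost everywhere and positive on non-zero vectors almost everywhere. The dual Finsler metric $h^*$ on $E^*$ is $$|u|_{h^*}^2=\sup_{v\in E_x\setminus\{0\}}\frac{|\langle u,v\rangle|^2}{|v|_h^2},\qquad u\in E_x^*.$$ A singular Finsler metric on a bundle is Griffiths semi-negative if for every local holomorphic section $s$ of that bundle the function $|s|^2$ (norm squared in the metric) is plurisubharmonic. $H^p(X,E,h)$ denotes the space of holomorphic sections $s$ of $E$ with $\|s\|_{L^p(h)}<+\infty$, where $\|s\|_{L^p(h)}^p=\int_X|s|_h^p\,dV$; likewise for $(E^{\otimes m},h^{\otimes m})$. Here $h^{\otimes m}$ is the metric induced by $h$ on $E^{\otimes m}$ (the usual tensor power metric if $h$ is Hermitian); it satisfies the duality inequality $|\langle u^{\otimes m},s\rangle|\le|u|_{h^*}^m\,|s|_{h^{\otimes m}}$ for $u\in E_x^*$, $s\in E_x^{\otimes m}$. $B(x,r)$ is the ball of radius $r$ about $x$ in a local holomorphic coordinate chart, relatively compact in the chart. The same measure $dV$ is used in the $L^p$ norms and in $\operatorname{Vol}(B(x,r))$; in the coordinate chart it is Lebesgue measure. The upper semi-continuous regularization is that of the function $u\mapsto\sup_s|\langle u^{\otimes m},s(x)\rangle|$ on the total space of $E^*$. *)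

theory Defs
  imports "HOL-Analysis.Analysis"
begin

section \<open>Complex manifolds\<close>

definition holomorphic_Cn :: "(complex ^ 'n) set \<Rightarrow> (complex ^ 'n \<Rightarrow> complex) \<Rightarrow> bool" where
  "holomorphic_Cn S f \<longleftrightarrow>
     (\<forall>z\<in>S. \<exists>D. (f has_derivative D) (at z) \<and> (\<forall>c v. D (c *s v) = c * D v))"

type_synonym ('x, 'n) chart = "'x set \<times> ('x \<Rightarrow> complex ^ 'n)"

definition is_chart :: "('x::topological_space, 'n::finite) chart \<Rightarrow> bool" where
  "is_chart c \<longleftrightarrow> (case c of (U, \<phi>) \<Rightarrow>
     open U \<and> open (\<phi> ` U) \<and> homeomorphism U (\<phi> ` U) \<phi> (inv_into U \<phi>))"

definition holo_transition :: "('x, 'n) chart \<Rightarrow> ('x, 'n::finite) chart \<Rightarrow> bool" where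
  "holo_transition c d \<longleftrightarrow> (case c of (U, \<phi>) \<Rightarrow> case d of (V, \<psi>) \<Rightarrow>
     \<forall>j. holomorphic_Cn (\<phi> ` (U \<inter> V)) (\<lambda>z. \<psi> (inv_into U \<phi> z) $ j))"

text \<open>A complex manifold structure of dimension \<open>CARD('n)\<close> on the whole type \<open>'x\<close>; in the statement
  \<open>'x\<close> is Hausdorff and second countable.\<close>

definition complex_atlas :: "('x::topological_space, 'n::finite) chart set \<Rightarrow> bool" where
  "complex_atlas \<A> \<longleftrightarrow>
     (\<forall>c\<in>\<A>. is_chart c) \<and> (\<Union>c\<in>\<A>. fst c) = UNIV \<and> (\<forall>c\<in>\<A>. \<forall>d\<in>\<A>. holo_transition c d)"

text \<open>All holomorphic coordinate charts, i.e. the maximal atlas.\<close>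

definition holo_charts :: "('x::topological_space, 'n::finite) chart set \<Rightarrow> ('x, 'n) chart set" where
  "holo_charts \<A> = {c. is_chart c \<and> (\<forall>d\<in>\<A>. holo_transition c d \<and> holo_transition d c)}"

definition holo_fun ::
  "('x::topological_space, 'n::finite) chart set \<Rightarrow> 'x set \<Rightarrow> ('x \<Rightarrow> complex) \<Rightarrow> bool" where
  "holo_fun \<A> W f \<longleftrightarrow> (\<forall>(U, \<phi>)\<in>\<A>. holomorphic_Cn (\<phi> ` (U \<inter> W)) (\<lambda>z. f (inv_into U \<phi> z)))"

text \<open>A volume form: around every point, in some holomorphic chart, \<open>dV\<close> has a positive continuous
  density with respect to Lebesgue measure (by change of variables this is then so in every chart).\<close>

definition volume_measure ::
  "('x::topological_space, 'n::finite) chart set \<Rightarrow> 'x measure \<Rightarrow> bool" where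
  "volume_measure \<A> dV \<longleftrightarrow> sets dV = sets borel \<and>
     (\<forall>x. \<exists>(U, \<phi>)\<in>holo_charts \<A>. x \<in> U \<and>
        (\<exists>\<rho>::complex ^ 'n \<Rightarrow> real. continuous_on (\<phi> ` U) \<rho> \<and> (\<forall>z\<in>\<phi> ` U. \<rho> z > 0) \<and>
           (\<forall>A\<in>sets borel. A \<subseteq> U \<longrightarrow>
              emeasure dV A = (\<integral>\<^sup>+z\<in>\<phi> ` A. ennreal (\<rho> z) \<partial>lborel))))"

definition lebesgue_chart ::
  "('x::topological_space, 'n::finite) chart set \<Rightarrow> 'x measure \<Rightarrow> ('x, 'n) chart \<Rightarrow> bool" where
  "lebesgue_chart \<A> dV c \<longleftrightarrow> c \<in> holo_charts \<A> \<and> (case c of (U, \<phi>) \<Rightarrow>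
     \<forall>A\<in>sets borel. A \<subseteq> U \<longrightarrow> emeasure dV A = emeasure lborel (\<phi> ` A))"

definition coord_ball :: "('x, 'n::finite) chart \<Rightarrow> 'x \<Rightarrow> real \<Rightarrow> 'x set" where
  "coord_ball c x r = (case c of (U, \<phi>) \<Rightarrow> {y\<in>U. \<phi> y \<in> ball (\<phi> x) r})"


section \<open>Semicontinuous and plurisubharmonic functions\<close>

text \<open>Real powers \<open>x\<^sup>a\<close>, \<open>a > 0\<close>, on \<open>[0,\<infinity>]\<close>.\<close>

definition epow :: "ennreal \<Rightarrow> real \<Rightarrow> ennreal" where
  "epow x a = (if x = \<infinity> then \<infinity> else ennreal (enn2real x powr a))"

text \<open>As usual in pluripotential theory, an upper semicontinuous function does not take the
  value \<open>+\<infinity>\<close>.\<close>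

definition usc_on :: "'x::topological_space set \<Rightarrow> ('x \<Rightarrow> ennreal) \<Rightarrow> bool" where
  "usc_on W f \<longleftrightarrow>
     (\<forall>x\<in>W. f x < \<infinity> \<and> (\<forall>c. f x < c \<longrightarrow> (\<forall>\<^sub>F y in at x within W. f y < c)))"

text \<open>Only nonnegative functions are needed; the second clause is the mean value inequality on closed
  discs in complex lines, read in the charts.\<close>

definition psh_on ::
  "('x::topological_space, 'n::finite) chart set \<Rightarrow> 'x set \<Rightarrow> ('x \<Rightarrow> ennreal) \<Rightarrow> bool" where
  "psh_on \<A> W f \<longleftrightarrow> usc_on W f \<and>
     (\<forall>(U, \<phi>)\<in>\<A>. \<forall>z w. (\<forall>\<zeta>. cmod \<zeta> \<le> 1 \<longrightarrow> z + \<zeta> *s w \<in> \<phi> ` (U \<inter> W)) \<longrightarrow>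
        f (inv_into U \<phi> z) \<le>
          ennreal (1 / (2 * pi)) * (\<integral>\<^sup>+\<theta>\<in>{0..2 * pi}. f (inv_into U \<phi> (z + cis \<theta> *s w)) \<partial>lborel))"

definition L1loc :: "'x::topological_space measure \<Rightarrow> 'x set \<Rightarrow> ('x \<Rightarrow> ennreal) \<Rightarrow> bool" where
  "L1loc dV W f \<longleftrightarrow> (\<forall>K. compact K \<and> K \<subseteq> W \<longrightarrow>
     (AE x in dV. x \<in> K \<longrightarrow> f x < \<infinity>) \<and> set_integrable dV K (\<lambda>x. enn2real (f x)))"

definition L1loc_tendsto ::
  "'x::topological_space measure \<Rightarrow> 'x set \<Rightarrow> (nat \<Rightarrow> 'x \<Rightarrow> ennreal) \<Rightarrow> ('x \<Rightarrow> ennreal) \<Rightarrow> bool" where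
  "L1loc_tendsto dV W F f \<longleftrightarrow> L1loc dV W f \<and> (\<forall>\<^sub>F m in sequentially. L1loc dV W (F m)) \<and>
     (\<forall>K. compact K \<and> K \<subseteq> W \<longrightarrow>
        (\<lambda>m. \<integral>x\<in>K. \<bar>enn2real (F m x) - enn2real (f x)\<bar> \<partial>dV) \<longlonglongrightarrow> 0)"


section \<open>Holomorphic vector bundles\<close>

text \<open>\<open>vb_tot\<close> is the total space and \<open>vb_triv\<close> the set of local trivializations \<open>(U, \<tau>)\<close>, where
  \<open>e \<mapsto> (vb_proj e, \<tau> e)\<close> maps the part of the total space over \<open>U\<close> to \<open>U \<times> \<complex>\<^sup>I\<close>, with \<open>I = vb_idx\<close> a
  finite index set (so the rank is \<open>card I\<close>). Only the coordinates \<open>\<tau> e i\<close> with \<open>i \<in> I\<close> matter.\<close>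

record ('x, 'e, 'i) vbundle =
  vb_tot :: "'e set"
  vb_proj :: "'e \<Rightarrow> 'x"
  vb_add :: "'e \<Rightarrow> 'e \<Rightarrow> 'e"
  vb_scale :: "complex \<Rightarrow> 'e \<Rightarrow> 'e"
  vb_idx :: "'i set"
  vb_triv :: "('x set \<times> ('e \<Rightarrow> 'i \<Rightarrow> complex)) set"

definition fiber :: "('x, 'e, 'i) vbundle \<Rightarrow> 'x \<Rightarrow> 'e set" where
  "fiber F x = {e \<in> vb_tot F. vb_proj F e = x}"

definition fiber_nz :: "('x, 'e, 'i) vbundle \<Rightarrow> 'x \<Rightarrow> 'e set" where
  "fiber_nz F x = {e \<in> fiber F x. e \<noteq> vb_scale F 0 e}"

text \<open>The vector space axioms in the fibers follow from the linearity and bijectivity of the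
  trivializations.\<close>

definition holomorphic_vector_bundle ::
  "('x::topological_space, 'n::finite) chart set \<Rightarrow> ('x, 'e, 'i) vbundle \<Rightarrow> bool" where
  "holomorphic_vector_bundle \<A> F \<longleftrightarrow>
     finite (vb_idx F) \<and>
     (\<forall>x. \<forall>a\<in>fiber F x. (\<forall>b\<in>fiber F x. vb_add F a b \<in> fiber F x) \<and>
                        (\<forall>c. vb_scale F c a \<in> fiber F x)) \<and>
     (\<Union>t\<in>vb_triv F. fst t) = UNIV \<and>
     (\<forall>(U, \<tau>)\<in>vb_triv F. open U \<and> (\<forall>x\<in>U.
        (\<forall>z::'i \<Rightarrow> complex. \<exists>!e. e \<in> fiber F x \<and> (\<forall>i\<in>vb_idx F. \<tau> e i = z i)) \<and>
        (\<forall>a\<in>fiber F x. \<forall>i\<in>vb_idx F.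
           (\<forall>b\<in>fiber F x. \<tau> (vb_add F a b) i = \<tau> a i + \<tau> b i) \<and>
           (\<forall>c. \<tau> (vb_scale F c a) i = c * \<tau> a i)))) \<and>
     (\<forall>(U, \<tau>)\<in>vb_triv F. \<forall>(V, \<sigma>)\<in>vb_triv F. \<exists>g::'x \<Rightarrow> 'i \<Rightarrow> 'i \<Rightarrow> complex.
        (\<forall>i\<in>vb_idx F. \<forall>j\<in>vb_idx F. holo_fun \<A> (U \<inter> V) (\<lambda>x. g x i j)) \<and>
        (\<forall>x\<in>U \<inter> V. \<forall>e\<in>fiber F x. \<forall>i\<in>vb_idx F. \<sigma> e i = (\<Sum>j\<in>vb_idx F. g x i j * \<tau> e j)))"

definition holo_section ::
  "('x::topological_space, 'n::finite) chart set \<Rightarrow> ('x, 'e, 'i) vbundle \<Rightarrow> 'x set \<Rightarrow> ('x \<Rightarrow> 'e) \<Rightarrow> bool"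
  where
  "holo_section \<A> F W s \<longleftrightarrow> open W \<and> (\<forall>x\<in>W. s x \<in> fiber F x) \<and>
     (\<forall>(U, \<tau>)\<in>vb_triv F. \<forall>i\<in>vb_idx F. holo_fun \<A> (U \<inter> W) (\<lambda>x. \<tau> (s x) i))"

text \<open>The sets \<open>{e. vb_proj e \<in> V, \<tau> e \<in> \<Prod>\<^sub>i B\<^sub>i}\<close> generate the topology of the total space for which the
  trivializations are homeomorphisms.\<close>

definition tot_topology :: "('x::topological_space, 'e, 'i) vbundle \<Rightarrow> 'e topology" where
  "tot_topology F = topology_generated_by
     {{e \<in> vb_tot F. vb_proj F e \<in> V \<and> (\<forall>i\<in>vb_idx F. \<tau> e i \<in> B i)} | U \<tau> V B.
        (U, \<tau>) \<in> vb_triv F \<and> open V \<and> V \<subseteq> U \<and> (\<forall>i. open (B i))}"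

definition usc_reg ::
  "('x::topological_space, 'e, 'i) vbundle \<Rightarrow> ('e \<Rightarrow> ennreal) \<Rightarrow> 'e \<Rightarrow> ennreal" where
  "usc_reg F f e = (INF N\<in>{N. openin (tot_topology F) N \<and> e \<in> N}. SUP e'\<in>N. f e')"

subsection \<open>The dual bundle\<close>

text \<open>Elements of \<open>F\<^sub>x\<^sup>*\<close> are functionals extended by \<open>0\<close> outside \<open>F\<^sub>x\<close>.\<close>

definition covectors :: "('x, 'e, 'i) vbundle \<Rightarrow> 'x \<Rightarrow> ('e \<Rightarrow> complex) set" where
  "covectors F x = {\<xi>.
     (\<forall>a\<in>fiber F x. (\<forall>b\<in>fiber F x. \<xi> (vb_add F a b) = \<xi> a + \<xi> b) \<and>
                    (\<forall>c. \<xi> (vb_scale F c a) = c * \<xi> a)) \<and>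
     (\<forall>a. a \<notin> fiber F x \<longrightarrow> \<xi> a = 0)}"

text \<open>The local frame of \<open>F\<close> belonging to a trivialization \<open>\<tau>\<close>, and its dual frame.\<close>

definition frame ::
  "('x, 'e, 'i) vbundle \<Rightarrow> ('e \<Rightarrow> 'i \<Rightarrow> complex) \<Rightarrow> 'x \<Rightarrow> 'i \<Rightarrow> 'e" where
  "frame F \<tau> x i =
     (THE e. e \<in> fiber F x \<and> (\<forall>j\<in>vb_idx F. \<tau> e j = (if j = i then 1 else 0)))"

definition coframe ::
  "('x, 'e, 'i) vbundle \<Rightarrow> ('e \<Rightarrow> 'i \<Rightarrow> complex) \<Rightarrow> 'x \<Rightarrow> 'i \<Rightarrow> 'e \<Rightarrow> complex" where
  "coframe F \<tau> x i = (\<lambda>e. if e \<in> fiber F x then \<tau> e i else 0)"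

definition dual_bundle :: "('x, 'e, 'i) vbundle \<Rightarrow> ('x, 'x \<times> ('e \<Rightarrow> complex), 'i) vbundle" where
  "dual_bundle F = \<lparr>
     vb_tot = {(x, \<xi>). \<xi> \<in> covectors F x},
     vb_proj = fst,
     vb_add = (\<lambda>(x, \<xi>) (y, \<eta>). (x, \<lambda>e. \<xi> e + \<eta> e)),
     vb_scale = (\<lambda>c (x, \<xi>). (x, \<lambda>e. c * \<xi> e)),
     vb_idx = vb_idx F,
     vb_triv = {(U, \<lambda>(x, \<xi>) i. \<xi> (frame F \<tau> x i)) | U \<tau>. (U, \<tau>) \<in> vb_triv F}\<rparr>"

subsection \<open>Tensor powers\<close>

text \<open>Since the fibers are finite-dimensional, \<open>F\<^sub>x\<^sup>\<otimes>\<^sup>m\<close> is realized as the space of \<open>m\<close>-linear forms on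
  \<open>F\<^sub>x\<^sup>*\<close>, with \<open>a\<^sub>1 \<otimes> \<dots> \<otimes> a\<^sub>m\<close> acting by \<open>(\<xi>\<^sub>1, \<dots>, \<xi>\<^sub>m) \<mapsto> \<Prod>\<^sub>k \<xi>\<^sub>k(a\<^sub>k)\<close>. A form takes a list of \<open>m\<close> covectors
  and is extended by \<open>0\<close> to all other lists.\<close>

definition tensors ::
  "('x, 'e, 'i) vbundle \<Rightarrow> nat \<Rightarrow> 'x \<Rightarrow> (('e \<Rightarrow> complex) list \<Rightarrow> complex) set" where
  "tensors F m x = {T.
     (\<forall>us k. length us = m \<and> set us \<subseteq> covectors F x \<and> k < m \<longrightarrow>
        (\<forall>\<xi>\<in>covectors F x.
           (\<forall>\<eta>\<in>covectors F x. T (us[k := (\<lambda>e. \<xi> e + \<eta> e)]) = T (us[k := \<xi>]) + T (us[k := \<eta>])) \<and>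
           (\<forall>c. T (us[k := (\<lambda>e. c * \<xi> e)]) = c * T (us[k := \<xi>])))) \<and>
     (\<forall>us. \<not> (length us = m \<and> set us \<subseteq> covectors F x) \<longrightarrow> T us = 0)}"

text \<open>The trivialization of the tensor power gives the coordinates in the basis
  \<open>e\<^sub>j\<^sub>1 \<otimes> \<dots> \<otimes> e\<^sub>j\<^sub>m\<close> made of the frame \<open>e\<close>.\<close>

definition tensor_power ::
  "('x, 'e, 'i) vbundle \<Rightarrow> nat \<Rightarrow>
   ('x, 'x \<times> (('e \<Rightarrow> complex) list \<Rightarrow> complex), 'i list) vbundle" where
  "tensor_power F m = \<lparr>
     vb_tot = {(x, T). T \<in> tensors F m x},
     vb_proj = fst,
     vb_add = (\<lambda>(x, S) (y, T). (x, \<lambda>us. S us + T us)),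
     vb_scale = (\<lambda>c (x, T). (x, \<lambda>us. c * T us)),
     vb_idx = {J. length J = m \<and> set J \<subseteq> vb_idx F},
     vb_triv = {(U, \<lambda>(x, T) J. T (map (coframe F \<tau> x) J)) | U \<tau>. (U, \<tau>) \<in> vb_triv F}\<rparr>"

text \<open>\<open>a\<^sup>\<otimes>\<^sup>m\<close> for \<open>a\<close> in \<open>F\<close>, and the pairing \<open>\<langle>u\<^sup>\<otimes>\<^sup>m, t\<rangle>\<close> for \<open>u\<close> in \<open>F\<^sup>*\<close> and \<open>t\<close> in the tensor power.\<close>

definition vec_tpow ::
  "('x, 'e, 'i) vbundle \<Rightarrow> nat \<Rightarrow> 'e \<Rightarrow> 'x \<times> (('e \<Rightarrow> complex) list \<Rightarrow> complex)" where
  "vec_tpow F m a = (vb_proj F a, \<lambda>us.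
     if length us = m \<and> set us \<subseteq> covectors F (vb_proj F a) then prod_list (map (\<lambda>\<xi>. \<xi> a) us) else 0)"

definition tpairing ::
  "nat \<Rightarrow> 'x \<times> ('e \<Rightarrow> complex) \<Rightarrow> 'x \<times> (('e \<Rightarrow> complex) list \<Rightarrow> complex) \<Rightarrow> complex" where
  "tpairing m u t = snd t (replicate m (snd u))"


section \<open>Singular Finsler metrics\<close>

definition singular_finsler_metric ::
  "'x measure \<Rightarrow> ('x, 'e, 'i) vbundle \<Rightarrow> ('e \<Rightarrow> ennreal) \<Rightarrow> bool" where
  "singular_finsler_metric dV F h \<longleftrightarrow>
     (\<forall>v\<in>vb_tot F. \<forall>c. h (vb_scale F c v) = ennreal (cmod c) * h v) \<and>
     (AE x in dV. \<forall>v\<in>fiber F x. h v < \<infinity>) \<and>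
     (AE x in dV. \<forall>v\<in>fiber_nz F x. h v > 0)"

text \<open>In \<open>ennreal\<close>: \<open>a / 0 = \<infinity>\<close> for \<open>a > 0\<close>, \<open>0 / 0 = 0\<close> and \<open>a / \<infinity> = 0\<close> for \<open>a < \<infinity>\<close>.\<close>

definition dual_metric ::
  "('x, 'e, 'i) vbundle \<Rightarrow> ('e \<Rightarrow> ennreal) \<Rightarrow> 'x \<times> ('e \<Rightarrow> complex) \<Rightarrow> ennreal" where
  "dual_metric F h = (\<lambda>(x, \<xi>).
     epow (SUP v\<in>fiber_nz F x. (ennreal (cmod (\<xi> v)))\<^sup>2 / (h v)\<^sup>2) (1 / 2))"

definition griffiths_seminegative ::
  "('x::topological_space, 'n::finite) chart set \<Rightarrow> ('x, 'e, 'i) vbundle \<Rightarrow> ('e \<Rightarrow> ennreal) \<Rightarrow> bool" where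
  "griffiths_seminegative \<A> F h \<longleftrightarrow>
     (\<forall>W s. holo_section \<A> F W s \<longrightarrow> psh_on \<A> W (\<lambda>x. (h (s x))\<^sup>2))"

text \<open>\<open>\<xi>\<close> is the dual of a basis of \<open>F\<^sub>x\<close> that is orthonormal for \<open>h\<close>; such a \<open>\<xi>\<close> exists iff \<open>h\<close> restricted to
  \<open>F\<^sub>x\<close> is the norm of a Hermitian inner product.\<close>

definition unitary_coframe ::
  "('x, 'e, 'i) vbundle \<Rightarrow> ('e \<Rightarrow> ennreal) \<Rightarrow> 'x \<Rightarrow> ('i \<Rightarrow> 'e \<Rightarrow> complex) \<Rightarrow> bool" where
  "unitary_coframe F h x \<xi> \<longleftrightarrow>
     (\<forall>i\<in>vb_idx F. \<xi> i \<in> covectors F x) \<and>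
     (\<forall>z::'i \<Rightarrow> complex. \<exists>!v. v \<in> fiber F x \<and> (\<forall>i\<in>vb_idx F. \<xi> i v = z i)) \<and>
     (\<forall>v\<in>fiber F x. (h v)\<^sup>2 = ennreal (\<Sum>i\<in>vb_idx F. (cmod (\<xi> i v))\<^sup>2))"

text \<open>The induced metric \<open>k = h\<^sup>\<otimes>\<^sup>m\<close> on \<open>F\<^sup>\<otimes>\<^sup>m\<close>: any singular Finsler metric that is the usual tensor power
  metric where \<open>h\<close> is Hermitian and that satisfies \<open>\<bar>\<langle>u\<^sup>\<otimes>\<^sup>m, t\<rangle>\<bar> \<le> \<bar>u\<bar>\<^sub>h\<^sub>*\<^sup>m \<bar>t\<bar>\<^sub>k\<close>. The inequality is not imposed
  when \<open>\<bar>t\<bar>\<^sub>k = \<infinity>\<close>, where the convention \<open>0 * \<infinity> = 0\<close> of \<open>ennreal\<close> would make it a wrong constraint.\<close>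

definition tensor_power_metric ::
  "'x measure \<Rightarrow> ('x, 'e, 'i) vbundle \<Rightarrow> ('e \<Rightarrow> ennreal) \<Rightarrow> nat \<Rightarrow>
   ('x \<times> (('e \<Rightarrow> complex) list \<Rightarrow> complex) \<Rightarrow> ennreal) \<Rightarrow> bool" where
  "tensor_power_metric dV F h m k \<longleftrightarrow>
     singular_finsler_metric dV (tensor_power F m) k \<and>
     (\<forall>x \<xi>. unitary_coframe F h x \<xi> \<longrightarrow> (\<forall>T\<in>tensors F m x.
        (k (x, T))\<^sup>2 = ennreal (\<Sum>J\<in>vb_idx (tensor_power F m). (cmod (T (map \<xi> J)))\<^sup>2))) \<and>
     (\<forall>x. \<forall>u\<in>fiber (dual_bundle F) x. \<forall>t\<in>fiber (tensor_power F m) x. k t < \<infinity> \<longrightarrow>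
        ennreal (cmod (tpairing m u t)) \<le> (dual_metric F h u) ^ m * k t)"

definition Lp_norm :: "'x measure \<Rightarrow> real \<Rightarrow> ('e \<Rightarrow> ennreal) \<Rightarrow> ('x \<Rightarrow> 'e) \<Rightarrow> ennreal" where
  "Lp_norm dV p h s = epow (\<integral>\<^sup>+x. epow (h (s x)) p \<partial>dV) (1 / p)"

definition Hp ::
  "('x::topological_space, 'n::finite) chart set \<Rightarrow> 'x measure \<Rightarrow> real \<Rightarrow> ('x, 'e, 'i) vbundle \<Rightarrow>
   ('e \<Rightarrow> ennreal) \<Rightarrow> ('x \<Rightarrow> 'e) set" where
  "Hp \<A> dV p F h = {s. holo_section \<A> F UNIV s \<and> Lp_norm dV p h s < \<infinity>}"

text \<open>Here \<open>ht m\<close> is the metric \<open>h\<^sup>\<otimes>\<^sup>m\<close>.\<close>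

definition multiple_coarse_Lp_extension ::
  "('x::topological_space, 'n::finite) chart set \<Rightarrow> 'x measure \<Rightarrow> real \<Rightarrow> ('x, 'e, 'i) vbundle \<Rightarrow>
   ('e \<Rightarrow> ennreal) \<Rightarrow> (nat \<Rightarrow> 'x \<times> (('e \<Rightarrow> complex) list \<Rightarrow> complex) \<Rightarrow> ennreal) \<Rightarrow> (nat \<Rightarrow> real) \<Rightarrow> bool"
  where
  "multiple_coarse_Lp_extension \<A> dV p E h ht C \<longleftrightarrow>
     (\<forall>m\<ge>1. C m > 0) \<and> (\<lambda>m. ln (C m) / real m) \<longlonglongrightarrow> 0 \<and>
     (\<forall>m\<ge>1. \<forall>x. \<forall>a\<in>fiber_nz E x. \<exists>s\<in>Hp \<A> dV p (tensor_power E m) (ht m).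
        s x = vec_tpow E m a \<and>
        epow (Lp_norm dV p (ht m) s) p \<le> ennreal (C m) * epow (h a) (p * real m))"

definition hm_dual ::
  "('x::topological_space, 'n::finite) chart set \<Rightarrow> 'x measure \<Rightarrow> real \<Rightarrow> ('x, 'e, 'i) vbundle \<Rightarrow>
   (nat \<Rightarrow> 'x \<times> (('e \<Rightarrow> complex) list \<Rightarrow> complex) \<Rightarrow> ennreal) \<Rightarrow> nat \<Rightarrow>
   'x \<times> ('e \<Rightarrow> complex) \<Rightarrow> ennreal" where
  "hm_dual \<A> dV p E ht m u =
     epow (usc_reg (dual_bundle E)
        (\<lambda>v. SUP s\<in>{s \<in> Hp \<A> dV p (tensor_power E m) (ht m). Lp_norm dV p (ht m) s \<le> 1}.
               ennreal (cmod (tpairing m v (s (fst v))))) u)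
       (1 / real m)"

end

theory Submission
  imports Defs "HOL-Complex_Analysis.Complex_Analysis" "HOL-Real_Asymp.Real_Asymp"
    "HOL-Computational_Algebra.Fundamental_Theorem_Algebra"
begin

text \<open>The metric \<open>h\<^sub>m\<^sup>*\<close> is the \<open>m\<close>-th root of the upper semicontinuous regularization of
\<open>F\<^sub>m(\<xi>) = sup\<^sub>s \<bar>\<langle>\<xi>\<^sup>\<otimes>\<^sup>m, s(x)\<rangle>\<bar>\<close>, \<open>\<xi> \<in> E\<^sub>x\<^sup>*\<close>, with \<open>s\<close> in the unit ball of \<open>H\<^sup>p(X, E\<^sup>\<otimes>\<^sup>m, h\<^sup>\<otimes>\<^sup>m)\<close>. Everything rests
on two properties of the pairings \<open>\<langle>u\<^sup>\<otimes>\<^sup>m, s\<rangle>\<close> with a holomorphic section \<open>u\<close> of \<open>E\<^sup>*\<close>: they are holomorphic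
functions, and by duality they are bounded by \<open>\<bar>u\<bar>\<^sup>m \<bar>s\<bar>\<close> almost everywhere.

For a holomorphic function \<open>f\<close> and any \<open>q > 0\<close> the function \<open>\<bar>f\<bar>\<^sup>q\<close> satisfies the submean value
inequality, on circles and hence on balls (\<open>submean_holomorphic\<close>, \<open>holomorphic_Cn_ball_submean\<close>). With
\<open>q = p\<close> and \<open>f = \<langle>u\<^sup>\<otimes>\<^sup>m, s\<rangle>\<close> the integral over a ball \<open>B\<close> is at most \<open>(sup\<^sub>B \<bar>u\<bar>)\<^sup>p\<^sup>m\<close>, because \<open>s\<close> has norm at most
one (\<open>pairing_Lp_bound\<close>). Taking the \<open>m\<close>-th root gives the upper estimate (\<open>hm_dual_upper\<close>).

Applied to sections with constant coordinates in a local frame, the same bound shows that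
the functions \<open>\<xi> \<mapsto> \<langle>\<xi>\<^sup>\<otimes>\<^sup>m, s(x)\<rangle>\<close> are holomorphic and locally uniformly bounded on the total space of \<open>E\<^sup>*\<close>.
By the Schwarz lemma on complex lines in local coordinates such a family is equicontinuous
(\<open>sup_pairing_usc\<close>). Thus \<open>F\<^sub>m\<close> is upper semicontinuous and equal to its regularization
(\<open>usc_reg_sup_pairing\<close>), and along a section \<open>u\<close> the square of the norm is the supremum of the functions
\<open>\<bar>\<langle>u\<^sup>\<otimes>\<^sup>m, s\<rangle>\<bar>\<^sup>2\<^sup>/\<^sup>m\<close>. Each of them satisfies the submean value inequality with \<open>q = 2 / m\<close>, so the supremum does;
this is Griffiths seminegativity (\<open>griffiths_seminegative_hm\<close>).

A section that extends \<open>a\<^sup>\<otimes>\<^sup>m\<close>, suitably scaled, competes in the supremum and gives the lower estimate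
(\<open>hm_dual_lower\<close>). The lower constant tends to \<open>1\<close> since \<open>log C\<^sub>m / m\<close> tends to \<open>0\<close>, and so does an upper constant
\<open>\<kappa>\<^sup>1\<^sup>/\<^sup>p\<^sup>m\<close>; shrinking the neighbourhood and using that \<open>\<bar>u\<bar>\<close> is upper semicontinuous gives pointwise convergence
(\<open>hm_dual_tendsto\<close>). The upper bounds are locally uniform in \<open>m\<close>, so the convergence holds in \<open>L\<^sup>1\<close> on
compact sets by dominated convergence (\<open>hm_dual_L1loc_tendsto\<close>).\<close>

section \<open>The submean value inequality for powers of holomorphic functions\<close>

text \<open>The circle mean is an integral in \<open>[0,\<infinity>]\<close>, so that it can be combined with integrals over balls by
Tonelli's theorem without integrability conditions.\<close>

definition submean :: "real \<Rightarrow> (complex \<Rightarrow> complex) \<Rightarrow> bool" where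
  "submean q f \<longleftrightarrow> ennreal (cmod (f 0) powr q) \<le>
     ennreal (1 / (2 * pi)) * (\<integral>\<^sup>+\<theta>\<in>{0..2 * pi}. ennreal (cmod (f (cis \<theta>)) powr q) \<partial>lborel)"

lemma circle_mean_value:
  fixes f :: "complex \<Rightarrow> complex"
  assumes "f holomorphic_on cball 0 1"
  shows "((\<lambda>t. f (cis t)) has_integral (2 * pi * f 0)) {0..2 * pi}"
proof -
  have "((\<lambda>u. f u / (u - 0)) has_contour_integral (2 * of_real pi * \<i> * f 0)) (circlepath 0 1)"
    using assms by (intro Cauchy_integral_circlepath_simple) auto
  then have "((\<lambda>t. \<i> * f (cis t)) has_integral (2 * of_real pi * \<i> * f 0)) {0..2 * pi}"
    unfolding circlepath_def by (subst (asm) has_contour_integral_part_circlepath_iff) (auto simp: mult_ac)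
  from has_integral_mult_right[OF this, of "- \<i>"] show ?thesis
    by (simp add: algebra_simps)
qed

text \<open>A zero-free \<open>f\<close> has a holomorphic logarithm \<open>g\<close>, and \<open>exp (q g)\<close> is a holomorphic function of modulus
\<open>\<bar>f\<bar>\<^sup>q\<close>, to which the mean value property applies.\<close>

lemma submean_nonvanishing:
  assumes hol: "f holomorphic_on ball 0 R" and "R > 1" and nz: "\<And>z. z \<in> ball 0 R \<Longrightarrow> f z \<noteq> 0"
  shows "submean q f"
proof -
  obtain g where g: "g holomorphic_on ball 0 R" "\<And>z. z \<in> ball 0 R \<Longrightarrow> exp (g z) = f z"
    using holomorphic_logarithm_exists[of "ball 0 R" f 0] hol nz \<open>R > 1\<close> by (auto simp: dist_norm)
  define G where "G = (\<lambda>z. exp (of_real q * g z))"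
  have sub: "cball 0 1 \<subseteq> ball (0::complex) R" using \<open>R > 1\<close> by auto
  have holG: "G holomorphic_on cball 0 1"
    unfolding G_def by (intro holomorphic_intros holomorphic_on_subset[OF g(1) sub])
  have normG: "cmod (G z) = cmod (f z) powr q" if "z \<in> cball 0 1" for z
  proof -
    have z: "z \<in> ball 0 R" using that sub by blast
    have "cmod (f z) = exp (Re (g z))" using g(2)[OF z] by (metis norm_exp_eq_Re)
    then show ?thesis by (simp add: G_def powr_def)
  qed
  have mv: "((\<lambda>t. G (cis t)) has_integral (2 * pi * G 0)) {0..2 * pi}"
    by (rule circle_mean_value[OF holG])
  have "continuous_on (cball 0 1) G" using holG holomorphic_on_imp_continuous_on by blast
  then have cont: "continuous_on {0..2*pi} (\<lambda>t. G (cis t))"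
    by (rule continuous_on_compose2) (auto intro!: continuous_intros)
  have int: "(\<lambda>t. cmod (G (cis t))) integrable_on {0..2*pi}"
    by (intro integrable_continuous_interval continuous_on_norm cont)
  define I where "I = integral {0..2*pi} (\<lambda>t. cmod (G (cis t)))"
  have "norm (integral {0..2*pi} (\<lambda>t. G (cis t))) \<le> I"
    unfolding I_def by (intro integral_norm_bound_integral int has_integral_integrable[OF mv]) auto
  then have le: "cmod (G 0) \<le> 1 / (2 * pi) * I"
    using integral_unique[OF mv] by (simp add: norm_mult field_simps)
  have I: "(\<integral>\<^sup>+t. indicator {0..2*pi} t * ennreal (cmod (G (cis t))) \<partial>lborel) = ennreal I"
    using nn_integral_has_integral_lebesgue[of "{0..2*pi}" "\<lambda>t. cmod (G (cis t))" I] int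
    unfolding I_def by (simp add: integrable_integral ennreal_mult' ennreal_indicator)
  have "(\<integral>\<^sup>+\<theta>\<in>{0..2 * pi}. ennreal (cmod (f (cis \<theta>)) powr q) \<partial>lborel)
      = (\<integral>\<^sup>+t. indicator {0..2*pi} t * ennreal (cmod (G (cis t))) \<partial>lborel)"
    by (intro nn_integral_cong) (simp add: normG mult_ac)
  then have "ennreal (1 / (2 * pi)) * (\<integral>\<^sup>+\<theta>\<in>{0..2 * pi}. ennreal (cmod (f (cis \<theta>)) powr q) \<partial>lborel)
      = ennreal (1 / (2*pi) * I)" unfolding I by (subst ennreal_mult') auto
  moreover have "cmod (f 0) powr q = cmod (G 0)" using normG[of 0] by simp
  ultimately show ?thesis unfolding submean_def using le by (simp add: ennreal_leI)
qed

text \<open>Dominated convergence on the circle. It is used twice: to allow zeros on the circle, and to pass from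
polynomials to holomorphic functions.\<close>

lemma submean_limit:
  assumes "q > 0" and sm: "\<And>n. submean q (f n)"
    and [measurable]: "\<And>n. (\<lambda>\<theta>. f n (cis \<theta>)) \<in> borel_measurable borel"
    and lim: "\<And>\<theta>. (\<lambda>n. f n (cis \<theta>)) \<longlonglongrightarrow> g (cis \<theta>)" and lim0: "(\<lambda>n. f n 0) \<longlonglongrightarrow> g 0"
    and bd: "\<And>n \<theta>. cmod (f n (cis \<theta>)) \<le> B"
  shows "submean q g"
proof -
  have [measurable]: "(\<lambda>\<theta>. g (cis \<theta>)) \<in> borel_measurable borel"
    by (rule borel_measurable_LIMSEQ_metric[OF _ lim]) measurable
  let ?I = "\<lambda>f. \<integral>\<^sup>+\<theta>\<in>{0..2 * pi}. ennreal (cmod (f (cis \<theta>)) powr q) \<partial>lborel"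
  have powlim: "(\<lambda>n. ennreal (cmod (f n z) powr q)) \<longlonglongrightarrow> ennreal (cmod (g z) powr q)"
    if "(\<lambda>n. f n z) \<longlonglongrightarrow> g z" for z
    using that \<open>q > 0\<close> by (intro tendsto_ennrealI tendsto_powr' tendsto_intros) auto
  have "(\<lambda>n. ?I (f n)) \<longlonglongrightarrow> ?I g"
  proof (rule nn_integral_dominated_convergence)
    show "AE \<theta> in lborel. ennreal (cmod (f n (cis \<theta>)) powr q) * indicator {0..2 * pi} \<theta>
        \<le> ennreal (B powr q) * indicator {0..2 * pi} \<theta>" for n
      using bd \<open>q > 0\<close> by (intro AE_I2 mult_right_mono ennreal_leI powr_mono2) auto
    show "(\<integral>\<^sup>+\<theta>\<in>{0..2 * pi}. ennreal (B powr q) \<partial>lborel) < \<infinity>"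
      by (simp add: nn_integral_cmult_indicator ennreal_mult_less_top)
    show "AE \<theta> in lborel. (\<lambda>n. ennreal (cmod (f n (cis \<theta>)) powr q) * indicator {0..2 * pi} \<theta>)
        \<longlonglongrightarrow> ennreal (cmod (g (cis \<theta>)) powr q) * indicator {0..2 * pi} \<theta>"
      using powlim[OF lim] by (intro AE_I2) (auto simp: indicator_def)
  qed measurable
  then have "(\<lambda>n. ennreal (1 / (2 * pi)) * ?I (f n)) \<longlonglongrightarrow> ennreal (1 / (2 * pi)) * ?I g"
    by (intro ennreal_tendsto_cmult) auto
  then show ?thesis
    unfolding submean_def using sm[unfolded submean_def]
    by (intro LIMSEQ_le[OF powlim[OF lim0]]) auto
qed

text \<open>Blaschke's device: for \<open>\<bar>a\<bar> < 1\<close> the factor \<open>z - a\<close> is replaced by \<open>1 - cnj a * z\<close>, which has the same modulus on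
the unit circle, a larger one at \<open>0\<close>, and no zero in the disc.\<close>

lemma reflect_roots_out_of_disc:
  fixes P :: "complex poly"
  assumes "P \<noteq> 0"
  shows "\<exists>Q. Q holomorphic_on UNIV \<and> (\<forall>z\<in>ball 0 1. Q z \<noteq> 0) \<and>
     (\<forall>z. cmod z = 1 \<longrightarrow> cmod (Q z) = cmod (poly P z)) \<and> cmod (poly P 0) \<le> cmod (Q 0)"
  using assms
proof (induction "degree P" arbitrary: P)
  case 0
  then obtain c where "P = [:c:]" "c \<noteq> 0" by (metis degree_eq_zeroE pCons_0_0)
  then show ?case by (intro exI[of _ "\<lambda>_. c"]) auto
next
  case (Suc n)
  then obtain a where "poly P a = 0"
    using alg_closed_imp_poly_has_root[of P] by auto
  then obtain P1 where P: "P = [:-a, 1:] * P1" by (metis dvdE poly_eq_0_iff_dvd)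
  have "P1 \<noteq> 0" using Suc.prems P by auto
  then have "n = degree P1" using Suc.hyps(2) unfolding P by (subst (asm) degree_mult_eq) auto
  with Suc.hyps(1) \<open>P1 \<noteq> 0\<close> obtain Q1 where Q1: "Q1 holomorphic_on UNIV" "\<forall>z\<in>ball 0 1. Q1 z \<noteq> 0"
    "\<forall>z. cmod z = 1 \<longrightarrow> cmod (Q1 z) = cmod (poly P1 z)" "cmod (poly P1 0) \<le> cmod (Q1 0)" by blast
  define b where "b = (\<lambda>z. if cmod a < 1 then 1 - cnj a * z else z - a)"
  have "b holomorphic_on UNIV" by (cases "cmod a < 1") (auto simp: b_def intro!: holomorphic_intros)
  moreover have "b z \<noteq> 0" if "cmod z < 1" for z
  proof (cases "cmod a < 1")
    case True
    have "cmod (cnj a * z) \<le> cmod a" using that by (simp add: norm_mult mult_left_le)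
    then have "cnj a * z \<noteq> 1" using True by fastforce
    then show ?thesis using True by (auto simp: b_def)
  qed (use that in \<open>auto simp: b_def\<close>)
  moreover have "cmod (b z) = cmod (z - a)" if "cmod z = 1" for z
  proof (cases "cmod a < 1")
    case True
    \<comment> \<open>On the unit circle \<open>1 = z * cnj z\<close>.\<close>
    have "z * cnj z = 1" using that by (simp add: complex_norm_square[symmetric])
    then have "1 - cnj a * z = z * cnj (z - a)" by (simp add: algebra_simps)
    then have "cmod (1 - cnj a * z) = cmod z * cmod (cnj (z - a))" by (simp only: norm_mult)
    then show ?thesis using that True by (simp add: b_def del: complex_cnj_diff)
  qed (auto simp: b_def)
  moreover have "cmod (0 - a) \<le> cmod (b 0)" by (auto simp: b_def)
  moreover have "cmod (poly P z) = cmod (z - a) * cmod (poly P1 z)" for z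
    unfolding P by (simp add: norm_mult[symmetric] algebra_simps)
  ultimately show ?case using Q1
    by (intro exI[of _ "\<lambda>z. b z * Q1 z"])
       (auto simp: norm_mult intro!: holomorphic_intros mult_mono)
qed

text \<open>Zeros on the unit circle may occur here. The function \<open>Q(\<rho> z)\<close>, \<open>\<rho> < 1\<close>, is zero-free on the larger disc of
radius \<open>1 / \<rho>\<close>; then let \<open>\<rho>\<close> tend to \<open>1\<close>.\<close>

lemma submean_entire_nonvanishing_disc:
  assumes "q > 0" and hol: "Q holomorphic_on UNIV" and nz: "\<forall>z\<in>ball 0 1. Q z \<noteq> 0"
  shows "submean q Q"
proof -
  define \<rho> where "\<rho> = (\<lambda>n::nat. 1 - 1 / (real n + 2))"
  have \<rho>: "0 < \<rho> n" "\<rho> n < 1" for n by (auto simp: \<rho>_def field_simps)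
  have \<rho>1: "\<rho> \<longlonglongrightarrow> 1" unfolding \<rho>_def by real_asymp
  have contQ: "continuous_on UNIV Q" using hol holomorphic_on_imp_continuous_on by blast
  have cont: "isCont Q z" for z using contQ by (simp add: continuous_on_eq_continuous_at)
  obtain B where B: "\<And>z. z \<in> cball 0 1 \<Longrightarrow> cmod (Q z) \<le> B"
    using compact_imp_bounded[OF compact_continuous_image[OF continuous_on_subset[OF contQ subset_UNIV] compact_cball[of 0 1]]]
    unfolding bounded_iff by blast
  show ?thesis
  proof (rule submean_limit[where f = "\<lambda>n z. Q (of_real (\<rho> n) * z)" and B = B])
    fix n
    have disc: "of_real (\<rho> n) * z \<in> ball 0 1" if "z \<in> ball 0 (1 / \<rho> n)" for z :: complex
      using that \<rho>[of n] by (auto simp: norm_mult field_simps)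
    show "submean q (\<lambda>z. Q (of_real (\<rho> n) * z))"
    proof (rule submean_nonvanishing)
      show "(\<lambda>z. Q (of_real (\<rho> n) * z)) holomorphic_on ball 0 (1 / \<rho> n)"
        by (intro holomorphic_on_compose_gen[OF _ hol, unfolded o_def] holomorphic_intros) auto
    qed (use \<rho>[of n] nz disc in auto)
    show "(\<lambda>\<theta>. Q (of_real (\<rho> n) * cis \<theta>)) \<in> borel_measurable borel"
      by (intro borel_measurable_continuous_onI continuous_on_compose2[OF contQ] continuous_intros) auto
    show "cmod (Q (of_real (\<rho> n) * cis \<theta>)) \<le> B" for \<theta>
      using \<rho>[of n] by (intro B) (auto simp: norm_mult)
  next
    have "(\<lambda>n. Q (of_real (\<rho> n) * z)) \<longlonglongrightarrow> Q z" for z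
      using \<rho>1 by (intro isCont_tendsto_compose[OF cont]) (auto intro!: tendsto_eq_intros)
    then show "(\<lambda>n. Q (of_real (\<rho> n) * cis \<theta>)) \<longlonglongrightarrow> Q (cis \<theta>)"
      and "(\<lambda>n. Q (of_real (\<rho> n) * 0)) \<longlonglongrightarrow> Q 0" for \<theta> by auto
  qed (use \<open>q > 0\<close> in auto)
qed

lemma submean_poly:
  assumes "q > 0" shows "submean q (poly P)"
proof (cases "P = 0")
  case False
  then obtain Q where Q: "Q holomorphic_on UNIV" "\<forall>z\<in>ball 0 1. Q z \<noteq> 0"
    "\<forall>z. cmod z = 1 \<longrightarrow> cmod (Q z) = cmod (poly P z)" "cmod (poly P 0) \<le> cmod (Q 0)"
    using reflect_roots_out_of_disc by blast
  have "ennreal (cmod (poly P 0) powr q) \<le> ennreal (cmod (Q 0) powr q)"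
    using Q(4) assms by (intro ennreal_leI powr_mono2) auto
  moreover have "cmod (Q (cis t)) = cmod (poly P (cis t))" for t using Q(3) by simp
  ultimately show ?thesis
    using submean_entire_nonvanishing_disc[OF assms Q(1,2)] unfolding submean_def by (simp del: ennreal_le_iff)
qed (use assms in \<open>simp add: submean_def\<close>)

text \<open>The Taylor polynomials of \<open>f\<close> converge boundedly on the closed disc, so polynomials suffice; they can be
made zero-free in the open disc root by root.\<close>

theorem submean_holomorphic:
  assumes "q > 0" and hol: "f holomorphic_on S" and "open S" "cball 0 1 \<subseteq> S"
  shows "submean q f"
proof -
  obtain e where "e > 0" and e: "(\<Union>x\<in>cball 0 1. cball x e) \<subseteq> S"
    using compact_subset_open_imp_cball_epsilon_subset[OF compact_cball \<open>open S\<close> \<open>cball 0 1 \<subseteq> S\<close>] by blast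
  have "ball 0 (1 + e) \<subseteq> S"
  proof
    fix z :: complex assume z: "z \<in> ball 0 (1 + e)"
    show "z \<in> S"
    proof (cases "cmod z \<le> 1")
      case False
      have "z \<noteq> 0" using False by auto
      have "sgn z - z = (1 / cmod z - 1) *\<^sub>R z" by (simp add: sgn_div_norm algebra_simps divide_inverse)
      then have "dist (sgn z) z = \<bar>1 / cmod z - 1\<bar> * cmod z" by (simp add: dist_norm)
      also have "\<dots> = cmod z - 1" using False \<open>z \<noteq> 0\<close> by (simp add: abs_if field_simps)
      finally have "z \<in> cball (sgn z) e" using z by auto
      moreover have "sgn z \<in> cball 0 1" by (simp add: norm_sgn)
      ultimately show ?thesis using e by blast
    qed (use \<open>cball 0 1 \<subseteq> S\<close> in auto)
  qed
  then have hol': "f holomorphic_on ball 0 (1 + e)" using hol holomorphic_on_subset by blast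
  define a where "a = (\<lambda>n. (deriv ^^ n) f 0 / fact n)"
  have sums: "(\<lambda>n. a n * z ^ n) sums f z" if "cmod z < 1 + e" for z
    using holomorphic_power_series[OF hol', of z] that by (simp add: a_def)
  define P where "P = (\<lambda>N. \<Sum>n<N. monom (a n) n)"
  have P: "poly (P N) z = (\<Sum>n<N. a n * z ^ n)" for N z by (simp add: P_def poly_sum poly_monom)
  have lim: "(\<lambda>N. poly (P N) z) \<longlonglongrightarrow> f z" if "cmod z \<le> 1" for z
    using sums[of z] that \<open>e > 0\<close> unfolding P sums_def by auto
  have "cmod (of_real (1 + e / 2)) = 1 + e / 2"
    using \<open>e > 0\<close> by (simp only: norm_of_real)
  then have "summable (\<lambda>n. norm (a n * 1 ^ n))"
    using powser_insidea[of a "of_real (1 + e / 2)" 1] sums[of "of_real (1 + e / 2)"] \<open>e > 0\<close>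
    by (auto simp: sums_iff simp del: of_real_add)
  then have sa: "summable (\<lambda>n. norm (a n))" by simp
  show ?thesis
  proof (rule submean_limit[where f = "\<lambda>N. poly (P N)" and B = "\<Sum>n. norm (a n)"])
    show "submean q (poly (P N))" for N by (rule submean_poly[OF \<open>q > 0\<close>])
    show "(\<lambda>\<theta>. poly (P N) (cis \<theta>)) \<in> borel_measurable borel" for N
      by (intro borel_measurable_continuous_onI continuous_intros)
    show "cmod (poly (P N) (cis \<theta>)) \<le> (\<Sum>n. norm (a n))" for N \<theta>
    proof -
      have "cmod (poly (P N) (cis \<theta>)) \<le> (\<Sum>n<N. norm (a n * cis \<theta> ^ n))"
        unfolding P by (rule norm_sum)
      also have "\<dots> = (\<Sum>n<N. norm (a n))" by (simp add: norm_mult norm_power)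
      also have "\<dots> \<le> (\<Sum>n. norm (a n))" using sa by (intro sum_le_suminf) auto
      finally show ?thesis .
    qed
  qed (use \<open>q > 0\<close> lim in auto)
qed

section \<open>Rotation invariance of Lebesgue measure\<close>

lemma nn_integral_lborel_shift:
  fixes f :: "'a::euclidean_space \<Rightarrow> ennreal"
  assumes "f \<in> borel_measurable borel"
  shows "(\<integral>\<^sup>+y. f (a + y) \<partial>lborel) = (\<integral>\<^sup>+y. f y \<partial>lborel)"
  using assms by (subst lborel_distr_plus[of a, symmetric]) (simp add: nn_integral_distr)

text \<open>The uniqueness proof for Haar measure, with the unit ball as reference set. The double integral of
\<open>f x * B (x - S y)\<close> is computed in both orders. Translation invariance turns one order into the integral of
\<open>f\<close> and the other into that of \<open>f \<circ> S\<close>, each times the volume of the ball, which \<open>S\<close> preserves.\<close>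

lemma nn_integral_orthogonal_transformation:
  fixes f :: "'a::euclidean_space \<Rightarrow> ennreal" and S :: "'a \<Rightarrow> 'a"
  assumes S: "orthogonal_transformation S" and [measurable]: "f \<in> borel_measurable borel"
  shows "(\<integral>\<^sup>+y. f (S y) \<partial>lborel) = (\<integral>\<^sup>+y. f y \<partial>lborel)"
proof -
  have lin: "linear S" and nS: "norm (S y) = norm y" for y
    using S by (auto simp: orthogonal_transformation)
  have [measurable]: "S \<in> borel_measurable borel"
    using lin by (intro borel_measurable_continuous_onI linear_continuous_on linear_conv_bounded_linear[THEN iffD1])
  define B :: "'a \<Rightarrow> ennreal" where "B = indicator (ball 0 1)"
  have [measurable]: "B \<in> borel_measurable borel" unfolding B_def by (intro borel_measurable_indicator borel_open open_ball)
  have "inj S" using lin nS by (metis linear_injective_0 norm_eq_zero)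
  then have "surj S" using lin linear_inj_imp_surj by blast
  define R where "R = inv S"
  have R: "S (R x) = x" for x using \<open>surj S\<close> by (simp add: R_def surj_f_inv_f)
  have Sadd: "S (R x + y) = x + S y" for x y using lin R by (simp add: linear_add)
  define b where "b = (\<integral>\<^sup>+y. B y \<partial>lborel)"
  have b: "b \<noteq> 0" "b \<noteq> \<infinity>"
    using emeasure_lborel_ball_finite[of "0::'a" 1] content_ball_pos[of 1 "0::'a"]
    by (auto simp: b_def B_def measure_def)
  have BS: "B (- S y) = B y" for y by (simp add: B_def indicator_def nS)
  have "(\<integral>\<^sup>+x. f x \<partial>lborel) * b = (\<integral>\<^sup>+x. f x * (\<integral>\<^sup>+y. B (- S y) \<partial>lborel) \<partial>lborel)"
    unfolding b_def BS by (simp add: nn_integral_multc)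
  also have "\<dots> = (\<integral>\<^sup>+x. f x * (\<integral>\<^sup>+y. B (x - S y) \<partial>lborel) \<partial>lborel)"
  proof -
    have "(\<integral>\<^sup>+y. B (x - S y) \<partial>lborel) = (\<integral>\<^sup>+y. B (- S y) \<partial>lborel)" for x
      using nn_integral_lborel_shift[of "\<lambda>y. B (x - S y)" "R x"] by (simp add: Sadd)
    then show ?thesis by (simp only:)
  qed
  also have "\<dots> = (\<integral>\<^sup>+x. (\<integral>\<^sup>+y. f x * B (x - S y) \<partial>lborel) \<partial>lborel)"
    by (simp add: nn_integral_cmult)
  also have "\<dots> = (\<integral>\<^sup>+y. (\<integral>\<^sup>+x. f x * B (x - S y) \<partial>lborel) \<partial>lborel)"
    by (rule lborel_pair.Fubini'[symmetric]) measurable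
  also have "\<dots> = (\<integral>\<^sup>+y. (\<integral>\<^sup>+x. f (x + S y) * B x \<partial>lborel) \<partial>lborel)"
  proof (rule nn_integral_cong)
    fix y
    show "(\<integral>\<^sup>+x. f x * B (x - S y) \<partial>lborel) = (\<integral>\<^sup>+x. f (x + S y) * B x \<partial>lborel)"
      using nn_integral_lborel_shift[of "\<lambda>x. f x * B (x - S y)" "S y"] by (simp add: add.commute)
  qed
  also have "\<dots> = (\<integral>\<^sup>+x. (\<integral>\<^sup>+y. f (x + S y) * B x \<partial>lborel) \<partial>lborel)"
    by (rule lborel_pair.Fubini') measurable
  also have "\<dots> = (\<integral>\<^sup>+x. (\<integral>\<^sup>+y. f (x + S y) \<partial>lborel) * B x \<partial>lborel)"
    by (simp add: nn_integral_multc)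
  also have "\<dots> = (\<integral>\<^sup>+x. (\<integral>\<^sup>+y. f (S y) \<partial>lborel) * B x \<partial>lborel)"
  proof -
    have "(\<integral>\<^sup>+y. f (x + S y) \<partial>lborel) = (\<integral>\<^sup>+y. f (S y) \<partial>lborel)" for x
      using nn_integral_lborel_shift[of "\<lambda>y. f (S y)" "R x"] by (simp add: Sadd)
    then show ?thesis by (simp only:)
  qed
  also have "\<dots> = (\<integral>\<^sup>+y. f (S y) \<partial>lborel) * b"
    unfolding b_def by (simp add: nn_integral_cmult)
  finally show ?thesis using b by (simp add: mult.commute[of _ b] ennreal_mult_cancel_left)
qed

section \<open>Holomorphic functions of several variables\<close>

lemma norm_vector_scalar_mult: "norm (c *s w) = cmod c * norm (w :: complex ^ 'n::finite)"
  by (simp add: norm_vec_def norm_mult L2_set_right_distrib)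

lemma continuous_on_vector_scalar_mult [continuous_intros]:
  fixes g :: "'a::topological_space \<Rightarrow> complex ^ 'n::finite"
  assumes "continuous_on S f" "continuous_on S g"
  shows "continuous_on S (\<lambda>x. f x *s g x)"
  unfolding vector_scalar_mult_def by (intro continuous_intros assms)

lemma orthogonal_transformation_unimodular:
  assumes "cmod c = 1"
  shows "orthogonal_transformation (\<lambda>w :: complex ^ 'n::finite. c *s w)"
  unfolding orthogonal_transformation
  by (auto simp: norm_vector_scalar_mult assms vec_eq_iff algebra_simps intro!: linearI)

lemma linear_vector_scalar_mult_left: "linear (\<lambda>\<zeta>. \<zeta> *s (w :: complex ^ 'n::finite))"
  by (rule linearI) (auto simp: vec_eq_iff algebra_simps)

lemma holomorphic_Cn_subset: "holomorphic_Cn S f \<Longrightarrow> T \<subseteq> S \<Longrightarrow> holomorphic_Cn T f"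
  unfolding holomorphic_Cn_def by blast

lemma holomorphic_Cn_const: "holomorphic_Cn S (\<lambda>_. c)"
  unfolding holomorphic_Cn_def by (auto intro!: exI[of _ "\<lambda>_. 0"])

lemma holomorphic_Cn_add:
  assumes "holomorphic_Cn S f" "holomorphic_Cn S g"
  shows "holomorphic_Cn S (\<lambda>z. f z + g z)"
  unfolding holomorphic_Cn_def
proof
  fix z assume "z \<in> S"
  with assms obtain D D' where "(f has_derivative D) (at z)" "\<forall>c v. D (c *s v) = c * D v"
    "(g has_derivative D') (at z)" "\<forall>c v. D' (c *s v) = c * D' v"
    unfolding holomorphic_Cn_def by meson
  then show "\<exists>D. ((\<lambda>z. f z + g z) has_derivative D) (at z) \<and> (\<forall>c v. D (c *s v) = c * D v)"
    by (intro exI[of _ "\<lambda>v. D v + D' v"]) (auto intro: has_derivative_add simp: distrib_left)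
qed

lemma holomorphic_Cn_mult:
  assumes "holomorphic_Cn S f" "holomorphic_Cn S g"
  shows "holomorphic_Cn S (\<lambda>z. f z * g z)"
  unfolding holomorphic_Cn_def
proof
  fix z assume "z \<in> S"
  with assms obtain D D' where D: "(f has_derivative D) (at z)" "\<And>c v. D (c *s v) = c * D v"
    and D': "(g has_derivative D') (at z)" "\<And>c v. D' (c *s v) = c * D' v"
    unfolding holomorphic_Cn_def by meson
  have "((\<lambda>z. f z * g z) has_derivative (\<lambda>v. f z * D' v + D v * g z)) (at z)"
    by (rule has_derivative_mult[OF D(1) D'(1)])
  moreover have "f z * D' (c *s v) + D (c *s v) * g z = c * (f z * D' v + D v * g z)" for c v
    unfolding D D' by (simp add: algebra_simps)
  ultimately show "\<exists>D. ((\<lambda>z. f z * g z) has_derivative D) (at z) \<and> (\<forall>c v. D (c *s v) = c * D v)"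
    by (intro exI[of _ "\<lambda>v. f z * D' v + D v * g z"]) simp
qed

lemma holomorphic_Cn_sum:
  assumes "\<And>i. i \<in> I \<Longrightarrow> holomorphic_Cn S (f i)"
  shows "holomorphic_Cn S (\<lambda>z. \<Sum>i\<in>I. f i z)"
  using assms
proof (induction I rule: infinite_finite_induct)
  case (insert i I)
  then have "holomorphic_Cn S (\<lambda>z. f i z + (\<Sum>i\<in>I. f i z))"
    by (intro holomorphic_Cn_add[of S "f i"]) simp_all
  with insert.hyps show ?case by simp
qed (simp_all add: holomorphic_Cn_const)

lemma holomorphic_Cn_transform:
  assumes "holomorphic_Cn S f" "open S" "\<And>z. z \<in> S \<Longrightarrow> f z = g z"
  shows "holomorphic_Cn S g"
  unfolding holomorphic_Cn_def
proof
  fix z assume z: "z \<in> S"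
  then obtain D where D: "(f has_derivative D) (at z)" "\<forall>c v. D (c *s v) = c * D v"
    using assms(1) unfolding holomorphic_Cn_def by blast
  then have "(g has_derivative D) (at z)"
    using has_derivative_transform_within_open[OF D(1) assms(2) z] assms(3) by blast
  with D show "\<exists>D. (g has_derivative D) (at z) \<and> (\<forall>c v. D (c *s v) = c * D v)" by blast
qed

lemma has_derivative_vec_componentwise:
  fixes f :: "'a::real_normed_vector \<Rightarrow> 'b::euclidean_space ^ 'n::finite"
  assumes "\<And>i. ((\<lambda>x. f x $ i) has_derivative (\<lambda>v. D v $ i)) (at x)"
  shows "(f has_derivative D) (at x)"
proof (subst has_derivative_componentwise_within, intro ballI)
  fix b :: "'b ^ 'n" assume "b \<in> Basis"
  then obtain i u where b: "b = axis i u" by (auto simp: Basis_vec_def)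
  show "((\<lambda>x. f x \<bullet> b) has_derivative (\<lambda>x. D x \<bullet> b)) (at x)"
    unfolding b inner_axis by (intro has_derivative_inner_left assms)
qed

lemma holomorphic_Cn_compose:
  fixes g :: "complex ^ 'n::finite \<Rightarrow> complex ^ 'm::finite"
  assumes f: "holomorphic_Cn T f" and g: "\<And>j. holomorphic_Cn S (\<lambda>z. g z $ j)" and "g ` S \<subseteq> T"
  shows "holomorphic_Cn S (\<lambda>z. f (g z))"
  unfolding holomorphic_Cn_def
proof
  fix z assume z: "z \<in> S"
  then have "\<forall>j. \<exists>D. ((\<lambda>z. g z $ j) has_derivative D) (at z) \<and> (\<forall>c v. D (c *s v) = c * D v)"
    using g unfolding holomorphic_Cn_def by blast
  then obtain D where D: "\<And>j. ((\<lambda>z. g z $ j) has_derivative D j) (at z)" "\<And>j c v. D j (c *s v) = c * D j v"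
    by metis
  obtain L where L: "(f has_derivative L) (at (g z))" "\<And>c v. L (c *s v) = c * L v"
    using f z \<open>g ` S \<subseteq> T\<close> unfolding holomorphic_Cn_def by blast
  have "(g has_derivative (\<lambda>v. \<chi> j. D j v)) (at z)"
    by (rule has_derivative_vec_componentwise) (simp add: D)
  then have "((\<lambda>z. f (g z)) has_derivative (\<lambda>v. L (\<chi> j. D j v))) (at z)"
    by (rule has_derivative_compose) (rule L)
  moreover have "(\<chi> j. D j (c *s v)) = c *s (\<chi> j. D j v)" for c v by (simp add: D vec_eq_iff)
  ultimately show "\<exists>D. ((\<lambda>z. f (g z)) has_derivative D) (at z) \<and> (\<forall>c v. D (c *s v) = c * D v)"
    by (intro exI[of _ "\<lambda>v. L (\<chi> j. D j v)"]) (simp add: L)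
qed

lemma holomorphic_Cn_continuous_on: "holomorphic_Cn S f \<Longrightarrow> continuous_on S f"
  unfolding holomorphic_Cn_def
  by (meson continuous_at_imp_continuous_on has_derivative_continuous)

lemma open_line_preimage:
  "open S \<Longrightarrow> open {\<zeta>. z + \<zeta> *s w \<in> S}" for w :: "complex ^ 'n::finite"
  using open_vimage[of S "\<lambda>\<zeta>. z + \<zeta> *s w"] unfolding vimage_def
  by (simp add: continuous_on_add continuous_on_vector_scalar_mult)

lemma holomorphic_Cn_line:
  assumes "holomorphic_Cn S f"
  shows "(\<lambda>\<zeta>. f (z + \<zeta> *s w)) holomorphic_on {\<zeta>. z + \<zeta> *s w \<in> S}"
proof (rule holomorphic_onI, clarify)
  fix \<zeta> assume "z + \<zeta> *s w \<in> S"
  then obtain D where D: "(f has_derivative D) (at (z + \<zeta> *s w))" "\<And>c v. D (c *s v) = c * D v"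
    using assms unfolding holomorphic_Cn_def by blast
  have "((\<lambda>\<zeta>. \<zeta> *s w) has_derivative (\<lambda>\<zeta>. \<zeta> *s w)) (at \<zeta>)"
    by (intro bounded_linear_imp_has_derivative linear_conv_bounded_linear[THEN iffD1]
        linear_vector_scalar_mult_left)
  then have "((\<lambda>\<zeta>. z + \<zeta> *s w) has_derivative (\<lambda>\<zeta>. \<zeta> *s w)) (at \<zeta>)"
    using has_derivative_add[OF has_derivative_const] by fastforce
  then have "((\<lambda>\<zeta>. f (z + \<zeta> *s w)) has_derivative (\<lambda>\<eta>. D (\<eta> *s w))) (at \<zeta>)"
    by (rule has_derivative_compose) (rule D)
  then have "((\<lambda>\<zeta>. f (z + \<zeta> *s w)) has_field_derivative D w) (at \<zeta>)"
    unfolding has_field_derivative_def by (simp add: D(2) mult.commute[of _ "D w"])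
  then show "(\<lambda>\<zeta>. f (z + \<zeta> *s w)) field_differentiable at \<zeta> within {\<zeta>. z + \<zeta> *s w \<in> S}"
    using field_differentiable_at_within field_differentiable_def by blast
qed

lemma holomorphic_Cn_submean:
  assumes "q > 0" "holomorphic_Cn S f" "open S" "\<And>\<zeta>. cmod \<zeta> \<le> 1 \<Longrightarrow> z + \<zeta> *s w \<in> S"
  shows "ennreal (cmod (f z) powr q) \<le>
     ennreal (1 / (2 * pi)) * (\<integral>\<^sup>+\<theta>\<in>{0..2 * pi}. ennreal (cmod (f (z + cis \<theta> *s w)) powr q) \<partial>lborel)"
proof -
  have "submean q (\<lambda>\<zeta>. f (z + \<zeta> *s w))"
    using assms by (intro submean_holomorphic[OF _ holomorphic_Cn_line open_line_preimage]) auto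
  then show ?thesis by (simp add: submean_def)
qed

text \<open>The ball is invariant under the rotations \<open>w \<mapsto> cis \<theta> *s w\<close> about its centre. Averaging the integral over
\<open>\<theta>\<close> replaces the integrand by its circle means on the complex lines through the centre, and each of these
dominates the value at the centre.\<close>

theorem holomorphic_Cn_ball_submean:
  fixes f :: "complex ^ 'n::finite \<Rightarrow> complex"
  assumes "q > 0" and hol: "holomorphic_Cn (ball z r) f"
  shows "ennreal (cmod (f z) powr q) * emeasure lborel (ball z r) \<le>
    (\<integral>\<^sup>+w\<in>ball z r. ennreal (cmod (f w) powr q) \<partial>lborel)"
proof -
  define g where "g = (\<lambda>w. ennreal (indicator (ball z r) w * cmod (f w) powr q))"
  have "(\<lambda>w. indicator (ball z r) w *\<^sub>R cmod (f w) powr q) \<in> borel_measurable borel"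
    using holomorphic_Cn_continuous_on[OF hol] \<open>q > 0\<close>
    by (intro borel_measurable_continuous_on_indicator continuous_on_powr' continuous_intros) auto
  then have [measurable]: "g \<in> borel_measurable borel" by (simp add: g_def)
  define I where "I = (\<integral>\<^sup>+w. g w \<partial>lborel)"
  have rot: "(\<integral>\<^sup>+w. g (z + cis \<theta> *s w) \<partial>lborel) = I" for \<theta>
    using nn_integral_orthogonal_transformation[OF orthogonal_transformation_unimodular, of "cis \<theta>" "\<lambda>w. g (z + w)"]
      nn_integral_lborel_shift[of g z] by (simp add: I_def)
  have "(\<lambda>x. z + cis (snd x) *s fst x) \<in> borel \<Otimes>\<^sub>M borel \<rightarrow>\<^sub>M (borel :: (complex ^ 'n) measure)"
    unfolding borel_prod by (intro borel_measurable_continuous_onI continuous_intros)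
  then have [measurable]: "(\<lambda>x. g (z + cis (snd x) *s fst x)) \<in> borel_measurable (lborel \<Otimes>\<^sub>M lborel)"
    by measurable
  have meas: "(\<lambda>(w, \<theta>). g (z + cis \<theta> *s w) * indicator {0..2*pi} \<theta>) \<in> borel_measurable (lborel \<Otimes>\<^sub>M lborel)"
    unfolding case_prod_beta by measurable
  have point: "ennreal (2 * pi) * (ennreal (cmod (f z) powr q) * indicator (ball 0 r) w)
      \<le> (\<integral>\<^sup>+\<theta>\<in>{0..2*pi}. g (z + cis \<theta> *s w) \<partial>lborel)" for w
  proof (cases "w \<in> ball 0 r")
    case True
    then have inb: "z + \<zeta> *s w \<in> ball z r" if "cmod \<zeta> \<le> 1" for \<zeta>
      using that mult_left_le_one_le[of "norm w" "cmod \<zeta>"]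
      by (auto simp: dist_norm norm_vector_scalar_mult intro: le_less_trans)
    have "ennreal (cmod (f z) powr q) \<le>
     ennreal (1 / (2 * pi)) * (\<integral>\<^sup>+\<theta>\<in>{0..2 * pi}. ennreal (cmod (f (z + cis \<theta> *s w)) powr q) \<partial>lborel)"
      by (rule holomorphic_Cn_submean[OF \<open>q > 0\<close> hol]) (use inb in auto)
    also have "(\<integral>\<^sup>+\<theta>\<in>{0..2 * pi}. ennreal (cmod (f (z + cis \<theta> *s w)) powr q) \<partial>lborel) = 
        (\<integral>\<^sup>+\<theta>\<in>{0..2*pi}. g (z + cis \<theta> *s w) \<partial>lborel)"
      using inb by (intro nn_integral_cong) (simp add: g_def)
    finally have "ennreal (2 * pi) * ennreal (cmod (f z) powr q) \<le>
     ennreal (2 * pi) * (ennreal (1 / (2 * pi)) * (\<integral>\<^sup>+\<theta>\<in>{0..2*pi}. g (z + cis \<theta> *s w) \<partial>lborel))"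
      by (rule mult_left_mono) simp
    also have "\<dots> = (\<integral>\<^sup>+\<theta>\<in>{0..2*pi}. g (z + cis \<theta> *s w) \<partial>lborel)"
      by (subst mult.assoc[symmetric], subst ennreal_mult'[symmetric]) auto
    finally show ?thesis using True by simp
  qed simp
  have "emeasure lborel (ball z r) = emeasure lborel (ball (0 :: complex ^ 'n) r)"
    by (cases "r \<ge> 0") (simp_all add: emeasure_ball ball_empty)
  moreover have "(\<integral>\<^sup>+w. c * indicator (ball 0 r) (w :: complex ^ 'n) \<partial>lborel)
      = c * emeasure lborel (ball (0 :: complex ^ 'n) r)" for c
    by (rule nn_integral_cmult_indicator) simp
  ultimately have "ennreal (2 * pi) * (ennreal (cmod (f z) powr q) * emeasure lborel (ball z r))
    = (\<integral>\<^sup>+w. ennreal (2 * pi) * (ennreal (cmod (f z) powr q) * indicator (ball (0 :: complex ^ 'n) r) w) \<partial>lborel)"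
    by (simp only: mult.assoc[symmetric])
  also have "\<dots> \<le> (\<integral>\<^sup>+w. (\<integral>\<^sup>+\<theta>. g (z + cis \<theta> *s w) * indicator {0..2*pi} \<theta> \<partial>lborel) \<partial>lborel)"
    by (intro nn_integral_mono point)
  also have "\<dots> = (\<integral>\<^sup>+\<theta>. (\<integral>\<^sup>+w. g (z + cis \<theta> *s w) * indicator {0..2*pi} \<theta> \<partial>lborel) \<partial>lborel)"
    by (rule lborel_pair.Fubini'[OF meas, symmetric])
  also have "\<dots> = (\<integral>\<^sup>+\<theta>. I * indicator {0..2*pi} \<theta> \<partial>lborel)"
    by (intro nn_integral_cong) (auto simp: indicator_def rot)
  also have "\<dots> = ennreal (2 * pi) * I" by (simp add: nn_integral_cmult mult.commute)
  finally have "ennreal (cmod (f z) powr q) * emeasure lborel (ball z r) \<le> I"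
    by (subst (asm) ennreal_mult_le_mult_iff) auto
  also have "I = (\<integral>\<^sup>+w\<in>ball z r. ennreal (cmod (f w) powr q) \<partial>lborel)"
    unfolding I_def g_def by (intro nn_integral_cong) (auto simp: indicator_def)
  finally show ?thesis .
qed

section \<open>Holomorphic functions and volume on a complex manifold\<close>

lemma is_chartD:
  assumes "is_chart (U, \<phi>)"
  shows "open U" "open (\<phi> ` U)" "homeomorphism U (\<phi> ` U) \<phi> (inv_into U \<phi>)"
    "continuous_on U \<phi>" "continuous_on (\<phi> ` U) (inv_into U \<phi>)" "inj_on \<phi> U"
    "\<And>x. x \<in> U \<Longrightarrow> inv_into U \<phi> (\<phi> x) = x"
proof -
  show h: "open U" "open (\<phi> ` U)" "homeomorphism U (\<phi> ` U) \<phi> (inv_into U \<phi>)"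
    using assms unfolding is_chart_def by auto
  then show "continuous_on U \<phi>" "continuous_on (\<phi> ` U) (inv_into U \<phi>)"
    "\<And>x. x \<in> U \<Longrightarrow> inv_into U \<phi> (\<phi> x) = x"
    unfolding homeomorphism_def by auto
  then show "inj_on \<phi> U" by (metis inj_on_inverseI)
qed

lemma is_chart_open_image:
  assumes "is_chart (U, \<phi>)" "open W"
  shows "open (\<phi> ` (U \<inter> W))"
proof -
  have "openin (top_of_set (\<phi> ` U)) (\<phi> ` (U \<inter> W))"
    using homeomorphism_imp_open_map[OF is_chartD(3)[OF assms(1)]] assms(2) by blast
  then show ?thesis using is_chartD(2)[OF assms(1)] by (simp add: openin_open_eq)
qed

lemma is_chart_open_preimage:
  assumes "is_chart (U, \<phi>)" "open T"
  shows "open {y \<in> U. \<phi> y \<in> T}"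
  using is_chartD(1,4)[OF assms(1)] assms(2) continuous_on_open_vimage[of U \<phi>]
  by (simp add: vimage_def Int_def conj_commute)

lemma complex_atlasE:
  assumes "complex_atlas \<A>"
  obtains U \<phi> where "(U, \<phi>) \<in> \<A>" "x \<in> U" "is_chart (U, \<phi>)"
  using assms unfolding complex_atlas_def by (metis UNIV_I UN_E prod.collapse)

lemma holo_fun_subset:
  assumes "holo_fun \<A> W f" "W' \<subseteq> W"
  shows "holo_fun \<A> W' f"
  unfolding holo_fun_def
proof clarify
  fix U \<phi> assume "(U, \<phi>) \<in> \<A>"
  then have "holomorphic_Cn (\<phi> ` (U \<inter> W)) (\<lambda>z. f (inv_into U \<phi> z))"
    using assms(1) unfolding holo_fun_def by blast
  then show "holomorphic_Cn (\<phi> ` (U \<inter> W')) (\<lambda>z. f (inv_into U \<phi> z))"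
    by (rule holomorphic_Cn_subset) (use assms(2) in blast)
qed

lemma holo_fun_const: "holo_fun \<A> W (\<lambda>_. c)"
  unfolding holo_fun_def by (simp add: holomorphic_Cn_const case_prod_beta)

lemma holo_fun_mult:
  assumes "holo_fun \<A> W f" "holo_fun \<A> W g"
  shows "holo_fun \<A> W (\<lambda>x. f x * g x)"
  unfolding holo_fun_def
proof clarify
  fix U \<phi> assume "(U, \<phi>) \<in> \<A>"
  then have "holomorphic_Cn (\<phi> ` (U \<inter> W)) (\<lambda>z. f (inv_into U \<phi> z))"
    "holomorphic_Cn (\<phi> ` (U \<inter> W)) (\<lambda>z. g (inv_into U \<phi> z))"
    using assms unfolding holo_fun_def by blast+
  then show "holomorphic_Cn (\<phi> ` (U \<inter> W)) (\<lambda>z. f (inv_into U \<phi> z) * g (inv_into U \<phi> z))"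
    by (rule holomorphic_Cn_mult)
qed

lemma holo_fun_sum:
  assumes "\<And>i. i \<in> I \<Longrightarrow> holo_fun \<A> W (f i)"
  shows "holo_fun \<A> W (\<lambda>x. \<Sum>i\<in>I. f i x)"
  unfolding holo_fun_def
proof clarify
  fix U \<phi> assume "(U, \<phi>) \<in> \<A>"
  then have "holomorphic_Cn (\<phi> ` (U \<inter> W)) (\<lambda>z. f i (inv_into U \<phi> z))" if "i \<in> I" for i
    using assms[OF that] unfolding holo_fun_def by blast
  then show "holomorphic_Cn (\<phi> ` (U \<inter> W)) (\<lambda>z. \<Sum>i\<in>I. f i (inv_into U \<phi> z))"
    by (rule holomorphic_Cn_sum)
qed

lemma holo_fun_prod_list:
  "(\<And>i. i \<in> set J \<Longrightarrow> holo_fun \<A> W (f i)) \<Longrightarrow> holo_fun \<A> W (\<lambda>x. prod_list (map (\<lambda>i. f i x) J))"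
  by (induction J) (simp_all add: holo_fun_const holo_fun_mult)

lemma holo_fun_cong:
  assumes "complex_atlas \<A>" "open W" "\<And>x. x \<in> W \<Longrightarrow> f x = g x" "holo_fun \<A> W f"
  shows "holo_fun \<A> W g"
  unfolding holo_fun_def
proof clarify
  fix U \<phi> assume c: "(U, \<phi>) \<in> \<A>"
  then have ch: "is_chart (U, \<phi>)" using assms(1) unfolding complex_atlas_def by blast
  have "holomorphic_Cn (\<phi> ` (U \<inter> W)) (\<lambda>z. f (inv_into U \<phi> z))"
    using assms(4) c unfolding holo_fun_def by blast
  then show "holomorphic_Cn (\<phi> ` (U \<inter> W)) (\<lambda>z. g (inv_into U \<phi> z))"
    by (rule holomorphic_Cn_transform)
       (use is_chart_open_image[OF ch assms(2)] is_chartD(7)[OF ch] assms(3) in auto)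
qed

lemma holo_fun_local:
  assumes "\<And>x. x \<in> W \<Longrightarrow> \<exists>N. x \<in> N \<and> holo_fun \<A> (N \<inter> W) f"
  shows "holo_fun \<A> W f"
  unfolding holo_fun_def
proof clarify
  fix U \<phi> assume c: "(U, \<phi>) \<in> \<A>"
  show "holomorphic_Cn (\<phi> ` (U \<inter> W)) (\<lambda>z. f (inv_into U \<phi> z))"
    unfolding holomorphic_Cn_def
  proof clarify
    fix x assume x: "x \<in> U" "x \<in> W"
    then obtain N where "x \<in> N" "holo_fun \<A> (N \<inter> W) f" using assms by blast
    then have "holomorphic_Cn (\<phi> ` (U \<inter> (N \<inter> W))) (\<lambda>z. f (inv_into U \<phi> z))"
      using c unfolding holo_fun_def by blast
    then show "\<exists>D. ((\<lambda>z. f (inv_into U \<phi> z)) has_derivative D) (at (\<phi> x)) \<and> (\<forall>c v. D (c *s v) = c * D v)"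
      using x \<open>x \<in> N\<close> unfolding holomorphic_Cn_def by blast
  qed
qed

lemma holo_fun_continuous_on:
  fixes \<A> :: "('x::t2_space, 'n::finite) chart set"
  assumes "complex_atlas \<A>" "open W" "holo_fun \<A> W f"
  shows "continuous_on W f"
proof -
  have "isCont f x" if x: "x \<in> W" for x
  proof -
    obtain U \<phi> where c: "(U, \<phi>) \<in> \<A>" "x \<in> U" and ch: "is_chart (U, \<phi>)"
      using complex_atlasE[OF assms(1)] by blast
    have "holomorphic_Cn (\<phi> ` (U \<inter> W)) (\<lambda>z. f (inv_into U \<phi> z))"
      using assms(3) c unfolding holo_fun_def by blast
    then have "continuous_on (\<phi> ` (U \<inter> W)) (\<lambda>z. f (inv_into U \<phi> z))"
      by (rule holomorphic_Cn_continuous_on)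
    then have "continuous_on (W \<inter> U) (\<lambda>y. f (inv_into U \<phi> (\<phi> y)))"
      by (rule continuous_on_compose2) (auto intro: continuous_on_subset[OF is_chartD(4)[OF ch]])
    then have "continuous_on (W \<inter> U) f"
      by (rule continuous_on_eq) (use is_chartD(7)[OF ch] in auto)
    then show ?thesis
      using c x \<open>open W\<close> is_chartD(1)[OF ch] by (simp add: continuous_on_eq_continuous_at open_Int)
  qed
  then show ?thesis by (simp add: continuous_at_imp_continuous_on)
qed

text \<open>Holomorphic functions are defined by means of the given atlas, but the charts that carry a volume density
belong to the maximal atlas; the transition maps lead from one to the other.\<close>

lemma holo_fun_in_holo_chart:
  assumes \<A>: "complex_atlas \<A>" and c: "(U, \<phi>) \<in> holo_charts \<A>" and "open W" and f: "holo_fun \<A> W f"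
  shows "holomorphic_Cn (\<phi> ` (U \<inter> W)) (\<lambda>z. f (inv_into U \<phi> z))"
  unfolding holomorphic_Cn_def
proof clarify
  fix x assume x: "x \<in> U" "x \<in> W"
  have ch: "is_chart (U, \<phi>)" using c unfolding holo_charts_def by blast
  obtain V \<psi> where d: "(V, \<psi>) \<in> \<A>" "x \<in> V" and dh: "is_chart (V, \<psi>)"
    using complex_atlasE[OF \<A>] by blast
  have "\<forall>j. holomorphic_Cn (\<phi> ` (U \<inter> V)) (\<lambda>z. \<psi> (inv_into U \<phi> z) $ j)"
    using c d unfolding holo_charts_def holo_transition_def by fastforce
  then have tr: "holomorphic_Cn (\<phi> ` (U \<inter> (V \<inter> W))) (\<lambda>z. \<psi> (inv_into U \<phi> z) $ j)" for j
    using holomorphic_Cn_subset by (metis (no_types, lifting) Int_assoc Int_lower1 image_mono)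
  have "holomorphic_Cn (\<psi> ` (V \<inter> W)) (\<lambda>z. f (inv_into V \<psi> z))"
    using f d unfolding holo_fun_def by blast
  then have "holomorphic_Cn (\<phi> ` (U \<inter> (V \<inter> W))) (\<lambda>z. f (inv_into V \<psi> (\<psi> (inv_into U \<phi> z))))"
    by (rule holomorphic_Cn_compose[OF _ tr]) (auto simp: is_chartD(7)[OF ch])
  then have "holomorphic_Cn (\<phi> ` (U \<inter> (V \<inter> W))) (\<lambda>z. f (inv_into U \<phi> z))"
  proof (rule holomorphic_Cn_transform)
    show "open (\<phi> ` (U \<inter> (V \<inter> W)))"
      using is_chart_open_image[OF ch] is_chartD(1)[OF dh] \<open>open W\<close> by blast
  qed (auto simp: is_chartD(7)[OF ch] is_chartD(7)[OF dh])
  then show "\<exists>D. ((\<lambda>z. f (inv_into U \<phi> z)) has_derivative D) (at (\<phi> x)) \<and> (\<forall>c v. D (c *s v) = c * D v)"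
    using x d unfolding holomorphic_Cn_def by blast
qed

definition chart_density :: "'x::topological_space measure \<Rightarrow> ('x, 'n::finite) chart \<Rightarrow> (complex ^ 'n \<Rightarrow> real) \<Rightarrow> bool" where
  "chart_density dV c \<rho> \<longleftrightarrow> (case c of (U, \<phi>) \<Rightarrow>
     continuous_on (\<phi> ` U) \<rho> \<and> (\<forall>z\<in>\<phi> ` U. \<rho> z > 0) \<and>
     (\<forall>A\<in>sets borel. A \<subseteq> U \<longrightarrow> emeasure dV A = (\<integral>\<^sup>+z\<in>\<phi> ` A. ennreal (\<rho> z) \<partial>lborel)))"

lemma volume_measureE:
  assumes "volume_measure \<A> dV"
  obtains U \<phi> \<rho> where "(U, \<phi>) \<in> holo_charts \<A>" "x \<in> U" "chart_density dV (U, \<phi>) \<rho>" "is_chart (U, \<phi>)"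
proof -
  have "\<exists>c\<in>holo_charts \<A>. case c of (U, \<phi>) \<Rightarrow> x \<in> U \<and> (\<exists>\<rho>. chart_density dV (U, \<phi>) \<rho>)"
    using assms unfolding volume_measure_def chart_density_def prod.case
    by (elim conjE) (erule spec)
  then obtain c where c: "c \<in> holo_charts \<A>" and *: "case c of (U, \<phi>) \<Rightarrow> x \<in> U \<and> (\<exists>\<rho>. chart_density dV (U, \<phi>) \<rho>)"
    by (elim bexE)
  obtain U \<phi> where "c = (U, \<phi>)" by (cases c)
  with c * show thesis using that unfolding holo_charts_def by auto
qed

text \<open>The image under the chart of \<open>dV\<close> restricted to \<open>U\<close> is the measure with density \<open>\<rho>\<close>.\<close>

lemma nn_integral_chart:
  assumes ch: "is_chart (U, \<phi>)" and sets: "sets dV = sets borel" and \<rho>: "chart_density dV (U, \<phi>) \<rho>"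
    and [measurable]: "g \<in> borel_measurable borel"
  shows "(\<integral>\<^sup>+y\<in>U. g (\<phi> y) \<partial>dV) = (\<integral>\<^sup>+z\<in>\<phi> ` U. g z * ennreal (\<rho> z) \<partial>lborel)"
proof -
  note [measurable] = borel_open[OF is_chartD(1)[OF ch]] borel_open[OF is_chartD(2)[OF ch]]
  have UdV: "U \<inter> space dV \<in> sets dV" using sets sets_eq_imp_space_eq[OF sets] by simp
  have sp: "space dV = UNIV" using sets_eq_imp_space_eq[OF sets] by simp
  define M where "M = restrict_space dV U"
  have "sets M = sets (restrict_space borel U)" unfolding M_def by (rule sets_restrict_space_cong[OF sets])
  moreover have "\<phi> \<in> borel_measurable (restrict_space borel U)"
    by (rule borel_measurable_continuous_on_restrict[OF is_chartD(4)[OF ch]])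
  ultimately have \<phi>M: "\<phi> \<in> M \<rightarrow>\<^sub>M borel" using measurable_cong_sets by blast
  have "(\<lambda>z. indicator (\<phi> ` U) z *\<^sub>R \<rho> z) \<in> borel_measurable borel"
    using \<rho> is_chartD(2)[OF ch] unfolding chart_density_def
    by (intro borel_measurable_continuous_on_indicator) auto
  then have [measurable]: "(\<lambda>z. ennreal (indicator (\<phi> ` U) z * \<rho> z)) \<in> borel_measurable borel" by simp
  have eq: "distr M borel \<phi> = density lborel (\<lambda>z. ennreal (indicator (\<phi> ` U) z * \<rho> z))"
  proof (rule measure_eqI)
    fix A assume "A \<in> sets (distr M borel \<phi>)"
    then have [measurable]: "A \<in> sets borel" by simp
    have "\<phi> -` A \<inter> space M \<in> sets M" using \<phi>M by measurable
    then have 1: "\<phi> -` A \<inter> U \<in> sets borel"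
      using UdV sets sp unfolding M_def by (auto simp: sets_restrict_space_iff space_restrict_space)
    have "emeasure (distr M borel \<phi>) A = emeasure dV (\<phi> -` A \<inter> U)"
      using \<phi>M UdV sp unfolding M_def
      by (subst emeasure_distr) (auto simp: space_restrict_space emeasure_restrict_space)
    also have "\<dots> = (\<integral>\<^sup>+z\<in>\<phi> ` (\<phi> -` A \<inter> U). ennreal (\<rho> z) \<partial>lborel)"
      using \<rho> 1 unfolding chart_density_def by auto
    also have "\<dots> = (\<integral>\<^sup>+z. ennreal (indicator (\<phi> ` U) z * \<rho> z) * indicator A z \<partial>lborel)"
      by (intro nn_integral_cong) (auto simp: indicator_def)
    also have "\<dots> = emeasure (density lborel (\<lambda>z. ennreal (indicator (\<phi> ` U) z * \<rho> z))) A"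
      by (subst emeasure_density) auto
    finally show "emeasure (distr M borel \<phi>) A = \<dots>" .
  qed simp
  have "(\<integral>\<^sup>+y\<in>U. g (\<phi> y) \<partial>dV) = (\<integral>\<^sup>+y. g (\<phi> y) \<partial>M)"
    unfolding M_def using UdV by (simp add: nn_integral_restrict_space)
  also have "\<dots> = (\<integral>\<^sup>+z. g z \<partial>distr M borel \<phi>)" using \<phi>M by (simp add: nn_integral_distr)
  also have "\<dots> = (\<integral>\<^sup>+z. ennreal (indicator (\<phi> ` U) z * \<rho> z) * g z \<partial>lborel)"
    unfolding eq by (subst nn_integral_density) auto
  also have "\<dots> = (\<integral>\<^sup>+z\<in>\<phi> ` U. g z * ennreal (\<rho> z) \<partial>lborel)"
    by (intro nn_integral_cong) (auto simp: indicator_def mult_ac)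
  finally show ?thesis .
qed

lemma chart_ball_submean:
  assumes \<A>: "complex_atlas \<A>" and c: "(U, \<phi>) \<in> holo_charts \<A>" and sets: "sets dV = sets borel"
    and \<rho>: "chart_density dV (U, \<phi>) \<rho>" and "q > 0" and "x \<in> U" and "open W"
    and ball: "ball (\<phi> x) r \<subseteq> \<phi> ` (U \<inter> W)" and c\<rho>: "\<And>z. z \<in> ball (\<phi> x) r \<Longrightarrow> c \<le> \<rho> z"
    and f: "holo_fun \<A> W f"
  shows "ennreal (cmod (f x) powr q) * (ennreal c * emeasure lborel (ball (\<phi> x) r))
    \<le> (\<integral>\<^sup>+y\<in>coord_ball (U, \<phi>) x r. ennreal (cmod (f y) powr q) \<partial>dV)"
proof -
  let ?B = "ball (\<phi> x) r"
  have ch: "is_chart (U, \<phi>)" using c unfolding holo_charts_def by blast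
  define F where "F = (\<lambda>z. f (inv_into U \<phi> z))"
  have F: "F (\<phi> y) = f y" if "y \<in> U" for y using that by (simp add: F_def is_chartD(7)[OF ch])
  have hol: "holomorphic_Cn ?B F"
    unfolding F_def using holo_fun_in_holo_chart[OF \<A> c \<open>open W\<close> f] ball by (rule holomorphic_Cn_subset)
  define g where "g = (\<lambda>z. ennreal (indicator ?B z *\<^sub>R cmod (F z) powr q))"
  have "(\<lambda>z. indicator ?B z *\<^sub>R cmod (F z) powr q) \<in> borel_measurable borel"
    using holomorphic_Cn_continuous_on[OF hol] \<open>q > 0\<close>
    by (intro borel_measurable_continuous_on_indicator continuous_on_powr' continuous_intros) auto
  then have gm: "g \<in> borel_measurable borel" unfolding g_def by (rule measurable_compose) simp
  have "ennreal (cmod (f x) powr q) * emeasure lborel ?B \<le> (\<integral>\<^sup>+z\<in>?B. ennreal (cmod (F z) powr q) \<partial>lborel)"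
    using holomorphic_Cn_ball_submean[OF \<open>q > 0\<close> hol] F[OF \<open>x \<in> U\<close>] by simp
  also have "\<dots> = (\<integral>\<^sup>+z. g z \<partial>lborel)"
    by (intro nn_integral_cong) (auto simp: g_def indicator_def)
  finally have "ennreal c * (ennreal (cmod (f x) powr q) * emeasure lborel ?B) \<le> ennreal c * (\<integral>\<^sup>+z. g z \<partial>lborel)"
    by (rule mult_left_mono) simp
  also have "\<dots> = (\<integral>\<^sup>+z. ennreal c * g z \<partial>lborel)" using gm by (simp add: nn_integral_cmult)
  also have "\<dots> \<le> (\<integral>\<^sup>+z\<in>\<phi> ` U. g z * ennreal (\<rho> z) \<partial>lborel)"
    using ball c\<rho> by (intro nn_integral_mono) (auto simp: g_def indicator_def mult_ac intro!: mult_right_mono ennreal_leI)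
  also have "\<dots> = (\<integral>\<^sup>+y\<in>U. g (\<phi> y) \<partial>dV)" by (rule nn_integral_chart[OF ch sets \<rho> gm, symmetric])
  also have "\<dots> = (\<integral>\<^sup>+y\<in>coord_ball (U, \<phi>) x r. ennreal (cmod (f y) powr q) \<partial>dV)"
    by (intro nn_integral_cong) (auto simp: g_def coord_ball_def indicator_def F)
  finally show ?thesis by (simp add: mult_ac)
qed

lemma open_coord_ball: "is_chart (U, \<phi>) \<Longrightarrow> open (coord_ball (U, \<phi>) x r)"
  unfolding coord_ball_def using is_chart_open_preimage[OF _ open_ball] by simp

lemma density_small_ball:
  assumes ch: "is_chart (U, \<phi>)" and \<rho>: "chart_density dV (U, \<phi>) \<rho>" and "x \<in> U" "x \<in> W" "open W"
  obtains R where "R > 0" "ball (\<phi> x) R \<subseteq> \<phi> ` (U \<inter> W)"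
    "\<And>z. z \<in> ball (\<phi> x) R \<Longrightarrow> \<rho> (\<phi> x) / 2 \<le> \<rho> z \<and> \<rho> z \<le> 2 * \<rho> (\<phi> x)"
proof -
  have "\<phi> x \<in> \<phi> ` (U \<inter> W)" using assms by blast
  then obtain R1 where R1: "R1 > 0" "ball (\<phi> x) R1 \<subseteq> \<phi> ` (U \<inter> W)"
    using is_chart_open_image[OF ch \<open>open W\<close>] open_contains_ball by blast
  have pos: "\<rho> (\<phi> x) > 0" and "continuous_on (\<phi> ` U) \<rho>" using \<rho> \<open>x \<in> U\<close> unfolding chart_density_def by auto
  then have "isCont \<rho> (\<phi> x)"
    using is_chartD(2)[OF ch] \<open>x \<in> U\<close> by (auto simp: continuous_on_eq_continuous_at)
  then obtain R2 where R2: "R2 > 0" "\<And>z. dist z (\<phi> x) < R2 \<Longrightarrow> dist (\<rho> z) (\<rho> (\<phi> x)) < \<rho> (\<phi> x) / 2"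
    using pos unfolding continuous_at_eps_delta dist_norm by (metis half_gt_zero)
  show ?thesis
  proof (rule that[of "min R1 R2"])
    fix z assume "z \<in> ball (\<phi> x) (min R1 R2)"
    then have "dist (\<rho> z) (\<rho> (\<phi> x)) < \<rho> (\<phi> x) / 2" by (intro R2) (simp add: dist_commute)
    then show "\<rho> (\<phi> x) / 2 \<le> \<rho> z \<and> \<rho> z \<le> 2 * \<rho> (\<phi> x)"
      unfolding dist_real_def abs_less_iff using pos by (simp add: field_simps)
  qed (use R1 R2 in auto)
qed

text \<open>A form of the submean value inequality that does not mention charts. The constant depends neither on the
function nor on the exponent, and this makes the later bounds uniform in \<open>m\<close>.\<close>

lemma local_submean:
  assumes \<A>: "complex_atlas \<A>" and V: "volume_measure \<A> dV" and "x0 \<in> W" "open W"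
  obtains N \<kappa> where "open N" "x0 \<in> N" "N \<subseteq> W" "\<kappa> > 0"
    "\<And>f q x. holo_fun \<A> W f \<Longrightarrow> q > 0 \<Longrightarrow> x \<in> N \<Longrightarrow>
       ennreal (cmod (f x) powr q) \<le> ennreal \<kappa> * (\<integral>\<^sup>+y\<in>W. ennreal (cmod (f y) powr q) \<partial>dV)"
proof -
  have sets: "sets dV = sets borel" using V unfolding volume_measure_def by blast
  obtain U \<phi> \<rho> where c: "(U, \<phi>) \<in> holo_charts \<A>" "x0 \<in> U" and \<rho>: "chart_density dV (U, \<phi>) \<rho>"
    and ch: "is_chart (U, \<phi>)" using volume_measureE[OF V] by blast
  obtain R where R: "R > 0" "ball (\<phi> x0) R \<subseteq> \<phi> ` (U \<inter> W)"
    "\<And>z. z \<in> ball (\<phi> x0) R \<Longrightarrow> \<rho> (\<phi> x0) / 2 \<le> \<rho> z \<and> \<rho> z \<le> 2 * \<rho> (\<phi> x0)"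
    using density_small_ball[OF ch \<rho> c(2) assms(3,4)] by blast
  define d where "d = \<rho> (\<phi> x0) / 2"
  have "d > 0" using \<rho> c(2) unfolding chart_density_def d_def by auto
  define v where "v = measure lborel (ball (0 :: complex ^ 'b) (R / 2))"
  have "v > 0" unfolding v_def using R(1) by (intro content_ball_pos) auto
  have v: "emeasure lborel (ball z (R / 2)) = ennreal v" for z :: "complex ^ 'b"
    using R(1) unfolding v_def by (simp add: emeasure_ball measure_def)
  \<comment> \<open>Balls of radius \<open>R / 2\<close> about the points of \<open>N\<close> stay in the ball of radius \<open>R\<close>, where \<open>\<rho> \<ge> d\<close>.\<close>
  define N where "N = coord_ball (U, \<phi>) x0 (R / 2)"
  have inR: "ball (\<phi> x) (R / 2) \<subseteq> ball (\<phi> x0) R" if "x \<in> N" for x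
  proof
    fix w assume "w \<in> ball (\<phi> x) (R / 2)"
    moreover have "dist (\<phi> x0) (\<phi> x) < R / 2" using that unfolding N_def coord_ball_def by simp
    ultimately show "w \<in> ball (\<phi> x0) R" using dist_triangle[of "\<phi> x0" w "\<phi> x"] by simp
  qed
  have NW: "y \<in> W" if y: "y \<in> U" "\<phi> y \<in> ball (\<phi> x0) R" for y
  proof -
    obtain y' where "y' \<in> U \<inter> W" "\<phi> y = \<phi> y'" using y(2) R(2) by blast
    then show ?thesis using y(1) is_chartD(6)[OF ch] by (auto dest: inj_onD)
  qed
  show ?thesis
  proof
    show "open N" unfolding N_def by (rule open_coord_ball[OF ch])
    show "x0 \<in> N" using c R(1) by (simp add: N_def coord_ball_def)
    show "N \<subseteq> W" using NW R(1) unfolding N_def coord_ball_def by (auto intro: NW)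
    show "1 / (d * v) > 0" using \<open>d > 0\<close> \<open>v > 0\<close> by simp
    fix f q x assume f: "holo_fun \<A> W f" and "(q::real) > 0" and x: "x \<in> N"
    then have "x \<in> U" by (simp add: N_def coord_ball_def)
    have sub: "coord_ball (U, \<phi>) x (R / 2) \<subseteq> W"
      using inR[OF x] NW unfolding coord_ball_def by auto
    have "ennreal (cmod (f x) powr q) * (ennreal d * ennreal v)
      \<le> (\<integral>\<^sup>+y\<in>coord_ball (U, \<phi>) x (R / 2). ennreal (cmod (f y) powr q) \<partial>dV)"
      unfolding v[symmetric, of "\<phi> x"] using R inR[OF x] unfolding d_def
      by (intro chart_ball_submean[OF \<A> c(1) sets \<rho> \<open>q > 0\<close> \<open>x \<in> U\<close> \<open>open W\<close> _ _ f]) blast+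
    also have "\<dots> \<le> (\<integral>\<^sup>+y\<in>W. ennreal (cmod (f y) powr q) \<partial>dV)"
      using sub by (intro nn_integral_mono) (auto simp: indicator_def)
    finally have "ennreal (1 / (d * v)) * (ennreal (cmod (f x) powr q) * (ennreal d * ennreal v))
      \<le> ennreal (1 / (d * v)) * (\<integral>\<^sup>+y\<in>W. ennreal (cmod (f y) powr q) \<partial>dV)"
      by (rule mult_left_mono) simp
    also have "ennreal (1 / (d * v)) * (ennreal (cmod (f x) powr q) * (ennreal d * ennreal v)) = ennreal (cmod (f x) powr q)"
      using \<open>d > 0\<close> \<open>v > 0\<close> by (simp add: ennreal_mult[symmetric])
    finally show "ennreal (cmod (f x) powr q) \<le> ennreal (1 / (d * v)) * (\<integral>\<^sup>+y\<in>W. ennreal (cmod (f y) powr q) \<partial>dV)" .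
  qed
qed

lemma volume_measure_compact_finite:
  fixes dV :: "'x::t2_space measure"
  assumes V: "volume_measure \<A> dV" and "compact K"
  shows "emeasure dV K < \<infinity>"
proof -
  have sets: "sets dV = sets borel" using V unfolding volume_measure_def by blast
  have "\<exists>N. open N \<and> x \<in> N \<and> emeasure dV N < \<infinity>" for x
  proof -
    obtain U \<phi> \<rho> where c: "(U, \<phi>) \<in> holo_charts \<A>" "x \<in> U" and \<rho>: "chart_density dV (U, \<phi>) \<rho>"
      and ch: "is_chart (U, \<phi>)" using volume_measureE[OF V] by blast
    obtain R where R: "R > 0" "ball (\<phi> x) R \<subseteq> \<phi> ` (U \<inter> UNIV)"
      "\<And>z. z \<in> ball (\<phi> x) R \<Longrightarrow> \<rho> (\<phi> x) / 2 \<le> \<rho> z \<and> \<rho> z \<le> 2 * \<rho> (\<phi> x)"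
      using density_small_ball[OF ch \<rho> c(2), of UNIV] by blast
    define N where "N = coord_ball (U, \<phi>) x R"
    have oN: "open N" unfolding N_def by (rule open_coord_ball[OF ch])
    have im: "\<phi> ` N \<subseteq> ball (\<phi> x) R" unfolding N_def coord_ball_def by auto
    have "emeasure dV N = (\<integral>\<^sup>+z\<in>\<phi> ` N. ennreal (\<rho> z) \<partial>lborel)"
      using \<rho> oN unfolding chart_density_def by (auto simp: N_def coord_ball_def)
    also have "\<dots> \<le> (\<integral>\<^sup>+z. ennreal (2 * \<rho> (\<phi> x)) * indicator (ball (\<phi> x) R) z \<partial>lborel)"
      using R(3) im by (intro nn_integral_mono) (auto simp: indicator_def intro!: ennreal_leI)
    also have "\<dots> = ennreal (2 * \<rho> (\<phi> x)) * emeasure lborel (ball (\<phi> x) R)"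
      by (rule nn_integral_cmult_indicator) simp
    also have "\<dots> < \<infinity>" using emeasure_lborel_ball_finite[of "\<phi> x" R] by (simp add: ennreal_mult_less_top)
    finally show ?thesis using oN c R(1) by (intro exI[of _ N]) (auto simp: N_def coord_ball_def)
  qed
  then obtain N where N: "\<And>x. open (N x)" "\<And>x. x \<in> N x" "\<And>x. emeasure dV (N x) < \<infinity>" by metis
  obtain D where D: "D \<subseteq> K" "finite D" "K \<subseteq> (\<Union>x\<in>D. N x)"
    using compactE_image[OF \<open>compact K\<close>, of K N] N by blast
  have "emeasure dV K \<le> emeasure dV (\<Union>x\<in>D. N x)"
    using D N(1) sets by (intro emeasure_mono) (auto intro!: borel_open)
  also have "\<dots> \<le> (\<Sum>x\<in>D. emeasure dV (N x))"
    using D N(1) sets by (intro emeasure_subadditive_finite) auto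
  also have "\<dots> < \<infinity>" using N(3) D(2) by (simp add: less_top)
  finally show ?thesis .
qed

lemma lebesgue_chartD:
  assumes "lebesgue_chart \<A> dV (U, \<phi>)"
  shows "(U, \<phi>) \<in> holo_charts \<A>" "is_chart (U, \<phi>)" "chart_density dV (U, \<phi>) (\<lambda>_. 1)"
    "ball (\<phi> x) r \<subseteq> \<phi> ` U \<Longrightarrow> measure dV (coord_ball (U, \<phi>) x r) = measure lborel (ball (\<phi> x) r)"
proof -
  show c: "(U, \<phi>) \<in> holo_charts \<A>" using assms unfolding lebesgue_chart_def by simp
  then show ch: "is_chart (U, \<phi>)" unfolding holo_charts_def by simp
  have L: "emeasure dV A = emeasure lborel (\<phi> ` A)" if "A \<in> sets borel" "A \<subseteq> U" for A
    using assms that unfolding lebesgue_chart_def by simp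
  have "\<phi> ` A \<in> sets borel" if A: "A \<in> sets borel" "A \<subseteq> U" for A
  proof -
    have "inv_into U \<phi> \<in> borel_measurable (restrict_space borel (\<phi> ` U))"
      by (rule borel_measurable_continuous_on_restrict[OF is_chartD(5)[OF ch]])
    then have "inv_into U \<phi> -` A \<inter> space (restrict_space borel (\<phi> ` U)) \<in> sets (restrict_space borel (\<phi> ` U))"
      using A(1) by (rule measurable_sets)
    then have "inv_into U \<phi> -` A \<inter> \<phi> ` U \<in> sets borel"
      using borel_open[OF is_chartD(2)[OF ch]] by (auto simp: space_restrict_space sets_restrict_space_iff)
    also have "inv_into U \<phi> -` A \<inter> \<phi> ` U = \<phi> ` A"
    proof (intro set_eqI iffI)
      fix z assume "z \<in> inv_into U \<phi> -` A \<inter> \<phi> ` U"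
      then show "z \<in> \<phi> ` A" by (auto simp: is_chartD(7)[OF ch])
    next
      fix z assume "z \<in> \<phi> ` A"
      then show "z \<in> inv_into U \<phi> -` A \<inter> \<phi> ` U" using A(2) by (auto simp: is_chartD(7)[OF ch] subset_iff)
    qed
    finally show ?thesis .
  qed
  then show "chart_density dV (U, \<phi>) (\<lambda>_. 1)" unfolding chart_density_def using L by auto
  assume "ball (\<phi> x) r \<subseteq> \<phi> ` U"
  then have "\<phi> ` coord_ball (U, \<phi>) x r = ball (\<phi> x) r" unfolding coord_ball_def by auto
  then show "measure dV (coord_ball (U, \<phi>) x r) = measure lborel (ball (\<phi> x) r)"
    using L[of "coord_ball (U, \<phi>) x r"] open_coord_ball[OF ch, of x r]
    by (auto simp: measure_def coord_ball_def)
qed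

section \<open>Frames, dual bundle and tensor powers\<close>

locale holomorphic_bundle =
  fixes \<A> :: "('x::t2_space, 'n::finite) chart set" and E :: "('x, 'e, 'i) vbundle"
  assumes atlas: "complex_atlas \<A>" and vbundle: "holomorphic_vector_bundle \<A> E"
begin

abbreviation "I \<equiv> vb_idx E"

lemma finite_I: "finite I"
  using vbundle unfolding holomorphic_vector_bundle_def by simp

lemma fiber_closed:
  assumes "a \<in> fiber E x"
  shows "b \<in> fiber E x \<Longrightarrow> vb_add E a b \<in> fiber E x" "vb_scale E c a \<in> fiber E x"
proof -
  have "\<forall>x. \<forall>a\<in>fiber E x. (\<forall>b\<in>fiber E x. vb_add E a b \<in> fiber E x) \<and> (\<forall>c. vb_scale E c a \<in> fiber E x)"
    using vbundle unfolding holomorphic_vector_bundle_def by (elim conjE)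
  then show "b \<in> fiber E x \<Longrightarrow> vb_add E a b \<in> fiber E x" "vb_scale E c a \<in> fiber E x"
    using assms by simp_all
qed

lemma trivE:
  obtains U \<tau> where "(U, \<tau>) \<in> vb_triv E" "x \<in> U"
proof -
  have "x \<in> (\<Union>t\<in>vb_triv E. fst t)" using vbundle unfolding holomorphic_vector_bundle_def by simp
  then show thesis using that by (metis UN_E prod.collapse)
qed

lemma triv:
  assumes "(U, \<tau>) \<in> vb_triv E"
  shows triv_open: "open U"
    and triv_ex1: "x \<in> U \<Longrightarrow> \<exists>!e. e \<in> fiber E x \<and> (\<forall>i\<in>I. \<tau> e i = z i)"
    and triv_add: "x \<in> U \<Longrightarrow> a \<in> fiber E x \<Longrightarrow> b \<in> fiber E x \<Longrightarrow> i \<in> I \<Longrightarrow> \<tau> (vb_add E a b) i = \<tau> a i + \<tau> b i"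
    and triv_scale: "x \<in> U \<Longrightarrow> a \<in> fiber E x \<Longrightarrow> i \<in> I \<Longrightarrow> \<tau> (vb_scale E c a) i = c * \<tau> a i"
proof -
  let ?P = "\<lambda>U \<tau>. open U \<and> (\<forall>x\<in>U.
        (\<forall>z::'i \<Rightarrow> complex. \<exists>!e. e \<in> fiber E x \<and> (\<forall>i\<in>I. \<tau> e i = z i)) \<and>
        (\<forall>a\<in>fiber E x. \<forall>i\<in>I.
           (\<forall>b\<in>fiber E x. \<tau> (vb_add E a b) i = \<tau> a i + \<tau> b i) \<and>
           (\<forall>c. \<tau> (vb_scale E c a) i = c * \<tau> a i)))"
  have "\<forall>(U, \<tau>)\<in>vb_triv E. ?P U \<tau>"
    using vbundle unfolding holomorphic_vector_bundle_def by (elim conjE)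
  from bspec[OF this assms] have *: "?P U \<tau>" unfolding prod.case .
  then show "open U" by simp
  show "x \<in> U \<Longrightarrow> \<exists>!e. e \<in> fiber E x \<and> (\<forall>i\<in>I. \<tau> e i = z i)" using * by simp
  show "x \<in> U \<Longrightarrow> a \<in> fiber E x \<Longrightarrow> b \<in> fiber E x \<Longrightarrow> i \<in> I \<Longrightarrow> \<tau> (vb_add E a b) i = \<tau> a i + \<tau> b i" using * by simp
  show "x \<in> U \<Longrightarrow> a \<in> fiber E x \<Longrightarrow> i \<in> I \<Longrightarrow> \<tau> (vb_scale E c a) i = c * \<tau> a i" using * by simp
qed

lemma triv_transition:
  assumes "(U, \<tau>) \<in> vb_triv E" "(V, \<sigma>) \<in> vb_triv E"
  obtains g where "\<And>i j. i \<in> I \<Longrightarrow> j \<in> I \<Longrightarrow> holo_fun \<A> (U \<inter> V) (\<lambda>x. g x i j)"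
    "\<And>x e i. x \<in> U \<inter> V \<Longrightarrow> e \<in> fiber E x \<Longrightarrow> i \<in> I \<Longrightarrow> \<sigma> e i = (\<Sum>j\<in>I. g x i j * \<tau> e j)"
proof -
  let ?P = "\<lambda>U \<tau> V \<sigma>. \<exists>g::'x \<Rightarrow> 'i \<Rightarrow> 'i \<Rightarrow> complex.
        (\<forall>i\<in>I. \<forall>j\<in>I. holo_fun \<A> (U \<inter> V) (\<lambda>x. g x i j)) \<and>
        (\<forall>x\<in>U \<inter> V. \<forall>e\<in>fiber E x. \<forall>i\<in>I. \<sigma> e i = (\<Sum>j\<in>I. g x i j * \<tau> e j))"
  have "\<forall>(U, \<tau>)\<in>vb_triv E. \<forall>(V, \<sigma>)\<in>vb_triv E. ?P U \<tau> V \<sigma>"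
    using vbundle unfolding holomorphic_vector_bundle_def by (elim conjE)
  from bspec[OF this assms(1), unfolded prod.case, THEN bspec, OF assms(2)]
  have "?P U \<tau> V \<sigma>" unfolding prod.case .
  then show thesis using that by blast
qed

lemma frame:
  assumes "(U, \<tau>) \<in> vb_triv E" "x \<in> U"
  shows frame_fiber: "frame E \<tau> x i \<in> fiber E x"
    and triv_frame: "j \<in> I \<Longrightarrow> \<tau> (frame E \<tau> x i) j = (if j = i then 1 else 0)"
  using theI'[OF triv_ex1[OF assms, of "\<lambda>j. if j = i then 1 else 0"]] unfolding frame_def by blast+

lemma covectorsD:
  assumes "\<xi> \<in> covectors E x"
  shows covectors_add: "a \<in> fiber E x \<Longrightarrow> b \<in> fiber E x \<Longrightarrow> \<xi> (vb_add E a b) = \<xi> a + \<xi> b"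
    and covectors_scale: "a \<in> fiber E x \<Longrightarrow> \<xi> (vb_scale E c a) = c * \<xi> a"
    and covectors_outside: "a \<notin> fiber E x \<Longrightarrow> \<xi> a = 0"
  using assms unfolding covectors_def by blast+

lemma covectors_lincomb:
  assumes \<eta>: "\<And>i. i \<in> S \<Longrightarrow> \<eta> i \<in> covectors E x"
  shows "(\<lambda>e. \<Sum>i\<in>S. c i * \<eta> i e) \<in> covectors E x"
  unfolding covectors_def mem_Collect_eq
proof (intro conjI ballI allI impI)
  fix a b assume ab: "a \<in> fiber E x" "b \<in> fiber E x"
  have "(\<Sum>i\<in>S. c i * \<eta> i (vb_add E a b)) = (\<Sum>i\<in>S. c i * \<eta> i a + c i * \<eta> i b)"
    using covectors_add[OF \<eta> ab] by (intro sum.cong) (simp_all add: distrib_left)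
  then show "(\<Sum>i\<in>S. c i * \<eta> i (vb_add E a b)) = (\<Sum>i\<in>S. c i * \<eta> i a) + (\<Sum>i\<in>S. c i * \<eta> i b)"
    by (simp add: sum.distrib)
next
  fix a d assume a: "a \<in> fiber E x"
  show "(\<Sum>i\<in>S. c i * \<eta> i (vb_scale E d a)) = d * (\<Sum>i\<in>S. c i * \<eta> i a)"
    unfolding sum_distrib_left using covectors_scale[OF \<eta> a] by (intro sum.cong) simp_all
next
  fix a assume a: "a \<notin> fiber E x"
  show "(\<Sum>i\<in>S. c i * \<eta> i a) = 0"
    using covectors_outside[OF \<eta> a] by (intro sum.neutral) simp
qed

lemma covectors_scaled: "\<xi> \<in> covectors E x \<Longrightarrow> (\<lambda>e. c * \<xi> e) \<in> covectors E x"
  using covectors_lincomb[of "{()}" "\<lambda>_. \<xi>" x "\<lambda>_. c"] by simp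

lemma zero_covector: "(\<lambda>e. 0) \<in> covectors E x"
  using covectors_lincomb[of "{}" undefined x undefined] by simp

lemma coframe_covector:
  assumes "(U, \<tau>) \<in> vb_triv E" "x \<in> U" "i \<in> I"
  shows "coframe E \<tau> x i \<in> covectors E x"
  unfolding covectors_def coframe_def
  using triv_add[OF assms(1,2)] triv_scale[OF assms(1,2)] assms(3) fiber_closed by auto

lemma coframe_frame:
  assumes "(U, \<tau>) \<in> vb_triv E" "x \<in> U" "j \<in> I"
  shows "coframe E \<tau> x j (frame E \<tau> x i) = (if j = i then 1 else 0)"
  using frame[OF assms(1,2)] assms(3) by (simp add: coframe_def)

text \<open>The linear structure of a fiber is accessible only through the trivializations. The linear combination is
therefore built one frame vector at a time, so that every covector is seen to act linearly on it.\<close>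

lemma lincomb_of_frame:
  assumes t: "(U, \<tau>) \<in> vb_triv E" "x \<in> U" and "J \<subseteq> I"
  shows "\<exists>e\<in>fiber E x. (\<forall>i\<in>I. \<tau> e i = (if i \<in> J then z i else 0)) \<and>
    (\<forall>\<xi>\<in>covectors E x. \<xi> e = (\<Sum>i\<in>J. z i * \<xi> (frame E \<tau> x i)))"
  using finite_subset[OF \<open>J \<subseteq> I\<close> finite_I] \<open>J \<subseteq> I\<close>
proof (induction J rule: finite_induct)
  case empty
  obtain e where e: "e \<in> fiber E x" "\<forall>i\<in>I. \<tau> e i = 0"
    using triv_ex1[OF t, of "\<lambda>_. 0"] by blast
  have "vb_scale E 0 e = e"
    using triv_ex1[OF t, of "\<lambda>_. 0"] e fiber_closed(2)[OF e(1)] triv_scale[OF t e(1), of _ 0] by (metis mult_zero_left)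
  then have "\<xi> e = 0" if "\<xi> \<in> covectors E x" for \<xi>
    using covectors_scale[OF that e(1), of 0] by simp
  then show ?case using e by auto
next
  case (insert k J)
  then obtain e where e: "e \<in> fiber E x" "\<forall>i\<in>I. \<tau> e i = (if i \<in> J then z i else 0)"
    "\<forall>\<xi>\<in>covectors E x. \<xi> e = (\<Sum>i\<in>J. z i * \<xi> (frame E \<tau> x i))" by blast
  have f: "vb_scale E (z k) (frame E \<tau> x k) \<in> fiber E x" by (intro fiber_closed frame_fiber[OF t])
  show ?case
  proof (intro bexI[of _ "vb_add E (vb_scale E (z k) (frame E \<tau> x k)) e"] conjI ballI)
    show "vb_add E (vb_scale E (z k) (frame E \<tau> x k)) e \<in> fiber E x" by (intro fiber_closed f e)
    fix i assume "i \<in> I"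
    then show "\<tau> (vb_add E (vb_scale E (z k) (frame E \<tau> x k)) e) i = (if i \<in> insert k J then z i else 0)"
      using e insert.hyps by (simp add: triv_add[OF t f] triv_scale[OF t frame_fiber[OF t]] triv_frame[OF t])
  next
    fix \<xi> assume "\<xi> \<in> covectors E x"
    then show "\<xi> (vb_add E (vb_scale E (z k) (frame E \<tau> x k)) e) = (\<Sum>i\<in>insert k J. z i * \<xi> (frame E \<tau> x i))"
      using e insert.hyps f by (simp add: covectors_add covectors_scale frame_fiber[OF t])
  qed
qed

lemma covector_expansion:
  assumes t: "(U, \<tau>) \<in> vb_triv E" "x \<in> U" and \<xi>: "\<xi> \<in> covectors E x"
  shows "\<xi> = (\<lambda>e. \<Sum>i\<in>I. \<xi> (frame E \<tau> x i) * coframe E \<tau> x i e)"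
proof
  fix e
  show "\<xi> e = (\<Sum>i\<in>I. \<xi> (frame E \<tau> x i) * coframe E \<tau> x i e)"
  proof (cases "e \<in> fiber E x")
    case True
    obtain e' where e': "e' \<in> fiber E x" "\<forall>i\<in>I. \<tau> e' i = \<tau> e i" "\<xi> e' = (\<Sum>i\<in>I. \<tau> e i * \<xi> (frame E \<tau> x i))"
      using lincomb_of_frame[OF t subset_refl, of "\<tau> e"] \<xi> by auto
    have "e' = e" using triv_ex1[OF t, of "\<tau> e"] e' True by blast
    then show ?thesis using e'(3) True by (simp add: coframe_def mult.commute)
  qed (use covectors_outside[OF \<xi>] in \<open>simp add: coframe_def\<close>)
qed

abbreviation "multi_indices m \<equiv> {J. length J = m \<and> set J \<subseteq> I}"

lemma tensor_update:
  assumes T: "T \<in> tensors E m x" and us: "length us = m" "set us \<subseteq> covectors E x" "k < m"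
  shows "\<xi> \<in> covectors E x \<Longrightarrow> \<eta> \<in> covectors E x \<Longrightarrow> T (us[k := (\<lambda>e. \<xi> e + \<eta> e)]) = T (us[k := \<xi>]) + T (us[k := \<eta>])"
    "\<xi> \<in> covectors E x \<Longrightarrow> T (us[k := (\<lambda>e. c * \<xi> e)]) = c * T (us[k := \<xi>])"
  using assms unfolding tensors_def by blast+

lemma tensor_update_lincomb:
  assumes T: "T \<in> tensors E m x" and us: "length us = m" "set us \<subseteq> covectors E x" "k < m"
    and "finite S" "\<And>i. i \<in> S \<Longrightarrow> \<eta> i \<in> covectors E x"
  shows "T (us[k := (\<lambda>e. \<Sum>i\<in>S. c i * \<eta> i e)]) = (\<Sum>i\<in>S. c i * T (us[k := \<eta> i]))"
  using assms(5,6)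
proof (induction S rule: finite_induct)
  case empty
  show ?case using tensor_update(2)[OF T us zero_covector, of 0] by simp
next
  case (insert i S)
  then show ?case
    using tensor_update(1)[OF T us covectors_scaled[of "\<eta> i" x "c i"] covectors_lincomb[of S \<eta> x c]]
    by (simp add: tensor_update(2)[OF T us])
qed

text \<open>The slots are expanded from left to right: after \<open>k\<close> steps the first \<open>k\<close> of them contain members of the
coframe, and the others still contain \<open>\<xi>\<close>.\<close>

lemma tensor_diagonal_expansion:
  assumes t: "(U, \<tau>) \<in> vb_triv E" "x \<in> U" and T: "T \<in> tensors E m x" and \<xi>: "\<xi> \<in> covectors E x"
  shows "T (replicate m \<xi>) =
    (\<Sum>J\<in>multi_indices m. T (map (coframe E \<tau> x) J) * prod_list (map (\<lambda>i. \<xi> (frame E \<tau> x i)) J))"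
proof -
  let ?f = "coframe E \<tau> x" and ?c = "\<lambda>i. \<xi> (frame E \<tau> x i)"
  have "T (replicate m \<xi>) =
    (\<Sum>J\<in>multi_indices k. T (map ?f J @ replicate (m - k) \<xi>) * prod_list (map ?c J))" if "k \<le> m" for k
    using that
  proof (induction k)
    case 0
    then show ?case by (simp cong: conj_cong)
  next
    case (Suc k)
    have expand: "T (map ?f J @ replicate (m - k) \<xi>) = (\<Sum>i\<in>I. ?c i * T (map ?f (J @ [i]) @ replicate (m - Suc k) \<xi>))"
      if J: "J \<in> multi_indices k" for J
    proof -
      let ?us = "map ?f J @ replicate (m - k) \<xi>"
      have len: "length ?us = m" using J Suc.prems by simp
      have cov: "set ?us \<subseteq> covectors E x" using J \<xi> coframe_covector[OF t] by auto
      have upd: "?us[k := \<eta>] = map ?f J @ \<eta> # replicate (m - Suc k) \<xi>" for \<eta>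
        using J Suc.prems by (auto simp: list_update_append Suc_diff_Suc[symmetric])
      have "?us = ?us[k := \<xi>]" unfolding upd using Suc.prems by (simp add: Suc_diff_Suc[symmetric])
      then have "T ?us = T (?us[k := (\<lambda>e. \<Sum>i\<in>I. ?c i * ?f i e)])"
        using covector_expansion[OF t \<xi>] by metis
      also have "\<dots> = (\<Sum>i\<in>I. ?c i * T (?us[k := ?f i]))"
        using Suc.prems coframe_covector[OF t] by (intro tensor_update_lincomb[OF T len cov] finite_I) auto
      finally show ?thesis unfolding upd by simp
    qed
    have "T (replicate m \<xi>) = (\<Sum>J\<in>multi_indices k. T (map ?f J @ replicate (m - k) \<xi>) * prod_list (map ?c J))"
      using Suc by simp
    also have "\<dots> = (\<Sum>J\<in>multi_indices k. \<Sum>i\<in>I. T (map ?f (J @ [i]) @ replicate (m - Suc k) \<xi>) * prod_list (map ?c (J @ [i])))"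
      by (intro sum.cong refl) (simp only: expand sum_distrib_right, simp add: mult_ac)
    also have "\<dots> = (\<Sum>(J, i)\<in>multi_indices k \<times> I. T (map ?f (J @ [i]) @ replicate (m - Suc k) \<xi>) * prod_list (map ?c (J @ [i])))"
      by (rule sum.cartesian_product)
    also have "\<dots> = (\<Sum>J\<in>multi_indices (Suc k). T (map ?f J @ replicate (m - Suc k) \<xi>) * prod_list (map ?c J))"
    proof (rule sum.reindex_bij_witness[of _ "\<lambda>J. (butlast J, last J)" "\<lambda>(J, i). J @ [i]"])
      fix J assume J: "J \<in> multi_indices (Suc k)"
      then have ne: "J \<noteq> []" by auto
      show "(case (butlast J, last J) of (J, i) \<Rightarrow> J @ [i]) = J" using ne by simp
      show "(butlast J, last J) \<in> multi_indices k \<times> I"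
        using J ne last_in_set[OF ne] by (auto dest: in_set_butlastD)
    qed auto
    finally show ?case .
  qed
  from this[of m] show ?thesis by simp
qed

lemma fiber_dual: "fiber (dual_bundle E) x = {(x, \<xi>) |\<xi>. \<xi> \<in> covectors E x}"
  unfolding fiber_def dual_bundle_def by auto

lemma fiber_tensor: "fiber (tensor_power E m) x = {(x, T) |T. T \<in> tensors E m x}"
  unfolding fiber_def tensor_power_def by auto

lemma triv_dual:
  "(U, \<tau>) \<in> vb_triv E \<Longrightarrow> (U, \<lambda>(x, \<xi>) i. \<xi> (frame E \<tau> x i)) \<in> vb_triv (dual_bundle E)"
  unfolding dual_bundle_def by auto

lemma holo_section_dualD:
  assumes "holo_section \<A> (dual_bundle E) W u"
  shows "open W" "x \<in> W \<Longrightarrow> fst (u x) = x" "x \<in> W \<Longrightarrow> snd (u x) \<in> covectors E x"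
    "(U, \<tau>) \<in> vb_triv E \<Longrightarrow> i \<in> I \<Longrightarrow> holo_fun \<A> (U \<inter> W) (\<lambda>x. snd (u x) (frame E \<tau> x i))"
proof -
  show "open W" using assms unfolding holo_section_def by blast
  show 1: "x \<in> W \<Longrightarrow> fst (u x) = x" and "x \<in> W \<Longrightarrow> snd (u x) \<in> covectors E x" for x
    using assms unfolding holo_section_def fiber_dual by auto
  assume t: "(U, \<tau>) \<in> vb_triv E" "i \<in> I"
  then have "holo_fun \<A> (U \<inter> W) (\<lambda>x. (\<lambda>(x, \<xi>) i. \<xi> (frame E \<tau> x i)) (u x) i)"
    using assms triv_dual[OF t(1)] unfolding holo_section_def by (auto simp: dual_bundle_def)
  then show "holo_fun \<A> (U \<inter> W) (\<lambda>x. snd (u x) (frame E \<tau> x i))"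
    by (rule holo_fun_cong[OF atlas, rotated 2])
       (use triv_open[OF t(1)] \<open>open W\<close> 1 in \<open>auto simp: case_prod_beta\<close>)
qed

lemma holo_section_tensorD:
  assumes "holo_section \<A> (tensor_power E m) W s"
  shows "x \<in> W \<Longrightarrow> fst (s x) = x" "x \<in> W \<Longrightarrow> snd (s x) \<in> tensors E m x"
    "(U, \<tau>) \<in> vb_triv E \<Longrightarrow> J \<in> multi_indices m \<Longrightarrow> holo_fun \<A> (U \<inter> W) (\<lambda>x. snd (s x) (map (coframe E \<tau> x) J))"
proof -
  have "open W" using assms unfolding holo_section_def by blast
  show 1: "x \<in> W \<Longrightarrow> fst (s x) = x" and "x \<in> W \<Longrightarrow> snd (s x) \<in> tensors E m x" for x
    using assms unfolding holo_section_def fiber_tensor by auto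
  assume t: "(U, \<tau>) \<in> vb_triv E" "J \<in> multi_indices m"
  have "(U, \<lambda>(x, T) J. T (map (coframe E \<tau> x) J)) \<in> vb_triv (tensor_power E m)"
    using t unfolding tensor_power_def by auto
  then have "holo_fun \<A> (U \<inter> W) (\<lambda>x. (\<lambda>(x, T) J. T (map (coframe E \<tau> x) J)) (s x) J)"
    using assms t(2) unfolding holo_section_def by (auto simp: tensor_power_def)
  then show "holo_fun \<A> (U \<inter> W) (\<lambda>x. snd (s x) (map (coframe E \<tau> x) J))"
    by (rule holo_fun_cong[OF atlas, rotated 2])
       (use triv_open[OF t(1)] \<open>open W\<close> 1 in \<open>auto simp: case_prod_beta\<close>)
qed

lemma tpairing_expansion:
  assumes t: "(U, \<tau>) \<in> vb_triv E" "x \<in> U" and u: "snd v \<in> covectors E x" and s: "snd T \<in> tensors E m x"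
  shows "tpairing m v T = (\<Sum>J\<in>multi_indices m.
    snd T (map (coframe E \<tau> x) J) * prod_list (map (\<lambda>i. snd v (frame E \<tau> x i)) J))"
  unfolding tpairing_def by (rule tensor_diagonal_expansion[OF t s u])

lemma holo_fun_tpairing:
  assumes u: "holo_section \<A> (dual_bundle E) W u" and s: "holo_section \<A> (tensor_power E m) UNIV s"
  shows "holo_fun \<A> W (\<lambda>x. tpairing m (u x) (s x))"
proof (rule holo_fun_local)
  fix x assume "x \<in> W"
  obtain U \<tau> where t: "(U, \<tau>) \<in> vb_triv E" "x \<in> U" using trivE by blast
  have "holo_fun \<A> (U \<inter> W) (\<lambda>x. \<Sum>J\<in>multi_indices m.
    snd (s x) (map (coframe E \<tau> x) J) * prod_list (map (\<lambda>i. snd (u x) (frame E \<tau> x i)) J))"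
  proof (intro holo_fun_sum holo_fun_mult holo_fun_prod_list)
    fix J assume J: "J \<in> multi_indices m"
    show "holo_fun \<A> (U \<inter> W) (\<lambda>x. snd (s x) (map (coframe E \<tau> x) J))"
      using holo_section_tensorD(3)[OF s t(1) J] by (rule holo_fun_subset) auto
    fix i assume "i \<in> set J"
    then show "holo_fun \<A> (U \<inter> W) (\<lambda>x. snd (u x) (frame E \<tau> x i))"
      using holo_section_dualD(4)[OF u t(1)] J by auto
  qed
  then have "holo_fun \<A> (U \<inter> W) (\<lambda>x. tpairing m (u x) (s x))"
  proof (rule holo_fun_cong[OF atlas, rotated 2])
    show "open (U \<inter> W)" using triv_open[OF t(1)] holo_section_dualD(1)[OF u] by blast
    fix y assume "y \<in> U \<inter> W"
    then show "(\<Sum>J\<in>multi_indices m. snd (s y) (map (coframe E \<tau> y) J) *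
        prod_list (map (\<lambda>i. snd (u y) (frame E \<tau> y i)) J)) = tpairing m (u y) (s y)"
      using holo_section_dualD(3)[OF u] holo_section_tensorD(2)[OF s]
      by (intro tpairing_expansion[OF t(1), symmetric]) auto
  qed
  then show "\<exists>N. x \<in> N \<and> holo_fun \<A> (N \<inter> W) (\<lambda>x. tpairing m (u x) (s x))" using t by blast
qed

text \<open>These sections pass through every point of the dual bundle over the domain of \<open>\<tau>\<close>. They turn estimates
along sections into estimates on the total space.\<close>

definition const_section :: "('e \<Rightarrow> 'i \<Rightarrow> complex) \<Rightarrow> ('i \<Rightarrow> complex) \<Rightarrow> 'x \<Rightarrow> 'x \<times> ('e \<Rightarrow> complex)" where
  "const_section \<tau> c x = (x, \<lambda>e. \<Sum>i\<in>I. c i * coframe E \<tau> x i e)"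

lemma const_section_covector:
  assumes "(U, \<tau>) \<in> vb_triv E" "x \<in> U"
  shows "snd (const_section \<tau> c x) \<in> covectors E x"
  unfolding const_section_def snd_conv by (intro covectors_lincomb coframe_covector[OF assms])

lemma const_section_frame:
  assumes "(U, \<tau>) \<in> vb_triv E" "x \<in> U" "i \<in> I"
  shows "snd (const_section \<tau> c x) (frame E \<tau> x i) = c i"
proof -
  have "(\<Sum>j\<in>I. c j * coframe E \<tau> x j (frame E \<tau> x i)) = (\<Sum>j\<in>I. if j = i then c j else 0)"
    using coframe_frame[OF assms(1,2)] by (intro sum.cong) auto
  then show ?thesis using finite_I assms(3) by (simp add: const_section_def)
qed

lemma const_section_eq:
  assumes "(U, \<tau>) \<in> vb_triv E" "x \<in> U" "\<xi> \<in> covectors E x"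
  shows "const_section \<tau> (\<lambda>i. \<xi> (frame E \<tau> x i)) x = (x, \<xi>)"
  unfolding const_section_def using covector_expansion[OF assms] by metis

lemma holo_section_const_section:
  assumes t: "(U, \<tau>) \<in> vb_triv E" and "open W" "W \<subseteq> U"
  shows "holo_section \<A> (dual_bundle E) W (const_section \<tau> c)"
  unfolding holo_section_def
proof (intro conjI ballI)
  fix x assume "x \<in> W"
  then show "const_section \<tau> c x \<in> fiber (dual_bundle E) x"
    using const_section_covector[OF t, of x c] \<open>W \<subseteq> U\<close> unfolding fiber_dual by (auto simp: const_section_def)
next
  fix a assume "a \<in> vb_triv (dual_bundle E)"
  then obtain V \<sigma> where a: "a = (V, \<lambda>(x, \<xi>) i. \<xi> (frame E \<sigma> x i))" and \<sigma>: "(V, \<sigma>) \<in> vb_triv E"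
    unfolding dual_bundle_def by auto
  obtain g where g: "\<And>i j. i \<in> I \<Longrightarrow> j \<in> I \<Longrightarrow> holo_fun \<A> (V \<inter> U) (\<lambda>x. g x i j)"
    "\<And>x e i. x \<in> V \<inter> U \<Longrightarrow> e \<in> fiber E x \<Longrightarrow> i \<in> I \<Longrightarrow> \<tau> e i = (\<Sum>j\<in>I. g x i j * \<sigma> e j)"
    using triv_transition[OF \<sigma> t] by blast
  have "holo_fun \<A> (V \<inter> W) (\<lambda>x. (\<lambda>(x, \<xi>) i. \<xi> (frame E \<sigma> x i)) (const_section \<tau> c x) i)" if i: "i \<in> I" for i
  proof (rule holo_fun_cong[OF atlas])
    show "open (V \<inter> W)" using triv_open[OF \<sigma>] \<open>open W\<close> by blast
    show "holo_fun \<A> (V \<inter> W) (\<lambda>x. \<Sum>j\<in>I. c j * g x j i)"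
      using i \<open>W \<subseteq> U\<close> by (intro holo_fun_sum holo_fun_mult holo_fun_const holo_fun_subset[OF g(1)]) auto
    fix x assume x: "x \<in> V \<inter> W"
    have "coframe E \<tau> x j (frame E \<sigma> x i) = g x j i" if j: "j \<in> I" for j
    proof -
      have "coframe E \<tau> x j (frame E \<sigma> x i) = (\<Sum>k\<in>I. g x j k * \<sigma> (frame E \<sigma> x i) k)"
        using x \<open>W \<subseteq> U\<close> j frame_fiber[OF \<sigma>, of x i] by (simp add: coframe_def) (intro g(2); auto)
      also have "\<dots> = (\<Sum>k\<in>I. if k = i then g x j k else 0)"
        using x triv_frame[OF \<sigma>] by (intro sum.cong) auto
      also have "\<dots> = g x j i" using finite_I i by simp
      finally show ?thesis .
    qed
    then show "(\<Sum>j\<in>I. c j * g x j i) = (\<lambda>(x, \<xi>) i. \<xi> (frame E \<sigma> x i)) (const_section \<tau> c x) i"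
      by (simp add: const_section_def)
  qed
  then show "case a of (U, \<tau>') \<Rightarrow> \<forall>i\<in>vb_idx (dual_bundle E). holo_fun \<A> (U \<inter> W) (\<lambda>x. \<tau>' (const_section \<tau> c x) i)"
    unfolding a by (simp add: dual_bundle_def)
qed fact

lemma holo_section_subset:
  assumes "holo_section \<A> F W s" "open W'" "W' \<subseteq> W"
  shows "holo_section \<A> F W' s"
  unfolding holo_section_def
proof (intro conjI ballI)
  fix a assume "a \<in> vb_triv F"
  then have "case a of (U, \<tau>) \<Rightarrow> \<forall>i\<in>vb_idx F. holo_fun \<A> (U \<inter> W) (\<lambda>x. \<tau> (s x) i)"
    using assms unfolding holo_section_def by blast
  then show "case a of (U, \<tau>) \<Rightarrow> \<forall>i\<in>vb_idx F. holo_fun \<A> (U \<inter> W') (\<lambda>x. \<tau> (s x) i)"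
    using assms(3) by (cases a) (auto elim!: holo_fun_subset)
qed (use assms in \<open>auto simp: holo_section_def\<close>)

lemma tpairing_scale:
  assumes "\<xi> \<in> covectors E x" "T \<in> tensors E m x"
  shows "tpairing m (x, \<lambda>e. c * \<xi> e) (y, T) = c ^ m * tpairing m (x, \<xi>) (y, T)"
proof -
  obtain U \<tau> where t: "(U, \<tau>) \<in> vb_triv E" "x \<in> U" using trivE by blast
  have p: "prod_list (map (\<lambda>i. c * f i) J) = c ^ m * prod_list (map f J)" if "length J = m" for f :: "'i \<Rightarrow> complex" and J
    using that by (induction J arbitrary: m) auto
  show ?thesis
    using assms covectors_scaled[OF assms(1), of c]
    by (subst (1 2) tpairing_expansion[OF t]) (auto simp: p sum_distrib_left mult_ac intro!: sum.cong)
qed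

lemma tpairing_vec_tpow:
  assumes "a \<in> fiber E x" "\<xi> \<in> covectors E x"
  shows "tpairing m (x, \<xi>) (vec_tpow E m a) = \<xi> a ^ m"
  using assms by (auto simp: tpairing_def vec_tpow_def fiber_def prod_list_replicate)

lemma tensors_scaled: "T \<in> tensors E m x \<Longrightarrow> (\<lambda>us. c * T us) \<in> tensors E m x"
  unfolding tensors_def by (auto simp: algebra_simps)

lemma holo_section_tensor_scaled:
  assumes s: "holo_section \<A> (tensor_power E m) UNIV s"
  shows "holo_section \<A> (tensor_power E m) UNIV (\<lambda>x. vb_scale (tensor_power E m) c (s x))"
  unfolding holo_section_def
proof (intro conjI ballI)
  have scale: "vb_scale (tensor_power E m) c (s x) = (x, \<lambda>us. c * snd (s x) us)" for x
    using holo_section_tensorD(1)[OF s, of x] by (simp add: tensor_power_def case_prod_beta)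
  show "vb_scale (tensor_power E m) c (s x) \<in> fiber (tensor_power E m) x" for x
    unfolding scale fiber_tensor using tensors_scaled[OF holo_section_tensorD(2)[OF s]] by auto
  fix a assume "a \<in> vb_triv (tensor_power E m)"
  then obtain U \<tau> where a: "a = (U, \<lambda>(x, T) J. T (map (coframe E \<tau> x) J))" and \<tau>: "(U, \<tau>) \<in> vb_triv E"
    unfolding tensor_power_def by auto
  have "holo_fun \<A> (U \<inter> UNIV) (\<lambda>x. c * snd (s x) (map (coframe E \<tau> x) J))" if "J \<in> multi_indices m" for J
    by (intro holo_fun_mult holo_fun_const holo_section_tensorD(3)[OF s \<tau> that])
  then show "case a of (U, \<tau>) \<Rightarrow> \<forall>i\<in>vb_idx (tensor_power E m).
      holo_fun \<A> (U \<inter> UNIV) (\<lambda>x. \<tau> (vb_scale (tensor_power E m) c (s x)) i)"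
    unfolding a scale by (simp add: tensor_power_def)
qed simp

end

section \<open>Powers and integrals in the extended nonnegative reals\<close>

lemma epow_ennreal [simp]: "0 \<le> x \<Longrightarrow> epow (ennreal x) a = ennreal (x powr a)"
  by (simp add: epow_def)

lemma epow_top [simp]: "epow top a = top"
  by (simp add: epow_def)

lemma epow_zero [simp]: "epow 0 a = 0"
  by (simp add: epow_def)

lemma epow_one_right [simp]: "epow x 1 = x"
  by (cases x) simp_all

lemma epow_mono: "0 \<le> a \<Longrightarrow> x \<le> y \<Longrightarrow> epow x a \<le> epow y a"
  by (cases x; cases y) (auto simp: powr_mono2 top_unique)

lemma epow_epow: "epow (epow x a) b = epow x (a * b)"
  by (cases x) (simp_all add: powr_powr)

lemma epow_le_iff: "0 < a \<Longrightarrow> epow x a \<le> y \<longleftrightarrow> x \<le> epow y (1 / a)"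
  using epow_mono[of "1 / a" "epow x a" y] epow_mono[of a x "epow y (1 / a)"] by (auto simp: epow_epow)

lemma epow_less_iff: "0 < a \<Longrightarrow> epow x a < y \<longleftrightarrow> x < epow y (1 / a)"
  using epow_le_iff[of "1 / a" y x] by (auto simp: not_le[symmetric])

lemma epow_mult: "0 < a \<Longrightarrow> epow (x * y) a = epow x a * epow y a"
proof (cases x; cases y)
  fix r s assume "x = ennreal r" "0 \<le> r" "y = ennreal s" "0 \<le> s"
  then show ?thesis by (simp add: ennreal_mult[symmetric] powr_mult)
next
  fix r assume a: "0 < a" and "x = ennreal r" "0 \<le> r" "y = top"
  then show ?thesis by (cases "r = 0") (simp_all add: ennreal_mult_top)
next
  fix r assume a: "0 < a" and "y = ennreal r" "0 \<le> r" "x = top"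
  then show ?thesis by (cases "r = 0") (simp_all add: ennreal_top_mult)
qed simp

lemma epow_realpow: "n > 0 \<Longrightarrow> epow x (real n) = x ^ n"
proof (cases x)
  case (real r)
  moreover assume "n > 0"
  ultimately show ?thesis by (cases "r = 0") (simp_all add: ennreal_power powr_realpow)
qed (simp add: top_power_ennreal)

lemma epow_less_top_iff: "epow x a < top \<longleftrightarrow> x < top"
  by (cases x) simp_all

text \<open>Here \<open>f\<close> may fail to be measurable, as the norm of a section in a singular metric may. The integral is then
a lower integral, and scaling the simple functions below \<open>c * f\<close> gives the inequality.\<close>

lemma nn_integral_cmult_le:
  assumes "0 \<le> c"
  shows "(\<integral>\<^sup>+x. ennreal c * f x \<partial>M) \<le> ennreal c * (\<integral>\<^sup>+x. f x \<partial>M)"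
proof (cases "c = 0")
  case False
  then have "c > 0" using assms by simp
  have cancel: "ennreal c * (ennreal (1 / c) * y) = y" "ennreal (1 / c) * (ennreal c * y) = y" for y
    using \<open>c > 0\<close> by (simp_all add: mult.assoc[symmetric] ennreal_mult[symmetric])
  show ?thesis
    unfolding nn_integral_def[of M "\<lambda>x. ennreal c * f x"]
  proof (rule SUP_least, clarify)
    fix g assume g: "simple_function M g" "g \<le> (\<lambda>x. ennreal c * f x)"
    have s: "simple_function M (\<lambda>x. ennreal (1 / c) * g x)" using g(1) by (intro simple_function_mult) auto
    have "ennreal (1 / c) * g x \<le> f x" for x
      using mult_left_mono[OF le_funD[OF g(2), of x], of "ennreal (1 / c)"] cancel(2) by simp
    then have le: "(\<integral>\<^sup>+x. ennreal (1 / c) * g x \<partial>M) \<le> (\<integral>\<^sup>+x. f x \<partial>M)" by (intro nn_integral_mono)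
    have "integral\<^sup>S M g = (\<integral>\<^sup>+x. ennreal c * (ennreal (1 / c) * g x) \<partial>M)"
      using nn_integral_eq_simple_integral[OF g(1)] by (simp add: cancel)
    also have "\<dots> = ennreal c * (\<integral>\<^sup>+x. ennreal (1 / c) * g x \<partial>M)"
      using borel_measurable_simple_function[OF s] by (rule nn_integral_cmult)
    also have "\<dots> \<le> ennreal c * (\<integral>\<^sup>+x. f x \<partial>M)" using le by (rule mult_left_mono) simp
    finally show "integral\<^sup>S M g \<le> ennreal c * (\<integral>\<^sup>+x. f x \<partial>M)" .
  qed
qed simp

section \<open>Dual metrics and upper semicontinuity\<close>

text \<open>Without the squares the dual metric is visibly a supremum of (possibly infinite) seminorms in \<open>\<xi>\<close>.\<close>

lemma dual_metric_eq_SUP: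
  "dual_metric F h (x, \<xi>) = (SUP v\<in>fiber_nz F x. ennreal (cmod (\<xi> v)) / h v)" (is "_ = ?S")
proof -
  let ?r = "\<lambda>v. ennreal (cmod (\<xi> v)) / h v"
  have sq: "(ennreal (cmod (\<xi> v)))\<^sup>2 / (h v)\<^sup>2 = epow (?r v) 2" for v
  proof -
    have "(ennreal (cmod (\<xi> v)))\<^sup>2 / (h v)\<^sup>2 = (?r v)\<^sup>2"
    proof (cases "h v" )
      case (real r)
      then show ?thesis
        by (cases "r = 0"; cases "\<xi> v = 0") (auto simp: ennreal_power divide_ennreal power_divide
            ennreal_divide_zero ennreal_zero_divide)
    qed (simp add: power2_eq_square ennreal_top_mult)
    then show ?thesis using epow_realpow[of 2] by simp
  qed
  have "dual_metric F h (x, \<xi>) = epow (SUP v\<in>fiber_nz F x. epow (?r v) 2) (1 / 2)"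
    by (simp add: dual_metric_def sq)
  also have "\<dots> = ?S"
  proof (rule antisym)
    show "epow (SUP v\<in>fiber_nz F x. epow (?r v) 2) (1 / 2) \<le> ?S"
      by (subst epow_le_iff) (auto intro!: SUP_least epow_mono SUP_upper)
    show "?S \<le> epow (SUP v\<in>fiber_nz F x. epow (?r v) 2) (1 / 2)"
    proof (rule SUP_least)
      fix v assume v: "v \<in> fiber_nz F x"
      have "?r v = epow (epow (?r v) 2) (1 / 2)" by (simp add: epow_epow)
      also have "\<dots> \<le> epow (SUP v\<in>fiber_nz F x. epow (?r v) 2) (1 / 2)"
        using v by (intro epow_mono SUP_upper) auto
      finally show "?r v \<le> \<dots>" .
    qed
  qed
  finally show ?thesis .
qed

text \<open>Subadditivity turns upper semicontinuity along the sections of a coframe into a local bound on the total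
space of the dual bundle.\<close>

lemma dual_metric_lincomb_le:
  "dual_metric F h (x, \<lambda>e. \<Sum>i\<in>S. c i * \<eta> i e) \<le> (\<Sum>i\<in>S. ennreal (cmod (c i)) * dual_metric F h (x, \<eta> i))"
  unfolding dual_metric_eq_SUP
proof (rule SUP_least)
  fix v assume v: "v \<in> fiber_nz F x"
  have "ennreal (cmod (\<Sum>i\<in>S. c i * \<eta> i v)) / h v \<le> ennreal (\<Sum>i\<in>S. cmod (c i) * cmod (\<eta> i v)) / h v"
    by (intro divide_right_mono_ennreal ennreal_leI) (metis (no_types, lifting) norm_mult norm_sum sum.cong)
  also have "\<dots> = (\<Sum>i\<in>S. ennreal (cmod (c i)) * (ennreal (cmod (\<eta> i v)) / h v))"
    by (simp add: ennreal_mult' divide_ennreal_def sum_distrib_right mult.assoc flip: sum_ennreal)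
  also have "\<dots> \<le> (\<Sum>i\<in>S. ennreal (cmod (c i)) * (SUP v\<in>fiber_nz F x. ennreal (cmod (\<eta> i v)) / h v))"
    using v by (intro sum_mono mult_left_mono SUP_upper) auto
  finally show "ennreal (cmod (\<Sum>i\<in>S. c i * \<eta> i v)) / h v \<le> \<dots>" .
qed

lemma usc_onD:
  assumes "usc_on W f" "open W" "x \<in> W" "f x < c"
  obtains N where "open N" "x \<in> N" "N \<subseteq> W" "\<And>y. y \<in> N \<Longrightarrow> f y < c"
proof -
  have "\<forall>\<^sub>F y in at x within W. f y < c" using assms unfolding usc_on_def by blast
  then obtain T where T: "open T" "x \<in> T" "\<And>y. y \<in> T \<Longrightarrow> y \<noteq> x \<Longrightarrow> y \<in> W \<Longrightarrow> f y < c"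
    unfolding eventually_at_topological by blast
  show thesis
  proof (rule that[of "T \<inter> W"])
    fix y assume "y \<in> T \<inter> W"
    then show "f y < c" using T(3)[of y] assms(4) by (cases "y = x") auto
  qed (use T assms in auto)
qed

lemma usc_onI:
  assumes "\<And>x. x \<in> W \<Longrightarrow> f x < \<infinity>"
    and "\<And>x c. x \<in> W \<Longrightarrow> f x < c \<Longrightarrow> \<exists>N. open N \<and> x \<in> N \<and> (\<forall>y\<in>N \<inter> W. f y < c)"
  shows "usc_on W f"
  unfolding usc_on_def eventually_at_topological
proof (intro ballI conjI allI impI)
  fix x c assume "x \<in> W" "f x < c"
  then obtain N where "open N" "x \<in> N" "\<forall>y\<in>N \<inter> W. f y < c" using assms(2) by blast
  then show "\<exists>S. open S \<and> x \<in> S \<and> (\<forall>y\<in>S. y \<noteq> x \<longrightarrow> y \<in> W \<longrightarrow> f y < c)" by blast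
qed (use assms in auto)

lemma usc_on_cong:
  assumes "usc_on W f" "\<And>x. x \<in> W \<Longrightarrow> f x = g x"
  shows "usc_on W g"
  unfolding usc_on_def
proof (intro ballI conjI allI impI)
  fix x assume x: "x \<in> W"
  then show "g x < \<infinity>" using assms unfolding usc_on_def by force
  fix c assume "g x < c"
  then have "\<forall>\<^sub>F y in at x within W. f y < c" using assms x unfolding usc_on_def by simp
  then show "\<forall>\<^sub>F y in at x within W. g y < c"
    using assms(2) by (auto simp: eventually_at_filter elim!: eventually_mono)
qed

lemma usc_on_epow:
  assumes "usc_on W f" "0 < a"
  shows "usc_on W (\<lambda>x. epow (f x) a)"
  using assms unfolding usc_on_def by (simp add: epow_less_iff epow_less_top_iff)

lemma usc_on_borel_measurable:
  fixes f :: "'x::topological_space \<Rightarrow> ennreal"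
  assumes "usc_on W f" "open W"
  shows "(\<lambda>x. if x \<in> W then f x else 0) \<in> borel_measurable borel"
proof (rule borel_measurableI_less)
  fix c
  have "open {x \<in> W. f x < c}"
  proof (subst open_subopen, clarify)
    fix x assume "x \<in> W" "f x < c"
    then obtain N where "open N" "x \<in> N" "N \<subseteq> W" "\<And>y. y \<in> N \<Longrightarrow> f y < c"
      using usc_onD[OF assms] by blast
    then show "\<exists>T. open T \<and> x \<in> T \<and> T \<subseteq> {x \<in> W. f x < c}" by blast
  qed
  moreover have "{x \<in> space borel. (if x \<in> W then f x else 0) < c} = {x \<in> W. f x < c} \<union> (if 0 < c then - W else {})"
    by auto
  ultimately show "{x \<in> space borel. (if x \<in> W then f x else 0) < c} \<in> sets borel"
    using \<open>open W\<close> by (auto intro!: sets.Un borel_comp)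
qed

lemma Lp_norm_le_iff: "p > 0 \<Longrightarrow> Lp_norm dV p h s \<le> y \<longleftrightarrow> (\<integral>\<^sup>+x. epow (h (s x)) p \<partial>dV) \<le> epow y p"
  unfolding Lp_norm_def by (subst epow_le_iff) auto

lemma Lp_norm_scale_le:
  assumes "p > 0" "0 \<le> c" and hom: "\<And>x. h (t x) = ennreal c * h (s x)"
  shows "Lp_norm dV p h t \<le> ennreal c * Lp_norm dV p h s"
proof -
  have "(\<integral>\<^sup>+x. epow (h (t x)) p \<partial>dV) = (\<integral>\<^sup>+x. ennreal (c powr p) * epow (h (s x)) p \<partial>dV)"
    using assms by (simp add: epow_mult)
  also have "\<dots> \<le> ennreal (c powr p) * (\<integral>\<^sup>+x. epow (h (s x)) p \<partial>dV)" by (rule nn_integral_cmult_le) simp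
  also have "\<dots> = epow (ennreal c * Lp_norm dV p h s) p"
    using assms by (simp add: Lp_norm_def epow_mult epow_epow)
  finally show ?thesis by (subst Lp_norm_le_iff[OF \<open>p > 0\<close>])
qed

context holomorphic_bundle
begin

text \<open>Where the tensor power metric is finite, hence almost everywhere, duality bounds the integrand by
\<open>M\<^sup>p\<^sup>m \<bar>s\<bar>\<^sup>p\<close>.\<close>

lemma pairing_Lp_bound:
  assumes "p > 0" "m > 0" and k: "tensor_power_metric dV E h m k"
    and u: "holo_section \<A> (dual_bundle E) W u" and s: "holo_section \<A> (tensor_power E m) UNIV s"
    and le1: "Lp_norm dV p k s \<le> 1" and "0 \<le> M"
    and M: "\<And>y. y \<in> W \<Longrightarrow> dual_metric E h (u y) \<le> ennreal M"
  shows "(\<integral>\<^sup>+y\<in>W. ennreal (cmod (tpairing m (u y) (s y)) powr p) \<partial>dV) \<le> ennreal (M powr (p * real m))"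
proof -
  have sf: "s y \<in> fiber (tensor_power E m) y" for y using s unfolding holo_section_def by blast
  have uf: "u y \<in> fiber (dual_bundle E) y" if "y \<in> W" for y using u that unfolding holo_section_def by blast
  have "AE y in dV. \<forall>v\<in>fiber (tensor_power E m) y. k v < \<infinity>"
    using k unfolding tensor_power_metric_def singular_finsler_metric_def by blast
  then have AE: "AE y in dV. ennreal (cmod (tpairing m (u y) (s y)) powr p) * indicator W y
      \<le> ennreal (M powr (p * real m)) * epow (k (s y)) p"
  proof (rule AE_mp, intro AE_I2 impI)
    fix y assume fin: "\<forall>v\<in>fiber (tensor_power E m) y. k v < \<infinity>"
    show "ennreal (cmod (tpairing m (u y) (s y)) powr p) * indicator W y
      \<le> ennreal (M powr (p * real m)) * epow (k (s y)) p"
    proof (cases "y \<in> W")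
      case True
      have "ennreal (cmod (tpairing m (u y) (s y))) \<le> dual_metric E h (u y) ^ m * k (s y)"
        using k fin sf[of y] uf[OF True] unfolding tensor_power_metric_def by blast
      also have "\<dots> \<le> ennreal M ^ m * k (s y)" by (intro mult_right_mono power_mono M True) auto
      finally have "epow (ennreal (cmod (tpairing m (u y) (s y)))) p \<le> epow (ennreal M ^ m * k (s y)) p"
        using \<open>p > 0\<close> by (intro epow_mono) auto
      also have "\<dots> = ennreal (M powr (p * real m)) * epow (k (s y)) p"
        using assms(1,2,7) by (simp add: epow_mult epow_realpow[symmetric] powr_powr mult.commute)
      finally show ?thesis using True by simp
    qed simp
  qed
  then have "(\<integral>\<^sup>+y\<in>W. ennreal (cmod (tpairing m (u y) (s y)) powr p) \<partial>dV)
      \<le> (\<integral>\<^sup>+y. ennreal (M powr (p * real m)) * epow (k (s y)) p \<partial>dV)"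
    by (rule nn_integral_mono_AE)
  also have "\<dots> \<le> ennreal (M powr (p * real m)) * (\<integral>\<^sup>+y. epow (k (s y)) p \<partial>dV)"
    by (rule nn_integral_cmult_le) simp
  also have "\<dots> \<le> ennreal (M powr (p * real m)) * 1"
    using le1 epow_ennreal[of 1 p] unfolding Lp_norm_le_iff[OF \<open>p > 0\<close>] by (intro mult_left_mono) auto
  finally show ?thesis by simp
qed

end

section \<open>The supremum of pairings with the unit ball\<close>

locale Lp_tensor_setting = holomorphic_bundle \<A> E
  for \<A> :: "('x::t2_space, 'n::finite) chart set" and E :: "('x, 'e, 'i) vbundle" +
  fixes dV :: "'x measure" and p :: real and h :: "'e \<Rightarrow> ennreal"
    and ht :: "nat \<Rightarrow> 'x \<times> (('e \<Rightarrow> complex) list \<Rightarrow> complex) \<Rightarrow> ennreal"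
  assumes p_pos: "p > 0" and volume: "volume_measure \<A> dV"
    and ht: "\<And>m. m \<ge> 1 \<Longrightarrow> tensor_power_metric dV E h m (ht m)"
    and dual_usc: "\<And>W u. holo_section \<A> (dual_bundle E) W u \<Longrightarrow> usc_on W (\<lambda>x. dual_metric E h (u x))"
begin

definition unit_sections :: "nat \<Rightarrow> ('x \<Rightarrow> 'x \<times> (('e \<Rightarrow> complex) list \<Rightarrow> complex)) set" where
  "unit_sections m = {s \<in> Hp \<A> dV p (tensor_power E m) (ht m). Lp_norm dV p (ht m) s \<le> 1}"

definition sup_pairing :: "nat \<Rightarrow> 'x \<times> ('e \<Rightarrow> complex) \<Rightarrow> ennreal" where
  "sup_pairing m v = (SUP s\<in>unit_sections m. ennreal (cmod (tpairing m v (s (fst v)))))"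

lemma unit_sectionsD:
  assumes "s \<in> unit_sections m"
  shows "holo_section \<A> (tensor_power E m) UNIV s" "Lp_norm dV p (ht m) s \<le> 1"
  using assms unfolding unit_sections_def Hp_def by auto

lemma pairing_le_sup:
  "s \<in> unit_sections m \<Longrightarrow> ennreal (cmod (tpairing m v (s (fst v)))) \<le> sup_pairing m v"
  unfolding sup_pairing_def by (rule SUP_upper)

lemma sup_pairing_le:
  assumes "m > 0" and u: "holo_section \<A> (dual_bundle E) W u" and "x \<in> W" and "0 \<le> M" "0 \<le> \<kappa>"
    and M: "\<And>y. y \<in> W \<Longrightarrow> dual_metric E h (u y) \<le> ennreal M"
    and sub: "\<And>f. holo_fun \<A> W f \<Longrightarrow> ennreal (cmod (f x) powr p) \<le> ennreal \<kappa> * (\<integral>\<^sup>+y\<in>W. ennreal (cmod (f y) powr p) \<partial>dV)"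
  shows "sup_pairing m (u x) \<le> ennreal (\<kappa> powr (1 / p) * M ^ m)"
  unfolding sup_pairing_def
proof (rule SUP_least)
  fix s assume s: "s \<in> unit_sections m"
  define b where "b = cmod (tpairing m (u x) (s (fst (u x))))"
  have "fst (u x) = x" using holo_section_dualD(2)[OF u \<open>x \<in> W\<close>] .
  then have "ennreal (b powr p) \<le> ennreal \<kappa> * (\<integral>\<^sup>+y\<in>W. ennreal (cmod (tpairing m (u y) (s y)) powr p) \<partial>dV)"
    using sub[OF holo_fun_tpairing[OF u unit_sectionsD(1)[OF s]]] by (simp add: b_def)
  also have "\<dots> \<le> ennreal \<kappa> * ennreal (M powr (p * real m))"
    using \<open>m > 0\<close> \<open>0 \<le> M\<close> M by (intro mult_left_mono pairing_Lp_bound[OF p_pos _ ht u unit_sectionsD[OF s]]) auto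
  finally have "b powr p \<le> \<kappa> * M powr (p * real m)"
    using \<open>0 \<le> \<kappa>\<close> by (simp add: ennreal_mult[symmetric])
  then have "(b powr p) powr (1 / p) \<le> (\<kappa> * M powr (p * real m)) powr (1 / p)"
    using p_pos by (intro powr_mono2) auto
  also have "\<dots> = \<kappa> powr (1 / p) * M ^ m"
    using p_pos \<open>0 \<le> M\<close> \<open>0 \<le> \<kappa>\<close> \<open>m > 0\<close> by (cases "M = 0") (simp_all add: powr_mult powr_powr powr_realpow)
  finally show "ennreal b \<le> ennreal (\<kappa> powr (1 / p) * M ^ m)"
    using p_pos by (intro ennreal_leI) (simp add: powr_powr b_def)
qed

lemma coframe_dual_metric_usc:
  assumes t: "(U, \<tau>) \<in> vb_triv E" and i: "i \<in> I"
  shows "usc_on U (\<lambda>x. dual_metric E h (x, coframe E \<tau> x i))"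
proof -
  have "const_section \<tau> (\<lambda>j. if j = i then 1 else 0) x = (x, coframe E \<tau> x i)" for x
    using i finite_I by (simp add: const_section_def if_distrib[of "\<lambda>a. a * _"] cong: if_cong)
  then show ?thesis
    using dual_usc[OF holo_section_const_section[OF t triv_open[OF t] subset_refl, of "\<lambda>j. if j = i then 1 else 0"]]
    by simp
qed

text \<open>A covector at \<open>x\<close> is the value of the section with the same constant coordinates, whose dual norm is
bounded near \<open>x0\<close> in terms of the coframe. The neighbourhood and the constants serve all \<open>m\<close> and all
covectors at once.\<close>

lemma sup_pairing_locally_bounded:
  assumes t: "(U, \<tau>) \<in> vb_triv E" and "x0 \<in> U"
  obtains N \<kappa> M where "open N" "x0 \<in> N" "N \<subseteq> U" "\<kappa> > 0" "M > 0"
    "\<And>m x \<xi>. m > 0 \<Longrightarrow> x \<in> N \<Longrightarrow> \<xi> \<in> covectors E x \<Longrightarrow>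
      sup_pairing m (x, \<xi>) \<le> ennreal (\<kappa> powr (1 / p) * (M * (\<Sum>i\<in>I. cmod (\<xi> (frame E \<tau> x i)))) ^ m)"
proof -
  let ?d = "\<lambda>i x. dual_metric E h (x, coframe E \<tau> x i)"
  define M where "M = (\<Sum>i\<in>I. enn2real (?d i x0)) + 1"
  have nonneg: "0 \<le> (\<Sum>i\<in>I. enn2real (?d i x0))" by (intro sum_nonneg) auto
  then have "M > 0" by (simp add: M_def)
  have "?d i x0 < ennreal M" if i: "i \<in> I" for i
  proof -
    have fin: "?d i x0 < \<infinity>" using coframe_dual_metric_usc[OF t i] \<open>x0 \<in> U\<close> unfolding usc_on_def by blast
    have "enn2real (?d i x0) \<le> (\<Sum>i\<in>I. enn2real (?d i x0))"
      using i finite_I by (intro member_le_sum) auto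
    then have "enn2real (?d i x0) < M" by (simp add: M_def)
    then have "ennreal (enn2real (?d i x0)) < ennreal M" using \<open>M > 0\<close> by (intro ennreal_lessI)
    then show ?thesis using fin by simp
  qed
  then have "\<exists>N. open N \<and> x0 \<in> N \<and> N \<subseteq> U \<and> (\<forall>y\<in>N. ?d i y < ennreal M)" if "i \<in> I" for i
    using usc_onD[OF coframe_dual_metric_usc[OF t that] triv_open[OF t] \<open>x0 \<in> U\<close>] that by metis
  then obtain B where B: "\<And>i. i \<in> I \<Longrightarrow> open (B i) \<and> x0 \<in> B i \<and> B i \<subseteq> U \<and> (\<forall>y\<in>B i. ?d i y < ennreal M)"
    by metis
  define W where "W = U \<inter> (\<Inter>i\<in>I. B i)"
  have W: "open W" "x0 \<in> W" "W \<subseteq> U"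
    using B finite_I triv_open[OF t] \<open>x0 \<in> U\<close> unfolding W_def by (auto intro!: open_Int open_INT)
  obtain N \<kappa> where N: "open N" "x0 \<in> N" "N \<subseteq> W" "\<kappa> > 0"
    and sub: "\<And>f q x. holo_fun \<A> W f \<Longrightarrow> q > 0 \<Longrightarrow> x \<in> N \<Longrightarrow>
       ennreal (cmod (f x) powr q) \<le> ennreal \<kappa> * (\<integral>\<^sup>+y\<in>W. ennreal (cmod (f y) powr q) \<partial>dV)"
    using local_submean[OF atlas volume W(2,1)] by blast
  show thesis
  proof (rule that[OF N(1,2) _ \<open>\<kappa> > 0\<close> \<open>M > 0\<close>])
    fix m :: nat and x \<xi> assume m: "m > 0" and x: "x \<in> N" and \<xi>: "\<xi> \<in> covectors E x"
    have "x \<in> U" using x N W by blast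
    define c where "c = (\<lambda>i. \<xi> (frame E \<tau> x i))"
    have eq: "const_section \<tau> c x = (x, \<xi>)" unfolding c_def by (rule const_section_eq[OF t \<open>x \<in> U\<close> \<xi>])
    have "dual_metric E h (const_section \<tau> c y) \<le> ennreal (M * (\<Sum>i\<in>I. cmod (c i)))" if y: "y \<in> W" for y
    proof -
      have "dual_metric E h (const_section \<tau> c y) \<le> (\<Sum>i\<in>I. ennreal (cmod (c i)) * ?d i y)"
        unfolding const_section_def by (rule dual_metric_lincomb_le)
      also have "\<dots> \<le> (\<Sum>i\<in>I. ennreal (cmod (c i)) * ennreal M)"
      proof (intro sum_mono mult_left_mono)
        fix i assume "i \<in> I"
        then show "?d i y \<le> ennreal M" using B y unfolding W_def by (auto intro: less_imp_le)
      qed simp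
      also have "\<dots> = ennreal (M * (\<Sum>i\<in>I. cmod (c i)))"
        using \<open>M > 0\<close> by (simp add: ennreal_mult[symmetric] sum_ennreal sum_distrib_left mult.commute)
      finally show ?thesis .
    qed
    then have "sup_pairing m (const_section \<tau> c x) \<le> ennreal (\<kappa> powr (1 / p) * (M * (\<Sum>i\<in>I. cmod (c i))) ^ m)"
      using x N \<open>M > 0\<close> p_pos
      by (intro sup_pairing_le[OF m holo_section_const_section[OF t W(1,3)]] sub)
         (auto intro!: mult_nonneg_nonneg sum_nonneg)
    then show "sup_pairing m (x, \<xi>) \<le> ennreal (\<kappa> powr (1 / p) * (M * (\<Sum>i\<in>I. cmod (\<xi> (frame E \<tau> x i)))) ^ m)"
      unfolding eq by (simp add: c_def)
  qed (use N W in blast)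
qed

lemma sup_pairing_finite:
  assumes "m > 0" "\<xi> \<in> covectors E x"
  shows "sup_pairing m (x, \<xi>) < top"
proof -
  obtain U \<tau> where "(U, \<tau>) \<in> vb_triv E" "x \<in> U" using trivE by blast
  from sup_pairing_locally_bounded[OF this] assms show ?thesis
    by (metis ennreal_less_top order_le_less_trans)
qed

text \<open>The Schwarz lemma for \<open>\<eta> \<mapsto> (g (\<eta> / t) - g 0) / (2 K)\<close> at the point \<open>\<eta> = t\<close>.\<close>

lemma holomorphic_lipschitz_at_centre:
  assumes hol: "g holomorphic_on ball 0 (1 / t)" and t: "0 < t" "t < 1" and K: "K > 0"
    and bd: "\<And>\<zeta>. cmod \<zeta> < 1 / t \<Longrightarrow> cmod (g \<zeta>) < K"
  shows "cmod (g 1 - g 0) \<le> 2 * K * t"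
proof -
  define f where "f = (\<lambda>\<eta>. (g (\<eta> / of_real t) - g 0) / of_real (2 * K))"
  have dom: "\<eta> / of_real t \<in> ball 0 (1 / t)" if "cmod \<eta> < 1" for \<eta>
    using that t by (simp add: norm_divide divide_strict_right_mono)
  have "cmod (f (of_real t)) \<le> cmod (of_real t)"
  proof (rule Schwarz_Lemma(1))
    show "f holomorphic_on ball 0 1"
      unfolding f_def using K t dom
      by (intro holomorphic_intros holomorphic_on_compose_gen[OF _ hol, unfolded o_def]) auto
    show "f 0 = 0" by (simp add: f_def)
    fix \<eta> :: complex assume "cmod \<eta> < 1"
    then have "cmod (g (\<eta> / of_real t) - g 0) < 2 * K"
      using bd[of "\<eta> / of_real t"] bd[of 0] dom[of \<eta>] t norm_triangle_ineq4[of "g (\<eta> / of_real t)" "g 0"] by auto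
    then show "cmod (f \<eta>) < 1" using K by (simp add: f_def norm_divide norm_mult)
  qed (use t in simp)
  then show ?thesis using t K by (simp add: f_def norm_divide norm_mult field_simps)
qed

lemma holomorphic_on_prod_list:
  "(\<And>i. i \<in> set J \<Longrightarrow> f i holomorphic_on S) \<Longrightarrow> (\<lambda>\<zeta>. prod_list (map (\<lambda>i. f i \<zeta>) J)) holomorphic_on S"
  by (induction J) (auto intro!: holomorphic_intros)

text \<open>Equicontinuity of the pairings. In chart and frame coordinates, the complex line through \<open>(x0, \<xi>0)\<close> and a
nearby \<open>(x, \<xi>)\<close> is parametrized so that these points have the parameters \<open>0\<close> and \<open>1\<close>. If the points are
\<open>R t'\<close>-close, then the disc of radius \<open>1 / t'\<close> stays in the region where all pairings are bounded by \<open>K\<close>. By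
the Schwarz lemma each pairing changes by at most \<open>2 K t'\<close> between the two points, whatever the section \<open>s\<close>.\<close>

lemma sup_pairing_usc:
  assumes m: "m > 0" and t: "(U, \<tau>) \<in> vb_triv E" "x0 \<in> U" and \<xi>0: "\<xi>0 \<in> covectors E x0"
    and c: "sup_pairing m (x0, \<xi>0) < c"
  obtains V \<delta> where "open V" "x0 \<in> V" "V \<subseteq> U" "\<delta> > 0"
    "\<And>x \<xi>. x \<in> V \<Longrightarrow> \<xi> \<in> covectors E x \<Longrightarrow>
      (\<And>i. i \<in> I \<Longrightarrow> cmod (\<xi> (frame E \<tau> x i) - \<xi>0 (frame E \<tau> x0 i)) < \<delta>) \<Longrightarrow> sup_pairing m (x, \<xi>) < c"
proof -
  obtain N \<kappa> M where N: "open N" "x0 \<in> N" "N \<subseteq> U" and "\<kappa> > 0" "M > 0"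
    and bound: "\<And>x \<xi>. x \<in> N \<Longrightarrow> \<xi> \<in> covectors E x \<Longrightarrow>
      sup_pairing m (x, \<xi>) \<le> ennreal (\<kappa> powr (1 / p) * (M * (\<Sum>i\<in>I. cmod (\<xi> (frame E \<tau> x i)))) ^ m)"
    using sup_pairing_locally_bounded[OF t] m by metis
  obtain Uc \<phi> where ch: "(Uc, \<phi>) \<in> \<A>" "x0 \<in> Uc" "is_chart (Uc, \<phi>)" using complex_atlasE[OF atlas] by blast
  note inv = is_chartD(7)[OF ch(3)]
  have "\<phi> x0 \<in> \<phi> ` (Uc \<inter> N)" using ch N by blast
  then obtain R where R: "R > 0" "ball (\<phi> x0) R \<subseteq> \<phi> ` (Uc \<inter> N)"
    using is_chart_open_image[OF ch(3) N(1)] open_contains_ball by blast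
  have inN: "inv_into Uc \<phi> z \<in> Uc \<inter> N" if "z \<in> ball (\<phi> x0) R" for z
    using R(2) that inv by force
  define c0 where "c0 = (\<lambda>i. \<xi>0 (frame E \<tau> x0 i))"
  \<comment> \<open>The final \<open>+ 1\<close> makes the bound strict, as the Schwarz lemma requires, and \<open>K\<close> positive.\<close>
  define K where "K = \<kappa> powr (1 / p) * (M * (\<Sum>i\<in>I. cmod (c0 i) + R)) ^ m + 1"
  have sumR: "0 \<le> (\<Sum>i\<in>I. cmod (c0 i) + R)" using R by (intro sum_nonneg) auto
  have "K > 0" using \<open>M > 0\<close> sumR by (auto simp: K_def intro!: add_nonneg_pos mult_nonneg_nonneg zero_le_power)
  have bdK: "cmod (tpairing m (const_section \<tau> b y) (s y)) < K"
    if y: "y \<in> N" and b: "\<And>i. i \<in> I \<Longrightarrow> cmod (b i - c0 i) \<le> R" and s: "s \<in> unit_sections m" for y b s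
  proof -
    have yU: "y \<in> U" using y N by blast
    have fst: "const_section \<tau> b y = (y, snd (const_section \<tau> b y))" by (simp add: const_section_def)
    have "ennreal (cmod (tpairing m (const_section \<tau> b y) (s y))) \<le> sup_pairing m (const_section \<tau> b y)"
      using pairing_le_sup[OF s, of "const_section \<tau> b y"] by (simp add: const_section_def)
    also have "\<dots> \<le> ennreal (\<kappa> powr (1 / p) * (M * (\<Sum>i\<in>I. cmod (snd (const_section \<tau> b y) (frame E \<tau> y i)))) ^ m)"
      by (subst fst) (rule bound[OF y const_section_covector[OF t(1) yU]])
    also have "(\<Sum>i\<in>I. cmod (snd (const_section \<tau> b y) (frame E \<tau> y i))) = (\<Sum>i\<in>I. cmod (b i))"
      using const_section_frame[OF t(1) yU] by simp
    finally have "cmod (tpairing m (const_section \<tau> b y) (s y)) \<le> \<kappa> powr (1 / p) * (M * (\<Sum>i\<in>I. cmod (b i))) ^ m"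
      using \<open>M > 0\<close> by (subst (asm) ennreal_le_iff) (auto intro!: mult_nonneg_nonneg zero_le_power sum_nonneg)
    also have "(\<Sum>i\<in>I. cmod (b i)) \<le> (\<Sum>i\<in>I. cmod (c0 i) + R)"
    proof (rule sum_mono)
      fix i assume "i \<in> I"
      then show "cmod (b i) \<le> cmod (c0 i) + R" using b[of i] norm_triangle_sub[of "b i" "c0 i"] by linarith
    qed
    then have "\<kappa> powr (1 / p) * (M * (\<Sum>i\<in>I. cmod (b i))) ^ m \<le> \<kappa> powr (1 / p) * (M * (\<Sum>i\<in>I. cmod (c0 i) + R)) ^ m"
      using \<open>M > 0\<close> by (intro mult_left_mono power_mono) (auto intro!: mult_nonneg_nonneg sum_nonneg)
    finally show ?thesis by (simp add: K_def)
  qed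
  have fin: "sup_pairing m (x0, \<xi>0) < top" by (rule sup_pairing_finite[OF m \<xi>0])
  obtain t' where t': "0 < t'" "t' < 1" "sup_pairing m (x0, \<xi>0) + ennreal (2 * K * t') < c"
  proof -
    obtain a where a: "sup_pairing m (x0, \<xi>0) = ennreal a" "0 \<le> a" using fin by (cases "sup_pairing m (x0, \<xi>0)") auto
    obtain b where b: "a < b" "ennreal b \<le> c"
    proof (cases c)
      case (real r)
      then show thesis using c a that[of r] by (auto simp: ennreal_less_iff)
    next
      case top
      then show thesis using that[of "a + 1"] by simp
    qed
    define t' where "t' = min (1 / 2) ((b - a) / (4 * K))"
    have "2 * K * t' \<le> 2 * K * ((b - a) / (4 * K))" using \<open>K > 0\<close> unfolding t'_def by (intro mult_left_mono) auto
    also have "\<dots> < b - a" using \<open>K > 0\<close> b(1) by (simp add: field_simps)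
    finally have "a + 2 * K * t' < b" by simp
    moreover have "0 < t'" using b \<open>K > 0\<close> by (simp add: t'_def)
    ultimately have "ennreal a + ennreal (2 * K * t') < ennreal b"
      using a(2) \<open>K > 0\<close> by (simp add: ennreal_plus[symmetric] ennreal_less_iff del: ennreal_plus)
    then show thesis using that[of t'] a b \<open>0 < t'\<close> by (auto simp: t'_def intro: less_le_trans)
  qed
  define \<delta> where "\<delta> = R * t'"
  have \<delta>: "0 < \<delta>" "\<delta> \<le> R" using R t' by (auto simp: \<delta>_def mult_left_le)
  \<comment> \<open>Closeness \<open>\<delta> = R t'\<close> leaves room for the factor \<open>1 / t'\<close> up to the radius \<open>R\<close>.\<close>
  define V where "V = {y \<in> Uc. \<phi> y \<in> ball (\<phi> x0) \<delta>}"
  have VN: "y \<in> N" if y: "y \<in> V" for y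
    using inN[of "\<phi> y"] y \<delta> inv[of y] unfolding V_def by auto
  show thesis
  proof
    show "open V" unfolding V_def by (rule is_chart_open_preimage[OF ch(3) open_ball])
    show "x0 \<in> V" using ch \<delta> by (simp add: V_def)
    show "V \<subseteq> U" using VN N by blast
    show "\<delta> > 0" by fact
    fix x \<xi> assume x: "x \<in> V" and \<xi>: "\<xi> \<in> covectors E x"
      and close: "\<And>i. i \<in> I \<Longrightarrow> cmod (\<xi> (frame E \<tau> x i) - \<xi>0 (frame E \<tau> x0 i)) < \<delta>"
    have xU: "x \<in> U" "x \<in> N" "x \<in> Uc" using x VN N by (auto simp: V_def)
    define w where "w = \<phi> x - \<phi> x0"
    define d where "d = (\<lambda>i. \<xi> (frame E \<tau> x i) - c0 i)"
    have w: "norm w < \<delta>" using x by (simp add: V_def w_def dist_norm norm_minus_commute)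
    have d: "cmod (d i) < \<delta>" if "i \<in> I" for i using close[OF that] by (simp add: d_def c0_def)
    have scale: "cmod \<zeta> * a < R" if "cmod \<zeta> < 1 / t'" "0 \<le> a" "a < \<delta>" for \<zeta> a
    proof -
      have "cmod \<zeta> * a \<le> (1 / t') * a" using that by (intro mult_right_mono) auto
      also have "\<dots> < (1 / t') * \<delta>" using that t' by (intro mult_strict_left_mono) auto
      also have "\<dots> = R" using t' by (simp add: \<delta>_def)
      finally show ?thesis .
    qed
    define y where "y = (\<lambda>\<zeta>. inv_into Uc \<phi> (\<phi> x0 + \<zeta> *s w))"
    have z: "\<phi> x0 + \<zeta> *s w \<in> ball (\<phi> x0) R" if "cmod \<zeta> < 1 / t'" for \<zeta>
      using scale[OF that _ w] by (simp add: dist_norm norm_vector_scalar_mult)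
    have y: "y \<zeta> \<in> N" if "cmod \<zeta> < 1 / t'" for \<zeta> using inN[OF z[OF that]] by (simp add: y_def)
    have y01: "y 0 = x0" "y 1 = x" using inv ch xU by (simp_all add: y_def w_def)
    have "sup_pairing m (x, \<xi>) \<le> sup_pairing m (x0, \<xi>0) + ennreal (2 * K * t')"
      unfolding sup_pairing_def[of m "(x, \<xi>)"]
    proof (rule SUP_least)
      fix s assume s: "s \<in> unit_sections m"
      define g where "g = (\<lambda>\<zeta>. tpairing m (const_section \<tau> (\<lambda>i. c0 i + \<zeta> * d i) (y \<zeta>)) (s (y \<zeta>)))"
      have "cmod (g 1 - g 0) \<le> 2 * K * t'"
      proof (rule holomorphic_lipschitz_at_centre[OF _ t'(1,2) \<open>K > 0\<close>])
        show "cmod (g \<zeta>) < K" if "cmod \<zeta> < 1 / t'" for \<zeta>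
          unfolding g_def using scale[OF that norm_ge_zero d]
          by (intro bdK[OF y[OF that] _ s]) (simp add: norm_mult less_imp_le)
        have sec: "snd (s z) \<in> tensors E m z" for z
          using holo_section_tensorD(2)[OF unit_sectionsD(1)[OF s]] by simp
        have coeff: "(\<lambda>\<zeta>. snd (s (y \<zeta>)) (map (coframe E \<tau> (y \<zeta>)) J)) holomorphic_on ball 0 (1 / t')"
          if J: "J \<in> multi_indices m" for J
        proof -
          have "holo_fun \<A> N (\<lambda>x. snd (s x) (map (coframe E \<tau> x) J))"
            using holo_section_tensorD(3)[OF unit_sectionsD(1)[OF s] t(1) J] by (rule holo_fun_subset) (use N in auto)
          then have "holomorphic_Cn (\<phi> ` (Uc \<inter> N)) (\<lambda>z. snd (s (inv_into Uc \<phi> z)) (map (coframe E \<tau> (inv_into Uc \<phi> z)) J))"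
            using ch(1) unfolding holo_fun_def by blast
          from holomorphic_Cn_line[OF this, of "\<phi> x0" w] show ?thesis
            unfolding y_def by (rule holomorphic_on_subset) (use z R(2) in auto)
        qed
        have "(\<lambda>\<zeta>. \<Sum>J\<in>multi_indices m. snd (s (y \<zeta>)) (map (coframe E \<tau> (y \<zeta>)) J) *
            prod_list (map (\<lambda>i. c0 i + \<zeta> * d i) J)) holomorphic_on ball 0 (1 / t')"
          by (intro holomorphic_on_sum holomorphic_on_mult coeff holomorphic_on_prod_list) (auto intro!: holomorphic_intros)
        then show "g holomorphic_on ball 0 (1 / t')"
        proof (rule holomorphic_transform)
          fix \<zeta> :: complex assume "\<zeta> \<in> ball 0 (1 / t')"
          then have yU: "y \<zeta> \<in> U" using y[of \<zeta>] N by auto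
          show "(\<Sum>J\<in>multi_indices m. snd (s (y \<zeta>)) (map (coframe E \<tau> (y \<zeta>)) J) *
            prod_list (map (\<lambda>i. c0 i + \<zeta> * d i) J)) = g \<zeta>"
            unfolding g_def tpairing_expansion[OF t(1) yU const_section_covector[OF t(1) yU] sec]
          proof (intro sum.cong refl arg_cong2[where f = "(*)"] arg_cong[where f = prod_list] map_cong)
            fix J i assume "J \<in> multi_indices m" "i \<in> set J"
            then have "i \<in> I" by auto
            then show "c0 i + \<zeta> * d i = snd (const_section \<tau> (\<lambda>i. c0 i + \<zeta> * d i) (y \<zeta>)) (frame E \<tau> (y \<zeta>) i)"
              by (simp add: const_section_frame[OF t(1) yU])
          qed
        qed
      qed
      moreover have "g 0 = tpairing m (x0, \<xi>0) (s x0)"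
        using const_section_eq[OF t \<xi>0] by (simp add: g_def y01 c0_def)
      moreover have "g 1 = tpairing m (x, \<xi>) (s x)"
        using const_section_eq[OF t(1) xU(1) \<xi>] by (simp add: g_def y01 d_def)
      ultimately have "cmod (tpairing m (x, \<xi>) (s x)) \<le> cmod (tpairing m (x0, \<xi>0) (s x0)) + 2 * K * t'"
        using norm_triangle_sub[of "g 1" "g 0"] by simp
      then have "ennreal (cmod (tpairing m (x, \<xi>) (s x))) \<le> ennreal (cmod (tpairing m (x0, \<xi>0) (s x0))) + ennreal (2 * K * t')"
        using \<open>K > 0\<close> t' by (simp add: ennreal_plus[symmetric] del: ennreal_plus)
      also have "\<dots> \<le> sup_pairing m (x0, \<xi>0) + ennreal (2 * K * t')"
        using pairing_le_sup[OF s, of "(x0, \<xi>0)"] by (intro add_right_mono) simp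
      finally show "ennreal (cmod (tpairing m (x, \<xi>) (s (fst (x, \<xi>))))) \<le> \<dots>" by simp
    qed
    then show "sup_pairing m (x, \<xi>) < c" using t'(3) by (rule le_less_trans)
  qed
qed

text \<open>By equicontinuity the supremum is upper semicontinuous on the total space, and it equals its
regularization. From here on the metric is handled as a supremum of moduli of holomorphic functions.\<close>

lemma usc_reg_sup_pairing:
  assumes m: "m > 0" and \<xi>: "\<xi> \<in> covectors E x"
  shows "usc_reg (dual_bundle E) (sup_pairing m) (x, \<xi>) = sup_pairing m (x, \<xi>)"
proof (rule antisym)
  show "sup_pairing m (x, \<xi>) \<le> usc_reg (dual_bundle E) (sup_pairing m) (x, \<xi>)"
    unfolding usc_reg_def by (rule INF_greatest) (auto intro: SUP_upper)
  show "usc_reg (dual_bundle E) (sup_pairing m) (x, \<xi>) \<le> sup_pairing m (x, \<xi>)"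
  proof (rule dense_ge)
    fix c assume c: "sup_pairing m (x, \<xi>) < c"
    obtain U \<tau> where t: "(U, \<tau>) \<in> vb_triv E" "x \<in> U" using trivE by blast
    obtain V \<delta> where V: "open V" "x \<in> V" "V \<subseteq> U" "\<delta> > 0"
      and less: "\<And>y \<eta>. y \<in> V \<Longrightarrow> \<eta> \<in> covectors E y \<Longrightarrow>
      (\<And>i. i \<in> I \<Longrightarrow> cmod (\<eta> (frame E \<tau> y i) - \<xi> (frame E \<tau> x i)) < \<delta>) \<Longrightarrow> sup_pairing m (y, \<eta>) < c"
      using sup_pairing_usc[OF m t \<xi> c] by metis
    define \<sigma> where "\<sigma> = (\<lambda>(x, \<xi>) i. \<xi> (frame E \<tau> x i) :: complex)"
    define B where "B = (\<lambda>i. ball (\<xi> (frame E \<tau> x i)) \<delta>)"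
    define N where "N = {e \<in> vb_tot (dual_bundle E). vb_proj (dual_bundle E) e \<in> V \<and>
      (\<forall>i\<in>vb_idx (dual_bundle E). \<sigma> e i \<in> B i)}"
    have "(U, \<sigma>) \<in> vb_triv (dual_bundle E)" unfolding \<sigma>_def by (rule triv_dual[OF t(1)])
    then have "openin (tot_topology (dual_bundle E)) N"
      unfolding tot_topology_def N_def using V
      by (intro topology_generated_by_Basis CollectI exI[of _ U] exI[of _ \<sigma>] exI[of _ V] exI[of _ B])
         (simp add: B_def)
    moreover have "(x, \<xi>) \<in> N" using V \<xi> by (simp add: N_def dual_bundle_def \<sigma>_def B_def)
    ultimately have "usc_reg (dual_bundle E) (sup_pairing m) (x, \<xi>) \<le> (SUP e\<in>N. sup_pairing m e)"
      unfolding usc_reg_def by (intro INF_lower) simp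
    also have "\<dots> \<le> c"
    proof (rule SUP_least)
      fix e assume "e \<in> N"
      then obtain y \<eta> where "e = (y, \<eta>)" "\<eta> \<in> covectors E y" "y \<in> V"
        "\<And>i. i \<in> I \<Longrightarrow> cmod (\<eta> (frame E \<tau> y i) - \<xi> (frame E \<tau> x i)) < \<delta>"
        by (auto simp: N_def dual_bundle_def \<sigma>_def B_def dist_norm norm_minus_commute)
      then show "sup_pairing m e \<le> c" using less by (simp add: less_imp_le)
    qed
    finally show "usc_reg (dual_bundle E) (sup_pairing m) (x, \<xi>) \<le> c" .
  qed
qed

abbreviation "hm m \<equiv> hm_dual \<A> dV p E ht m"

lemma hm_dual_eq:
  assumes "m > 0" "\<xi> \<in> covectors E x"
  shows "hm m (x, \<xi>) = epow (sup_pairing m (x, \<xi>)) (1 / real m)"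
  using usc_reg_sup_pairing[OF assms] unfolding hm_dual_def sup_pairing_def unit_sections_def by simp

lemma hm_dual_section:
  assumes "m > 0" "holo_section \<A> (dual_bundle E) W u" "x \<in> W"
  shows "hm m (u x) = epow (sup_pairing m (u x)) (1 / real m)"
  using hm_dual_eq[OF assms(1) holo_section_dualD(3)[OF assms(2,3)]] holo_section_dualD(2)[OF assms(2,3)]
  by (metis prod.collapse)

lemma usc_on_sup_pairing:
  assumes m: "m > 0" and u: "holo_section \<A> (dual_bundle E) W u"
  shows "usc_on W (\<lambda>x. sup_pairing m (u x))"
proof (rule usc_onI)
  fix x assume x: "x \<in> W"
  have ux: "u y = (y, snd (u y))" "snd (u y) \<in> covectors E y" if "y \<in> W" for y
    using holo_section_dualD(2,3)[OF u that] by (metis prod.collapse)+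
  show "sup_pairing m (u x) < \<infinity>"
    using sup_pairing_finite[OF m ux(2)[OF x]] ux(1)[OF x] by simp
  fix c assume c: "sup_pairing m (u x) < c"
  then have c': "sup_pairing m (x, snd (u x)) < c" using ux(1)[OF x] by simp
  obtain U \<tau> where t: "(U, \<tau>) \<in> vb_triv E" "x \<in> U" using trivE by blast
  obtain V \<delta> where V: "open V" "x \<in> V" "V \<subseteq> U" "\<delta> > 0"
    and less: "\<And>y \<eta>. y \<in> V \<Longrightarrow> \<eta> \<in> covectors E y \<Longrightarrow>
      (\<And>i. i \<in> I \<Longrightarrow> cmod (\<eta> (frame E \<tau> y i) - snd (u x) (frame E \<tau> x i)) < \<delta>) \<Longrightarrow> sup_pairing m (y, \<eta>) < c"
    using sup_pairing_usc[OF m t ux(2)[OF x] c'] by metis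
  let ?f = "\<lambda>i y. snd (u y) (frame E \<tau> y i)"
  define B where "B = (\<lambda>i. {y \<in> U \<inter> W. ?f i y \<in> ball (?f i x) \<delta>})"
  have oUW: "open (U \<inter> W)" using triv_open[OF t(1)] holo_section_dualD(1)[OF u] by blast
  have "open (B i)" if "i \<in> I" for i
  proof -
    have "continuous_on (U \<inter> W) (?f i)"
      by (rule holo_fun_continuous_on[OF atlas oUW holo_section_dualD(4)[OF u t(1) that]])
    then have "open (?f i -` ball (?f i x) \<delta> \<inter> (U \<inter> W))"
      using continuous_on_open_vimage[OF oUW] open_ball by blast
    then show ?thesis unfolding B_def by (simp add: vimage_def Int_def conj_commute)
  qed
  then have "open (V \<inter> (\<Inter>i\<in>I. B i))" using V(1) finite_I by (intro open_Int open_INT) auto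
  moreover have "x \<in> V \<inter> (\<Inter>i\<in>I. B i)" using V t x by (simp add: B_def)
  moreover have "sup_pairing m (u y) < c" if "y \<in> (V \<inter> (\<Inter>i\<in>I. B i)) \<inter> W" for y
  proof -
    have "sup_pairing m (y, snd (u y)) < c"
      using that by (intro less ux(2)) (auto simp: B_def dist_norm norm_minus_commute)
    then show ?thesis using that ux(1)[of y] by simp
  qed
  ultimately show "\<exists>N. open N \<and> x \<in> N \<and> (\<forall>y\<in>N \<inter> W. sup_pairing m (u y) < c)" by blast
qed

end

section \<open>Seminegativity and the two estimates\<close>

context Lp_tensor_setting
begin

text \<open>Along a section the squared norm is the supremum of \<open>\<bar>\<langle>u\<^sup>\<otimes>\<^sup>m, s\<rangle>\<bar>\<^sup>q\<close> with \<open>q = 2 / m\<close>, and submean value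
inequalities are inherited by suprema.\<close>

lemma griffiths_seminegative_hm:
  assumes m: "m > 0"
  shows "griffiths_seminegative \<A> (dual_bundle E) (hm m)"
  unfolding griffiths_seminegative_def
proof (intro allI impI)
  fix W u assume u: "holo_section \<A> (dual_bundle E) W u"
  define q where "q = 2 / real m"
  have q: "q > 0" using m by (simp add: q_def)
  have sq: "(hm m (u x))\<^sup>2 = epow (sup_pairing m (u x)) q" if "x \<in> W" for x
    using hm_dual_section[OF m u that] epow_realpow[of 2 "hm m (u x)"] by (simp add: epow_epow q_def)
  show "psh_on \<A> W (\<lambda>x. (hm m (u x))\<^sup>2)"
    unfolding psh_on_def
  proof (intro conjI ballI)
    show "usc_on W (\<lambda>x. (hm m (u x))\<^sup>2)"
      using usc_on_epow[OF usc_on_sup_pairing[OF m u] q] by (rule usc_on_cong) (simp add: sq)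
  next
    fix chart assume "chart \<in> \<A>"
    moreover obtain U \<phi> where c: "chart = (U, \<phi>)" by (cases chart)
    ultimately have ch: "(U, \<phi>) \<in> \<A>" by simp
    then have isch: "is_chart (U, \<phi>)" using atlas unfolding complex_atlas_def by blast
    have "(hm m (u (inv_into U \<phi> z)))\<^sup>2 \<le>
          ennreal (1 / (2 * pi)) * (\<integral>\<^sup>+\<theta>\<in>{0..2 * pi}. (hm m (u (inv_into U \<phi> (z + cis \<theta> *s w))))\<^sup>2 \<partial>lborel)" (is "_ \<le> ?R")
      if disc: "\<And>\<zeta>. cmod \<zeta> \<le> 1 \<Longrightarrow> z + \<zeta> *s w \<in> \<phi> ` (U \<inter> W)" for z w
    proof -
      have inW: "inv_into U \<phi> (z + \<zeta> *s w) \<in> W" if "cmod \<zeta> \<le> 1" for \<zeta>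
        using disc[OF that] by (auto simp: is_chartD(7)[OF isch])
      have zW: "inv_into U \<phi> z \<in> W" using inW[of 0] by simp
      have "sup_pairing m (u (inv_into U \<phi> z)) \<le> epow ?R (1 / q)"
        unfolding sup_pairing_def[of m "u (inv_into U \<phi> z)"]
      proof (rule SUP_least)
        fix s assume s: "s \<in> unit_sections m"
        define g where "g = (\<lambda>x. tpairing m (u x) (s x))"
        have le: "ennreal (cmod (g x) powr q) \<le> (hm m (u x))\<^sup>2" if "x \<in> W" for x
        proof -
          have "ennreal (cmod (g x)) \<le> sup_pairing m (u x)"
            using pairing_le_sup[OF s, of "u x"] holo_section_dualD(2)[OF u that] by (simp add: g_def)
          from epow_mono[OF less_imp_le[OF q] this] show ?thesis using sq[OF that] by simp
        qed
        have "holo_fun \<A> W g" unfolding g_def by (rule holo_fun_tpairing[OF u unit_sectionsD(1)[OF s]])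
        then have "holomorphic_Cn (\<phi> ` (U \<inter> W)) (\<lambda>z. g (inv_into U \<phi> z))"
          using ch unfolding holo_fun_def by blast
        then have "ennreal (cmod (g (inv_into U \<phi> z)) powr q) \<le> ennreal (1 / (2 * pi)) *
            (\<integral>\<^sup>+\<theta>\<in>{0..2 * pi}. ennreal (cmod (g (inv_into U \<phi> (z + cis \<theta> *s w))) powr q) \<partial>lborel)"
          by (rule holomorphic_Cn_submean[OF q _ is_chart_open_image[OF isch holo_section_dualD(1)[OF u]] disc])
        also have "\<dots> \<le> ?R"
          by (intro mult_left_mono nn_integral_mono mult_right_mono le inW) simp_all
        finally have "epow (ennreal (cmod (g (inv_into U \<phi> z)))) q \<le> ?R" by simp
        then show "ennreal (cmod (tpairing m (u (inv_into U \<phi> z)) (s (fst (u (inv_into U \<phi> z)))))) \<le> epow ?R (1 / q)"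
          using holo_section_dualD(2)[OF u zW] by (simp only: epow_le_iff[OF q] g_def)
      qed
      then show ?thesis unfolding sq[OF zW] by (simp only: epow_le_iff[OF q])
    qed
    then show "case chart of (U, \<phi>) \<Rightarrow> \<forall>z w. (\<forall>\<zeta>. cmod \<zeta> \<le> 1 \<longrightarrow> z + \<zeta> *s w \<in> \<phi> ` (U \<inter> W)) \<longrightarrow>
        (hm m (u (inv_into U \<phi> z)))\<^sup>2 \<le>
          ennreal (1 / (2 * pi)) * (\<integral>\<^sup>+\<theta>\<in>{0..2 * pi}. (hm m (u (inv_into U \<phi> (z + cis \<theta> *s w))))\<^sup>2 \<partial>lborel)"
      unfolding c by blast
  qed
qed

lemma hm_dual_upper:
  assumes "m > 0" and u: "holo_section \<A> (dual_bundle E) W u" and "x \<in> W" and "0 \<le> M" "0 \<le> \<kappa>"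
    and M: "\<And>y. y \<in> W \<Longrightarrow> dual_metric E h (u y) \<le> ennreal M"
    and sub: "\<And>f. holo_fun \<A> W f \<Longrightarrow> ennreal (cmod (f x) powr p) \<le> ennreal \<kappa> * (\<integral>\<^sup>+y\<in>W. ennreal (cmod (f y) powr p) \<partial>dV)"
  shows "hm m (u x) \<le> ennreal (\<kappa> powr (1 / (p * real m)) * M)"
proof -
  have "hm m (u x) \<le> epow (ennreal (\<kappa> powr (1 / p) * M ^ m)) (1 / real m)"
    unfolding hm_dual_section[OF assms(1-3)] by (intro epow_mono sup_pairing_le[OF assms]) auto
  also have "\<dots> = ennreal ((\<kappa> powr (1 / p)) powr (1 / real m) * (M ^ m) powr (1 / real m))"
    using \<open>0 \<le> M\<close> by (simp add: powr_mult)
  also have "(M ^ m) powr (1 / real m) = M"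
    using \<open>0 \<le> M\<close> \<open>m > 0\<close> by (cases "M = 0") (simp_all add: powr_realpow[symmetric] powr_powr)
  finally show ?thesis by (simp add: powr_powr)
qed

text \<open>In a chart where \<open>dV\<close> is Lebesgue measure the submean value inequality has the constant \<open>1 / Vol(B)\<close>.\<close>

lemma hm_dual_upper_coord_ball:
  assumes m: "m > 0" and u: "holo_section \<A> (dual_bundle E) W u" and x: "x \<in> W"
    and leb: "lebesgue_chart \<A> dV (U, \<phi>)" and "x \<in> U" "r > 0" and sub: "ball (\<phi> x) r \<subseteq> \<phi> ` (U \<inter> W)"
  shows "hm m (u x) \<le> ennreal ((1 / measure dV (coord_ball (U, \<phi>) x r)) powr (1 / (p * real m))) *
      (SUP y\<in>coord_ball (U, \<phi>) x r. dual_metric E h (u y))"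
proof -
  note L = lebesgue_chartD[OF leb]
  let ?B = "coord_ball (U, \<phi>) x r"
  let ?S = "SUP y\<in>?B. dual_metric E h (u y)"
  define v where "v = measure lborel (ball (\<phi> x) r)"
  have "v > 0" unfolding v_def using \<open>r > 0\<close> by (rule content_ball_pos)
  have v: "emeasure lborel (ball (\<phi> x) r) = ennreal v"
    unfolding v_def using emeasure_lborel_ball_finite[of "\<phi> x" r] by (simp add: emeasure_eq_ennreal_measure)
  have mv: "measure dV ?B = v" unfolding v_def using sub by (intro L(4)) auto
  have oB: "open ?B" by (rule open_coord_ball[OF L(2)])
  have xB: "x \<in> ?B" using \<open>x \<in> U\<close> \<open>r > 0\<close> by (simp add: coord_ball_def)
  have BW: "?B \<subseteq> W"
  proof
    fix y assume "y \<in> ?B"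
    then have y: "y \<in> U" "\<phi> y \<in> \<phi> ` (U \<inter> W)" using sub unfolding coord_ball_def by auto
    then obtain y' where "y' \<in> U \<inter> W" "\<phi> y = \<phi> y'" by blast
    then show "y \<in> W" using y(1) is_chartD(6)[OF L(2)] by (auto dest: inj_onD)
  qed
  have ballB: "ball (\<phi> x) r \<subseteq> \<phi> ` (U \<inter> ?B)" using sub unfolding coord_ball_def by auto
  have uB: "holo_section \<A> (dual_bundle E) ?B u" by (rule holo_section_subset[OF u oB BW])
  have "hm m (u x) \<le> ennreal ((1 / v) powr (1 / (p * real m))) * ?S"
  proof (cases ?S)
    case (real M)
    have sm: "ennreal (cmod (f x) powr p) \<le> ennreal (1 / v) * (\<integral>\<^sup>+y\<in>?B. ennreal (cmod (f y) powr p) \<partial>dV)"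
      if f: "holo_fun \<A> ?B f" for f
    proof -
      have sets: "sets dV = sets borel" using volume unfolding volume_measure_def by blast
      have "ennreal (cmod (f x) powr p) * (ennreal 1 * ennreal v) \<le> (\<integral>\<^sup>+y\<in>?B. ennreal (cmod (f y) powr p) \<partial>dV)"
        unfolding v[symmetric]
        by (rule chart_ball_submean[OF atlas L(1) sets L(3) p_pos \<open>x \<in> U\<close> oB ballB _ f]) simp
      then have "ennreal (1 / v) * (ennreal (cmod (f x) powr p) * (ennreal 1 * ennreal v))
        \<le> ennreal (1 / v) * (\<integral>\<^sup>+y\<in>?B. ennreal (cmod (f y) powr p) \<partial>dV)" by (rule mult_left_mono) simp
      also have "ennreal (1 / v) * (ennreal (cmod (f x) powr p) * (ennreal 1 * ennreal v)) = ennreal (cmod (f x) powr p)"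
        using \<open>v > 0\<close> by (simp add: ennreal_mult[symmetric])
      finally show ?thesis .
    qed
    have "dual_metric E h (u y) \<le> ennreal M" if "y \<in> ?B" for y
      using that unfolding real(2)[symmetric] by (rule SUP_upper)
    then have "hm m (u x) \<le> ennreal ((1 / v) powr (1 / (p * real m)) * M)"
      using \<open>v > 0\<close> real(1) by (intro hm_dual_upper[OF m uB xB] sm) auto
    then show ?thesis unfolding real(2) using real(1) by (simp add: ennreal_mult)
  next
    case top
    show ?thesis unfolding top using \<open>v > 0\<close> by (simp add: ennreal_mult_top)
  qed
  then show ?thesis unfolding mv .
qed

lemma scaled_unit_section:
  assumes "m > 0" and s: "s \<in> Hp \<A> dV p (tensor_power E m) (ht m)" and "0 \<le> k"
    and le: "ennreal k * Lp_norm dV p (ht m) s \<le> 1"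
  shows "(\<lambda>y. vb_scale (tensor_power E m) (of_real k) (s y)) \<in> unit_sections m"
proof -
  let ?t = "\<lambda>y. vb_scale (tensor_power E m) (of_real k) (s y)"
  have hs: "holo_section \<A> (tensor_power E m) UNIV s" using s unfolding Hp_def by simp
  have "ht m (?t y) = ennreal k * ht m (s y)" for y
  proof -
    have "s y \<in> vb_tot (tensor_power E m)" using hs unfolding holo_section_def fiber_def by auto
    moreover have "singular_finsler_metric dV (tensor_power E m) (ht m)"
      using ht[of m] \<open>m > 0\<close> unfolding tensor_power_metric_def by auto
    ultimately show ?thesis using \<open>0 \<le> k\<close> unfolding singular_finsler_metric_def by simp
  qed
  then have "Lp_norm dV p (ht m) ?t \<le> ennreal k * Lp_norm dV p (ht m) s"
    by (rule Lp_norm_scale_le[OF p_pos \<open>0 \<le> k\<close>])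
  then have "Lp_norm dV p (ht m) ?t \<le> 1" using le by (rule order_trans)
  then show ?thesis
    using holo_section_tensor_scaled[OF hs] unfolding unit_sections_def Hp_def
    by (auto intro: le_less_trans)
qed

text \<open>For \<open>0 < h v < \<infinity>\<close> the extension of \<open>v\<^sup>\<otimes>\<^sup>m\<close>, divided by the bound \<open>L\<close> on its norm, competes in the supremum. For
\<open>h v = 0\<close> the extension has norm \<open>0\<close>, all its multiples compete, and the supremum is infinite as soon as
\<open>\<xi> v \<noteq> 0\<close>; for \<open>h v = \<infinity>\<close> the vector contributes \<open>0\<close> to the dual norm.\<close>

lemma hm_dual_lower:
  assumes ext: "multiple_coarse_Lp_extension \<A> dV p E h ht C" and m: "m > 0" and \<xi>: "\<xi> \<in> covectors E x"
  shows "ennreal (C m powr (- 1 / (p * real m))) * dual_metric E h (x, \<xi>) \<le> hm m (x, \<xi>)"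
  unfolding dual_metric_eq_SUP SUP_mult_left_ennreal
proof (rule SUP_least)
  fix v assume v: "v \<in> fiber_nz E x"
  then have vf: "v \<in> fiber E x" unfolding fiber_nz_def by simp
  define a where "a = cmod (\<xi> v)"
  have Cm: "C m > 0" using ext m unfolding multiple_coarse_Lp_extension_def by auto
  show "ennreal (C m powr (- 1 / (p * real m))) * (ennreal (cmod (\<xi> v)) / h v) \<le> hm m (x, \<xi>)"
  proof (cases "h v")
    case (real r)
    show ?thesis
    proof (cases "a = 0")
      case False
      then have "a > 0" by (simp add: a_def)
      have "\<forall>m\<ge>1. \<forall>x. \<forall>a\<in>fiber_nz E x. \<exists>s\<in>Hp \<A> dV p (tensor_power E m) (ht m). s x = vec_tpow E m a \<and>
          epow (Lp_norm dV p (ht m) s) p \<le> ennreal (C m) * epow (h a) (p * real m)"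
        using ext unfolding multiple_coarse_Lp_extension_def by (elim conjE)
      from this[rule_format, OF _ v, of m] m
      obtain s where s: "s \<in> Hp \<A> dV p (tensor_power E m) (ht m)" "s x = vec_tpow E m v"
        and norm: "epow (Lp_norm dV p (ht m) s) p \<le> ennreal (C m) * epow (h v) (p * real m)"
        by auto
      define L where "L = C m powr (1 / p) * r powr real m"
      have "Lp_norm dV p (ht m) s \<le> epow (ennreal (C m) * epow (h v) (p * real m)) (1 / p)"
        using norm by (simp only: epow_le_iff[OF p_pos])
      also have "\<dots> = ennreal L"
        using real Cm p_pos by (simp add: epow_mult powr_powr L_def ennreal_mult)
      finally have L: "Lp_norm dV p (ht m) s \<le> ennreal L" .
      have hs: "holo_section \<A> (tensor_power E m) UNIV s" using s unfolding Hp_def by simp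
      have test: "ennreal (k * a ^ m) \<le> sup_pairing m (x, \<xi>)" if k: "0 \<le> k" "k * L \<le> 1" for k
      proof -
        have "ennreal k * Lp_norm dV p (ht m) s \<le> ennreal k * ennreal L" by (intro mult_left_mono L) simp
        also have "\<dots> = ennreal (k * L)" using k(1) by (simp add: ennreal_mult')
        also have "\<dots> \<le> ennreal 1" by (intro ennreal_leI k)
        finally have "ennreal k * Lp_norm dV p (ht m) s \<le> 1" by simp
        from pairing_le_sup[OF scaled_unit_section[OF m s(1) k(1) this], of "(x, \<xi>)"]
        have "ennreal (cmod (tpairing m (x, \<xi>) (vb_scale (tensor_power E m) (of_real k) (s x)))) \<le> sup_pairing m (x, \<xi>)"
          by simp
        moreover have "tpairing m (x, \<xi>) (vb_scale (tensor_power E m) (of_real k) (s x)) = of_real k * \<xi> v ^ m"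
          using tpairing_vec_tpow[OF vf \<xi>, of m] s(2)
          by (simp add: tpairing_def tensor_power_def case_prod_beta)
        ultimately show ?thesis using k(1) by (simp add: norm_mult norm_power a_def)
      qed
      show ?thesis
      proof (cases "r = 0")
        case True
        then have L0: "L = 0" using m by (simp add: L_def)
        have "sup_pairing m (x, \<xi>) = top"
        proof (rule ccontr)
          assume "sup_pairing m (x, \<xi>) \<noteq> top"
          then obtain b where b: "sup_pairing m (x, \<xi>) = ennreal b" "0 \<le> b" by (cases "sup_pairing m (x, \<xi>)") auto
          \<comment> \<open>As \<open>L = 0\<close>, every multiple is allowed; this one would exceed a finite supremum \<open>b\<close>.\<close>
          have "ennreal ((b + 1) / a ^ m * a ^ m) \<le> ennreal b"
            using test[of "(b + 1) / a ^ m"] b L0 \<open>a > 0\<close> by simp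
          then show False using b \<open>a > 0\<close> by simp
        qed
        then show ?thesis unfolding hm_dual_eq[OF m \<xi>] by simp
      next
        case False
        then have "r > 0" using real by simp
        then have "L > 0" using Cm by (simp add: L_def)
        have "ennreal (1 / L * a ^ m) \<le> sup_pairing m (x, \<xi>)" using \<open>L > 0\<close> by (intro test) auto
        then have "epow (ennreal (1 / L * a ^ m)) (1 / real m) \<le> hm m (x, \<xi>)"
          unfolding hm_dual_eq[OF m \<xi>] by (intro epow_mono) auto
        moreover have "(1 / L * a ^ m) powr (1 / real m) = C m powr (- 1 / (p * real m)) * (a / r)"
        proof -
          have "(1 / L * a ^ m) powr (1 / real m) = (a powr real m) powr (1 / real m) / L powr (1 / real m)"
            using \<open>a > 0\<close> \<open>L > 0\<close> by (simp add: powr_divide powr_realpow)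
          also have "\<dots> = a / (C m powr (1 / (p * real m)) * r)"
            using \<open>a > 0\<close> \<open>r > 0\<close> Cm m by (simp add: L_def powr_mult powr_powr)
          also have "\<dots> = C m powr (- 1 / (p * real m)) * (a / r)"
            by (simp add: powr_minus_divide)
          finally show ?thesis .
        qed
        ultimately show ?thesis
          using real \<open>r > 0\<close> \<open>a > 0\<close> \<open>L > 0\<close> by (simp add: a_def[symmetric] divide_ennreal ennreal_mult[symmetric])
      qed
    qed (simp add: a_def)
  qed simp
qed

lemma hm_dual_scale:
  assumes m: "m > 0" and \<xi>: "\<xi> \<in> covectors E x"
  shows "hm m (x, \<lambda>e. c * \<xi> e) = ennreal (cmod c) * hm m (x, \<xi>)"
proof -
  have "sup_pairing m (x, \<lambda>e. c * \<xi> e) = ennreal (cmod c ^ m) * sup_pairing m (x, \<xi>)"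
    unfolding sup_pairing_def SUP_mult_left_ennreal
  proof (rule SUP_cong[OF refl])
    fix s assume "s \<in> unit_sections m"
    then have "snd (s x) \<in> tensors E m x" using holo_section_tensorD(2)[OF unit_sectionsD(1)] by blast
    from tpairing_scale[OF \<xi> this, of c "fst (s x)"]
    show "ennreal (cmod (tpairing m (x, \<lambda>e. c * \<xi> e) (s (fst (x, \<lambda>e. c * \<xi> e))))) =
        ennreal (cmod c ^ m) * ennreal (cmod (tpairing m (x, \<xi>) (s (fst (x, \<xi>)))))"
      by (simp add: norm_mult norm_power ennreal_mult)
  qed
  moreover have "(cmod c ^ m) powr (1 / real m) = cmod c"
    using m by (cases "c = 0") (simp_all add: powr_realpow[symmetric] powr_powr)
  ultimately show ?thesis
    using m by (simp add: hm_dual_eq[OF m \<xi>] hm_dual_eq[OF m covectors_scaled[OF \<xi>]] epow_mult)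
qed

text \<open>Positivity comes from the lower bound: where \<open>h\<close> is finite, the dual norm of a nonzero covector is positive.\<close>

lemma singular_finsler_metric_hm:
  assumes ext: "multiple_coarse_Lp_extension \<A> dV p E h ht C" and m: "m > 0"
    and h: "singular_finsler_metric dV E h"
  shows "singular_finsler_metric dV (dual_bundle E) (hm m)"
  unfolding singular_finsler_metric_def
proof (intro conjI ballI allI)
  fix v c assume "v \<in> vb_tot (dual_bundle E)"
  then obtain x \<xi> where "v = (x, \<xi>)" "\<xi> \<in> covectors E x" unfolding dual_bundle_def by auto
  then show "hm m (vb_scale (dual_bundle E) c v) = ennreal (cmod c) * hm m v"
    using hm_dual_scale[OF m] by (simp add: dual_bundle_def)
next
  have "hm m v < \<infinity>" if "v \<in> fiber (dual_bundle E) x" for x v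
    using that sup_pairing_finite[OF m] unfolding fiber_dual by (auto simp: hm_dual_eq[OF m] epow_less_top_iff)
  then show "AE x in dV. \<forall>v\<in>fiber (dual_bundle E) x. hm m v < \<infinity>" by simp
next
  have pos: "hm m v > 0" if fin: "\<forall>v\<in>fiber E x. h v < \<infinity>" and v: "v \<in> fiber_nz (dual_bundle E) x" for x v
  proof -
    obtain \<xi> where v': "v = (x, \<xi>)" "\<xi> \<in> covectors E x" and "v \<noteq> vb_scale (dual_bundle E) 0 v"
      using v unfolding fiber_nz_def fiber_dual by auto
    then have "\<xi> \<noteq> (\<lambda>e. 0)" by (simp add: dual_bundle_def)
    then obtain e where e: "\<xi> e \<noteq> 0" by auto
    then have ef: "e \<in> fiber E x" using covectors_outside[OF v'(2)] by blast
    have "\<xi> (vb_scale E 0 e) = 0" using covectors_scale[OF v'(2) ef, of 0] by simp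
    then have "e \<in> fiber_nz E x" using ef e unfolding fiber_nz_def by auto
    then have "ennreal (cmod (\<xi> e)) / h e \<le> dual_metric E h (x, \<xi>)"
      unfolding dual_metric_eq_SUP by (rule SUP_upper)
    moreover have "0 < ennreal (cmod (\<xi> e)) / h e"
      using e fin ef by (auto simp: ennreal_zero_less_divide)
    ultimately have "0 < dual_metric E h (x, \<xi>)" by (rule less_le_trans[rotated])
    moreover have "C m > 0" using ext m unfolding multiple_coarse_Lp_extension_def by auto
    ultimately have "0 < ennreal (C m powr (- 1 / (p * real m))) * dual_metric E h (x, \<xi>)"
      by (simp add: ennreal_zero_less_mult_iff)
    then show ?thesis using hm_dual_lower[OF ext m v'(2)] unfolding v'(1) by (rule less_le_trans)
  qed
  have "AE x in dV. \<forall>v\<in>fiber E x. h v < \<infinity>" using h unfolding singular_finsler_metric_def by blast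
  then show "AE x in dV. \<forall>v\<in>fiber_nz (dual_bundle E) x. hm m v > 0"
    by (rule AE_mp) (use pos in auto)
qed

text \<open>The upper bound near \<open>x0\<close>, on a neighbourhood where the dual norm stays below \<open>M\<close>; it gives both the limit at
\<open>x0\<close> and the domination on compact sets.\<close>

lemma hm_dual_local_upper:
  assumes u: "holo_section \<A> (dual_bundle E) W u" and x0: "x0 \<in> W"
    and M: "dual_metric E h (u x0) < ennreal M"
  obtains N \<kappa> where "open N" "x0 \<in> N" "N \<subseteq> W" "\<kappa> > 0"
    "\<And>x. x \<in> N \<Longrightarrow> dual_metric E h (u x) < ennreal M"
    "\<And>m x. m > 0 \<Longrightarrow> x \<in> N \<Longrightarrow> hm m (u x) \<le> ennreal (\<kappa> powr (1 / (p * real m)) * M)"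
proof -
  have "M > 0" using M by (metis ennreal_neg not_less not_less_zero)
  obtain W' where W': "open W'" "x0 \<in> W'" "W' \<subseteq> W" "\<And>y. y \<in> W' \<Longrightarrow> dual_metric E h (u y) < ennreal M"
    using usc_onD[OF dual_usc[OF u] holo_section_dualD(1)[OF u] x0 M] by metis
  obtain N \<kappa> where N: "open N" "x0 \<in> N" "N \<subseteq> W'" "\<kappa> > 0"
    and sub: "\<And>f q x. holo_fun \<A> W' f \<Longrightarrow> q > 0 \<Longrightarrow> x \<in> N \<Longrightarrow>
       ennreal (cmod (f x) powr q) \<le> ennreal \<kappa> * (\<integral>\<^sup>+y\<in>W'. ennreal (cmod (f y) powr q) \<partial>dV)"
    using local_submean[OF atlas volume W'(2,1)] by blast
  show thesis
  proof (rule that[OF N(1,2) _ N(4)])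
    fix m :: nat and x assume "m > 0" "x \<in> N"
    then show "hm m (u x) \<le> ennreal (\<kappa> powr (1 / (p * real m)) * M)"
      using N W' p_pos \<open>M > 0\<close>
      by (intro hm_dual_upper[OF _ holo_section_subset[OF u W'(1,3)]] sub) (auto intro: less_imp_le)
  qed (use N W' in auto)
qed

section \<open>Convergence\<close>

lemma tendsto_powr_inverse_index:
  "\<kappa> > 0 \<Longrightarrow> (\<lambda>m. \<kappa> powr (1 / (p * real m))) \<longlonglongrightarrow> 1"
  using p_pos by real_asymp

lemma hm_dual_tendsto:
  assumes ext: "multiple_coarse_Lp_extension \<A> dV p E h ht C"
    and u: "holo_section \<A> (dual_bundle E) W u" and x: "x \<in> W"
  shows "(\<lambda>m. hm m (u x)) \<longlonglongrightarrow> dual_metric E h (u x)"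
proof (rule order_tendstoI)
  let ?D = "dual_metric E h (u x)"
  have ux: "u x = (x, snd (u x))" "snd (u x) \<in> covectors E x"
    using holo_section_dualD(2,3)[OF u x] by (metis prod.collapse)+
  have fin: "?D < top" using dual_usc[OF u] x unfolding usc_on_def by simp
  then obtain d where d: "?D = ennreal d" "0 \<le> d" by (cases ?D) auto
  fix a
  {
    assume a: "a < ?D"
    have "(\<lambda>m. ln (C m) / real m) \<longlonglongrightarrow> 0" and C: "\<And>m. m > 0 \<Longrightarrow> C m > 0"
      using ext unfolding multiple_coarse_Lp_extension_def by auto
    then have "(\<lambda>m. exp (- (ln (C m) / real m) / p) * d) \<longlonglongrightarrow> exp (- 0 / p) * d"
      using p_pos by (intro tendsto_intros) auto
    then have lim: "(\<lambda>m. exp (- (ln (C m) / real m) / p) * d) \<longlonglongrightarrow> d" by simp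
    have powr: "exp (- (ln (C m) / real m) / p) * d = C m powr (- 1 / (p * real m)) * d" if "m > 0" for m
    proof -
      have "- (ln (C m) / real m) / p = - 1 / (p * real m) * ln (C m)" by simp
      then show ?thesis using C[OF that] by (simp only: powr_def) auto
    qed
    have "(\<lambda>m. C m powr (- 1 / (p * real m)) * d) \<longlonglongrightarrow> d"
      using eventually_gt_at_top[of 0] by (rule Lim_transform_eventually[OF lim eventually_mono]) (rule powr)
    then have "(\<lambda>m. ennreal (C m powr (- 1 / (p * real m)) * d)) \<longlonglongrightarrow> ennreal d" by (rule tendsto_ennrealI)
    then have "\<forall>\<^sub>F m in sequentially. a < ennreal (C m powr (- 1 / (p * real m)) * d)"
      using a d by (intro order_tendstoD) auto
    then show "\<forall>\<^sub>F m in sequentially. a < hm m (u x)"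
      using eventually_gt_at_top[of 0]
    proof eventually_elim
      case (elim m)
      have "ennreal (C m powr (- 1 / (p * real m)) * d) \<le> hm m (u x)"
        using hm_dual_lower[OF ext elim(2) ux(2)] d ux(1) by (simp add: ennreal_mult)
      then show ?case using elim(1) by (rule less_le_trans[rotated])
    qed
  }
  {
    assume a: "?D < a"
    obtain M where M: "?D < ennreal M" "ennreal M < a"
    proof -
      obtain b where b: "?D < b" "b < a" using dense[OF a] by blast
      then have "b = ennreal (enn2real b)" by (metis ennreal_enn2real less_top_ennreal order.strict_trans top_greatest less_le_trans)
      then show thesis using that[of "enn2real b"] b by simp
    qed
    obtain N \<kappa> where "x \<in> N" "\<kappa> > 0"
      and up: "\<And>m x. m > 0 \<Longrightarrow> x \<in> N \<Longrightarrow> hm m (u x) \<le> ennreal (\<kappa> powr (1 / (p * real m)) * M)"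
      using hm_dual_local_upper[OF u x M(1)] by metis
    have "(\<lambda>m. \<kappa> powr (1 / (p * real m)) * M) \<longlonglongrightarrow> 1 * M"
      by (intro tendsto_intros tendsto_powr_inverse_index[OF \<open>\<kappa> > 0\<close>])
    then have "(\<lambda>m. ennreal (\<kappa> powr (1 / (p * real m)) * M)) \<longlonglongrightarrow> ennreal M" by (intro tendsto_ennrealI) simp
    then have "\<forall>\<^sub>F m in sequentially. ennreal (\<kappa> powr (1 / (p * real m)) * M) < a"
      using M(2) by (rule order_tendstoD)
    then show "\<forall>\<^sub>F m in sequentially. hm m (u x) < a"
      using eventually_gt_at_top[of 0]
      by eventually_elim (use up \<open>x \<in> N\<close> in \<open>auto intro: le_less_trans\<close>)
  }
qed

text \<open>Uniformity in \<open>m\<close> holds because \<open>\<kappa>\<^sup>1\<^sup>/\<^sup>p\<^sup>m\<close> is at most \<open>(max 1 \<kappa>)\<^sup>1\<^sup>/\<^sup>p\<close>.\<close>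

lemma compact_uniform_bound:
  assumes u: "holo_section \<A> (dual_bundle E) W u" and K: "compact K" "K \<subseteq> W"
  obtains B where "0 \<le> B" "\<And>x. x \<in> K \<Longrightarrow> dual_metric E h (u x) \<le> ennreal B"
    "\<And>m x. m > 0 \<Longrightarrow> x \<in> K \<Longrightarrow> hm m (u x) \<le> ennreal B"
proof -
  have "\<exists>N B. open N \<and> x0 \<in> N \<and> 0 \<le> B \<and> (\<forall>x\<in>N. dual_metric E h (u x) \<le> ennreal B \<and> (\<forall>m>0. hm m (u x) \<le> ennreal B))"
    if x0: "x0 \<in> W" for x0
  proof -
    have "dual_metric E h (u x0) < top" using dual_usc[OF u] x0 unfolding usc_on_def by simp
    then obtain d where "dual_metric E h (u x0) = ennreal d" "0 \<le> d" by (cases "dual_metric E h (u x0)") auto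
    then have "dual_metric E h (u x0) < ennreal (d + 1)" by (simp add: ennreal_less_iff)
    from hm_dual_local_upper[OF u x0 this]
    obtain N \<kappa> where N: "open N" "x0 \<in> N" "\<kappa> > 0"
      and D: "\<And>x. x \<in> N \<Longrightarrow> dual_metric E h (u x) < ennreal (d + 1)"
      and up: "\<And>m x. m > 0 \<Longrightarrow> x \<in> N \<Longrightarrow> hm m (u x) \<le> ennreal (\<kappa> powr (1 / (p * real m)) * (d + 1))" by metis
    \<comment> \<open>A bound for \<open>\<kappa>\<^sup>1\<^sup>/\<^sup>p\<^sup>m\<close> that is valid for all \<open>m \<ge> 1\<close>.\<close>
    define b where "b = max 1 \<kappa> powr (1 / p)"
    have b1: "1 \<le> b" using p_pos unfolding b_def by (intro ge_one_powr_ge_zero) auto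
    have kb: "\<kappa> powr (1 / (p * real m)) \<le> b" if "m > 0" for m
    proof -
      have "\<kappa> powr (1 / (p * real m)) \<le> max 1 \<kappa> powr (1 / (p * real m))"
        using \<open>\<kappa> > 0\<close> p_pos by (intro powr_mono2) auto
      also have "\<dots> \<le> max 1 \<kappa> powr (1 / p)"
        using p_pos that by (intro powr_mono) (auto simp: field_simps)
      finally show ?thesis by (simp add: b_def)
    qed
    have "dual_metric E h (u x) \<le> ennreal (b * (d + 1))" if "x \<in> N" for x
    proof -
      have "ennreal (d + 1) \<le> ennreal (b * (d + 1))"
        using b1 \<open>0 \<le> d\<close> by (intro ennreal_leI) (simp add: mult_le_cancel_right1)
      with D[OF that] show ?thesis by (meson less_imp_le order_trans)
    qed
    moreover have "hm m (u x) \<le> ennreal (b * (d + 1))" if "x \<in> N" "m > 0" for x m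
      using up[OF that(2,1)] kb[OF that(2)] \<open>0 \<le> d\<close>
      by (elim order_trans) (intro ennreal_leI mult_right_mono; simp)
    ultimately show ?thesis using N b1 \<open>0 \<le> d\<close>
      by (intro exI[of _ N] exI[of _ "b * (d + 1)"]) auto
  qed
  then obtain N B where NB: "\<And>x. x \<in> W \<Longrightarrow> open (N x) \<and> x \<in> N x \<and> 0 \<le> B x \<and>
      (\<forall>y\<in>N x. dual_metric E h (u y) \<le> ennreal (B x) \<and> (\<forall>m>0. hm m (u y) \<le> ennreal (B x)))"
    by metis
  obtain D where D: "D \<subseteq> K" "finite D" "K \<subseteq> (\<Union>x\<in>D. N x)"
    using compactE_image[OF K(1), of K N] NB K(2) by blast
  define B' where "B' = (\<Sum>x\<in>D. B x)"
  have B0: "0 \<le> B x" if "x \<in> D" for x using that NB D K by blast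
  have le: "B x \<le> B'" if "x \<in> D" for x
    unfolding B'_def using that B0 D(2) by (intro member_le_sum) auto
  have cover: "\<exists>z\<in>D. y \<in> N z \<and> ennreal (B z) \<le> ennreal B'" if "y \<in> K" for y
    using that D(3) le by (blast intro: ennreal_leI)
  show thesis
  proof (rule that[of B'])
    show "0 \<le> B'" unfolding B'_def using B0 by (rule sum_nonneg)
    fix x assume "x \<in> K"
    then obtain z where z: "z \<in> D" "x \<in> N z" "ennreal (B z) \<le> ennreal B'" using cover by blast
    then have "z \<in> W" using D K by blast
    then show "dual_metric E h (u x) \<le> ennreal B'" using NB z by (meson order_trans)
    fix m :: nat assume "m > 0"
    then show "hm m (u x) \<le> ennreal B'" using NB z \<open>z \<in> W\<close> by (meson order_trans)
  qed
qed

lemma usc_bounded_L1: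
  assumes f: "usc_on W f" and "open W" and K: "compact K" "K \<subseteq> W"
    and B: "\<And>x. x \<in> K \<Longrightarrow> f x \<le> ennreal B"
  shows "(\<lambda>x. indicator K x *\<^sub>R enn2real (f x)) \<in> borel_measurable dV"
    "set_integrable dV K (\<lambda>x. enn2real (f x))"
    "AE x in dV. x \<in> K \<longrightarrow> f x < \<infinity>"
proof -
  have sets: "sets dV = sets borel" using volume unfolding volume_measure_def by blast
  have Kb: "K \<in> sets dV" using K(1) sets by (simp add: borel_compact)
  have "(\<lambda>x. enn2real (if x \<in> W then f x else 0)) \<in> borel_measurable borel"
    using usc_on_borel_measurable[OF f \<open>open W\<close>] by (rule measurable_compose) simp
  then have "(\<lambda>x. indicator K x *\<^sub>R enn2real (if x \<in> W then f x else 0)) \<in> borel_measurable borel"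
    using borel_compact[OF K(1)] by (intro borel_measurable_scaleR borel_measurable_indicator)
  moreover have "(\<lambda>x. indicator K x *\<^sub>R enn2real (if x \<in> W then f x else 0)) = (\<lambda>x. indicator K x *\<^sub>R enn2real (f x))"
  proof
    show "indicator K x *\<^sub>R enn2real (if x \<in> W then f x else 0) = indicator K x *\<^sub>R enn2real (f x)" for x
      using K(2) by (cases "x \<in> K") auto
  qed
  ultimately show meas: "(\<lambda>x. indicator K x *\<^sub>R enn2real (f x)) \<in> borel_measurable dV"
    using measurable_cong_sets[OF sets refl] by metis
  have "integrable dV (\<lambda>x. B * indicator K x)"
    using Kb volume_measure_compact_finite[OF volume K(1)] by (intro integrable_mult_right integrable_real_indicator)
  then show "set_integrable dV K (\<lambda>x. enn2real (f x))"
    unfolding set_integrable_def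
  proof (rule Bochner_Integration.integrable_bound[OF _ meas])
    have "enn2real (f x) \<le> \<bar>B\<bar>" if "x \<in> K" for x
      using enn2real_mono[OF B[OF that]] by (cases "0 \<le> B") (auto simp: ennreal_neg)
    then show "AE x in dV. norm (indicator K x *\<^sub>R enn2real (f x)) \<le> norm (B * indicator K x)"
      by (intro AE_I2) (auto simp: indicator_def)
  qed
  have "f x < \<infinity>" if "x \<in> K" for x using f K(2) that unfolding usc_on_def by blast
  then show "AE x in dV. x \<in> K \<longrightarrow> f x < \<infinity>" by simp
qed

lemma usc_on_hm:
  assumes "m > 0" and u: "holo_section \<A> (dual_bundle E) W u"
  shows "usc_on W (\<lambda>x. hm m (u x))"
proof (rule usc_on_cong)
  show "usc_on W (\<lambda>x. epow (sup_pairing m (u x)) (1 / real m))"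
    using assms by (intro usc_on_epow usc_on_sup_pairing) auto
qed (simp add: hm_dual_section[OF assms])

lemma hm_dual_L1loc_tendsto:
  assumes ext: "multiple_coarse_Lp_extension \<A> dV p E h ht C"
    and u: "holo_section \<A> (dual_bundle E) W u"
  shows "L1loc_tendsto dV W (\<lambda>m x. hm m (u x)) (\<lambda>x. dual_metric E h (u x))"
  unfolding L1loc_tendsto_def
proof (intro conjI allI impI)
  have oW: "open W" by (rule holo_section_dualD(1)[OF u])
  note D = usc_bounded_L1[OF dual_usc[OF u] oW]
  note H = usc_bounded_L1[OF usc_on_hm[OF _ u] oW]
  show "L1loc dV W (\<lambda>x. dual_metric E h (u x))"
    unfolding L1loc_def
  proof (intro allI impI, elim conjE)
    fix K assume K: "compact K" "K \<subseteq> W"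
    obtain B where "\<And>x. x \<in> K \<Longrightarrow> dual_metric E h (u x) \<le> ennreal B"
      using compact_uniform_bound[OF u K] by metis
    from D(2,3)[OF K this]
    show "(AE x in dV. x \<in> K \<longrightarrow> dual_metric E h (u x) < \<infinity>) \<and>
        set_integrable dV K (\<lambda>x. enn2real (dual_metric E h (u x)))" by blast
  qed
  have "L1loc dV W (\<lambda>x. hm m (u x))" if m: "m > 0" for m
    unfolding L1loc_def
  proof (intro allI impI, elim conjE)
    fix K assume K: "compact K" "K \<subseteq> W"
    obtain B where "\<And>x. x \<in> K \<Longrightarrow> hm m (u x) \<le> ennreal B"
      using compact_uniform_bound[OF u K] m by metis
    from H(2,3)[OF m K this]
    show "(AE x in dV. x \<in> K \<longrightarrow> hm m (u x) < \<infinity>) \<and> set_integrable dV K (\<lambda>x. enn2real (hm m (u x)))" by blast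
  qed
  then show "\<forall>\<^sub>F m in sequentially. L1loc dV W (\<lambda>x. hm m (u x))"
    using eventually_gt_at_top[of 0] by (rule eventually_mono[rotated])
  fix K assume "compact K \<and> K \<subseteq> W"
  then have K: "compact K" "K \<subseteq> W" by auto
  obtain B where B: "0 \<le> B" "\<And>x. x \<in> K \<Longrightarrow> dual_metric E h (u x) \<le> ennreal B"
    "\<And>m x. m > 0 \<Longrightarrow> x \<in> K \<Longrightarrow> hm m (u x) \<le> ennreal B"
    using compact_uniform_bound[OF u K] by metis
  have sets: "sets dV = sets borel" using volume unfolding volume_measure_def by blast
  have Kb: "K \<in> sets dV" using K(1) sets by (simp add: borel_compact)
  let ?f = "\<lambda>x. enn2real (dual_metric E h (u x))" and ?g = "\<lambda>m x. enn2real (hm m (u x))"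
  \<comment> \<open>The bounds hold for positive indices only, hence the shift.\<close>
  have "(\<lambda>m. \<integral>x. indicator K x *\<^sub>R \<bar>?g (Suc m) x - ?f x\<bar> \<partial>dV) \<longlonglongrightarrow> (\<integral>x. 0 \<partial>dV)"
  proof (rule integral_dominated_convergence[where w = "\<lambda>x. B * indicator K x"])
    show "integrable dV (\<lambda>x. B * indicator K x)"
      using Kb volume_measure_compact_finite[OF volume K(1)] by (intro integrable_mult_right integrable_real_indicator)
    show "(\<lambda>x. indicator K x *\<^sub>R \<bar>?g (Suc m) x - ?f x\<bar>) \<in> borel_measurable dV" for m
    proof -
      have "(\<lambda>x. \<bar>indicator K x *\<^sub>R ?g (Suc m) x - indicator K x *\<^sub>R ?f x\<bar>) \<in> borel_measurable dV"
        using H(1)[OF _ K B(3), of "Suc m"] D(1)[OF K B(2)] by (intro borel_measurable_abs borel_measurable_diff) auto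
      also have "(\<lambda>x. \<bar>indicator K x *\<^sub>R ?g (Suc m) x - indicator K x *\<^sub>R ?f x\<bar>) = (\<lambda>x. indicator K x *\<^sub>R \<bar>?g (Suc m) x - ?f x\<bar>)"
        by (auto simp: indicator_def)
      finally show ?thesis .
    qed
    show "AE x in dV. norm (indicator K x *\<^sub>R \<bar>?g (Suc m) x - ?f x\<bar>) \<le> B * indicator K x" for m
    proof (intro AE_I2)
      fix x
      have "\<bar>?g (Suc m) x - ?f x\<bar> \<le> B" if "x \<in> K"
      proof -
        have "?f x \<le> B" using enn2real_mono[OF B(2)[OF that]] B(1) by simp
        moreover have "?g (Suc m) x \<le> B" using enn2real_mono[OF B(3)[OF _ that, of "Suc m"]] B(1) by simp
        ultimately show ?thesis
          using enn2real_nonneg[of "hm (Suc m) (u x)"] enn2real_nonneg[of "dual_metric E h (u x)"]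
          unfolding abs_le_iff by linarith
      qed
      then show "norm (indicator K x *\<^sub>R \<bar>?g (Suc m) x - ?f x\<bar>) \<le> B * indicator K x"
        by (auto simp: indicator_def)
    qed
    show "AE x in dV. (\<lambda>m. indicator K x *\<^sub>R \<bar>?g (Suc m) x - ?f x\<bar>) \<longlonglongrightarrow> 0"
    proof (intro AE_I2)
      fix x
      show "(\<lambda>m. indicator K x *\<^sub>R \<bar>?g (Suc m) x - ?f x\<bar>) \<longlonglongrightarrow> 0"
      proof (cases "x \<in> K")
        case True
        then have x: "x \<in> W" using K by blast
        have "dual_metric E h (u x) < top" using dual_usc[OF u] x unfolding usc_on_def by simp
        with hm_dual_tendsto[OF ext u x] have "(\<lambda>m. ?g m x) \<longlonglongrightarrow> ?f x"
          by (intro tendsto_enn2real) simp_all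
        then have "(\<lambda>m. ?g (Suc m) x) \<longlonglongrightarrow> ?f x" by (rule LIMSEQ_Suc)
        then have "(\<lambda>m. \<bar>?g (Suc m) x - ?f x\<bar>) \<longlonglongrightarrow> \<bar>?f x - ?f x\<bar>"
            by (intro tendsto_rabs tendsto_diff tendsto_const)
        then show ?thesis using True by simp
      qed simp
    qed
  qed simp
  then have "(\<lambda>m. \<integral>x. indicator K x *\<^sub>R \<bar>?g (Suc m) x - ?f x\<bar> \<partial>dV) \<longlonglongrightarrow> 0" by simp
  then show "(\<lambda>m. \<integral>x\<in>K. \<bar>?g m x - ?f x\<bar> \<partial>dV) \<longlonglongrightarrow> 0"
    unfolding set_lebesgue_integral_def by (rule LIMSEQ_imp_Suc)
qed

end

section \<open>Approximation of the dual metric\<close>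

theorem theorem1p1:
  fixes \<A> :: "('x::{t2_space, second_countable_topology}, 'n::finite) chart set"
    and dV :: "'x measure"
    and E :: "('x, 'e, 'i) vbundle"
    and h :: "'e \<Rightarrow> ennreal"
    and ht :: "nat \<Rightarrow> 'x \<times> (('e \<Rightarrow> complex) list \<Rightarrow> complex) \<Rightarrow> ennreal"
    and p :: real
    and C :: "nat \<Rightarrow> real"
  assumes "p > 0"
    and "complex_atlas \<A>"
    and "volume_measure \<A> dV"
    and "holomorphic_vector_bundle \<A> E"
    and "singular_finsler_metric dV E h"
    and "\<And>m. m \<ge> 1 \<Longrightarrow> tensor_power_metric dV E h m (ht m)"
    and "\<And>W u. holo_section \<A> (dual_bundle E) W u \<Longrightarrow> usc_on W (\<lambda>x. dual_metric E h (u x))"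
    and "multiple_coarse_Lp_extension \<A> dV p E h ht C"
  shows "(\<forall>m\<ge>1.
           singular_finsler_metric dV (dual_bundle E) (hm_dual \<A> dV p E ht m) \<and>
           griffiths_seminegative \<A> (dual_bundle E) (hm_dual \<A> dV p E ht m) \<and>
           (\<forall>W u. holo_section \<A> (dual_bundle E) W u \<longrightarrow> (\<forall>x\<in>W.
              ennreal (C m powr (- 1 / (p * real m))) * dual_metric E h (u x)
                \<le> hm_dual \<A> dV p E ht m (u x) \<and>
              (\<forall>U \<phi> r. lebesgue_chart \<A> dV (U, \<phi>) \<and> x \<in> U \<and> r > 0 \<and>
                        cball (\<phi> x) r \<subseteq> \<phi> ` (U \<inter> W) \<longrightarrow>
                 hm_dual \<A> dV p E ht m (u x)
                   \<le> ennreal ((1 / measure dV (coord_ball (U, \<phi>) x r)) powr (1 / (p * real m))) *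
                     (SUP y\<in>coord_ball (U, \<phi>) x r. dual_metric E h (u y)))))) \<and>
         (\<forall>W u. holo_section \<A> (dual_bundle E) W u \<longrightarrow>
           (\<forall>x\<in>W. (\<lambda>m. hm_dual \<A> dV p E ht m (u x)) \<longlonglongrightarrow> dual_metric E h (u x)) \<and>
           L1loc_tendsto dV W (\<lambda>m x. hm_dual \<A> dV p E ht m (u x)) (\<lambda>x. dual_metric E h (u x)))"
proof -
  interpret Lp_tensor_setting \<A> E dV p h ht
    by unfold_locales (use assms in auto)
  note ext = \<open>multiple_coarse_Lp_extension \<A> dV p E h ht C\<close>
  have lower: "ennreal (C m powr (- 1 / (p * real m))) * dual_metric E h (u x) \<le> hm m (u x)"
    if "m \<ge> 1" and u: "holo_section \<A> (dual_bundle E) W u" and x: "x \<in> W" for m W u x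
    using hm_dual_lower[OF ext _ holo_section_dualD(3)[OF u x], of m] holo_section_dualD(2)[OF u x] that(1)
    by (metis One_nat_def Suc_le_lessD prod.collapse)
  have upper: "hm m (u x) \<le> ennreal ((1 / measure dV (coord_ball (U, \<phi>) x r)) powr (1 / (p * real m))) *
      (SUP y\<in>coord_ball (U, \<phi>) x r. dual_metric E h (u y))"
    if "m \<ge> 1" and u: "holo_section \<A> (dual_bundle E) W u" and x: "x \<in> W"
      and ch: "lebesgue_chart \<A> dV (U, \<phi>)" "x \<in> U" "r > 0" "cball (\<phi> x) r \<subseteq> \<phi> ` (U \<inter> W)" for m W u x U \<phi> r
    using that ball_subset_cball[of "\<phi> x" r] by (intro hm_dual_upper_coord_ball[OF _ u x ch(1-3)]) auto
  show ?thesis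
    using lower upper singular_finsler_metric_hm[OF ext _ \<open>singular_finsler_metric dV E h\<close>]
      griffiths_seminegative_hm hm_dual_tendsto[OF ext] hm_dual_L1loc_tendsto[OF ext]
    by auto
qed

end
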